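(* Let $n=2$, let $\Omega\subset\mathbb{R}^2$ be a compact convex domain with smooth boundary such that $\partial\Omega$ is strictly convex (its curvature $\kappa$ satisfies $\kappa>0$), let $\Sigma$ be the cylinder over $\partial\Omega$ in the direction $e_3$ in $\mathbb{R}^3_1$, and let $\alpha:\Sigma\to\mathbb{R}$ be a smooth graphical boundary angle (i.e. $\nabla^\Sigma_{e_3}\alpha=0$ on $\Sigma$). Let $\mathbf{F}:M^2\times[0,T)\to\mathbb{R}^3_1$ be a solution of mean curvature flow with $\alpha$-Neumann boundary angle condition (as defined in the context), and let $v=-\langle\nu,e_3\rangle$. Then there exists a time-independent constant $C$, depending only on $M_0$, $\partial\Omega$, $\alpha$ and $\nabla^\Sigma\alpha$ (in particular not on $T$), such that for all time that the flow exists $$v\le C .$$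
   Context: $\mathbb{R}^{n+1}_1$ is Minkowski space with metric $\langle\cdot,\cdot\rangle$, where $\langle e_{n+1},e_{n+1}\rangle=-1$ and $\mathbb{R}^n=e_{n+1}^\perp$ is Euclidean. $\Omega\subset\mathbb{R}^n$ is a compact convex domain with smooth boundary, $\Sigma$ is the cylinder over $\partial\Omega$ in direction $e_{n+1}$, $\mu$ is its outward unit normal, and $\nabla^\Sigma$ is the connection on $\Sigma$. For $n=2$, $\kappa$ is the curvature of $\partial\Omega$ (positive for round circles). Mean curvature flow with $\alpha$-Neumann boundary angle condition: $M^n$ is an $n$-dimensional disk with boundary, and $\mathbf{F}:M^n\times[0,T)\to\mathbb{R}^{n+1}_1$ is a smooth map such that every $\mathbf{F}(\cdot,t)$ is a spacelike embedding, with image $M_t$, and (i) $\langle \frac{d\mathbf{F}}{dt},\nu\rangle=-H$ on $M^n\times[0,T)$; (ii) $\mathbf{F}(\cdot,0)=\mathbf{F}_0$; (iii) $\mathbf{F}(p,t)\in\Sigma$ for $p\in\partial M^n$; (iv) $\langle\nu(p,t),\mu(\mathbf{F}(p,t))\rangle=\alpha(\mathbf{F}(p,t))$ for $p\in\partial M^n$. Here $\nu$ is the smooth timelike unit normal ($\langle\nu,\nu\rangle=-1$) to $M_t$ with the sign such that $v:=-\langle\nu,e_{n+1}\rangle>0$, and $H$ is the trace of the second fundamental form $A(X,Y)=\langle\overline\nabla_X\nu,Y\rangle$ ($\overline\nabla$ is the flat ambient connection). The initial embedding $\mathbf{F}_0$, with image $M_0$, is smooth, spacelike, and compatible: for $p\in\partial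 M^n$, $\mathbf{F}_0(p)\in\Sigma$ and $\langle\nu(p),\mu(\mathbf{F}_0(p))\rangle=\alpha(\mathbf{F}_0(p))$. If $M_t$ is the graph of $u(\cdot,t)$ over $\Omega$, then $v=(1-|Du|^2)^{-1/2}$. *)

theory Defs
  imports "HOL-Analysis.Analysis" "HOL-Library.Extended_Real"
begin

section \<open>Smooth maps\<close>

primrec Ck_on :: "nat \<Rightarrow> 'a::euclidean_space set \<Rightarrow> ('a \<Rightarrow> 'b::real_normed_vector) \<Rightarrow> bool" where
  "Ck_on 0 U f \<longleftrightarrow> continuous_on U f"
| "Ck_on (Suc k) U f \<longleftrightarrow>
     (\<forall>x\<in>U. f differentiable (at x)) \<and> (\<forall>w. Ck_on k U (\<lambda>x. frechet_derivative f (at x) w))"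

text \<open>Smoothness on an arbitrary set (a closed disk, a hypersurface) means that there are local
  smooth extensions to open sets; on an open set this is ordinary smoothness.\<close>

definition smooth_on :: "'a::euclidean_space set \<Rightarrow> ('a \<Rightarrow> 'b::real_normed_vector) \<Rightarrow> bool" where
  "smooth_on S f \<longleftrightarrow>
     (\<forall>x\<in>S. \<exists>U g. open U \<and> x \<in> U \<and> (\<forall>k. Ck_on k U g) \<and> (\<forall>y\<in>S \<inter> U. g y = f y))"


section \<open>Domains with smooth boundary\<close>

definition local_defining_function ::
  "'a::euclidean_space set \<Rightarrow> 'a \<Rightarrow> 'a set \<Rightarrow> ('a \<Rightarrow> real) \<Rightarrow> bool" where
  "local_defining_function \<Omega> x U \<rho> \<longleftrightarrow>
     open U \<and> x \<in> U \<and> smooth_on U \<rho> \<and> (\<forall>y\<in>U. \<not> (GDERIV \<rho> y :> 0)) \<and>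
     \<Omega> \<inter> U = {y \<in> U. \<rho> y \<le> 0}"

definition smooth_boundary :: "'a::euclidean_space set \<Rightarrow> bool" where
  "smooth_boundary \<Omega> \<longleftrightarrow> (\<forall>x\<in>frontier \<Omega>. \<exists>U \<rho>. local_defining_function \<Omega> x U \<rho>)"

definition smooth_convex_domain :: "'a::euclidean_space set \<Rightarrow> bool" where
  "smooth_convex_domain \<Omega> \<longleftrightarrow>
     compact \<Omega> \<and> convex \<Omega> \<and> interior \<Omega> \<noteq> {} \<and> smooth_boundary \<Omega>"

text \<open>At a point of a smooth boundary the gradients of any two local defining functions are
  positive multiples of each other, so the description is unique.\<close>

definition outward_normal :: "'a::euclidean_space set \<Rightarrow> 'a \<Rightarrow> 'a" where
  "outward_normal \<Omega> x =
     (THE N. \<exists>U \<rho> g. local_defining_function \<Omega> x U \<rho> \<and> GDERIV \<rho> x :> g \<and> N = g /\<^sub>R norm g)"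

text \<open>For a unit-speed parametrization \<open>\<gamma>\<close> of the boundary curve, \<open>\<gamma>'' = - \<kappa> N\<close> with \<open>N\<close> the
  outward normal. This does not depend on \<open>\<gamma>\<close>, and a disk of radius \<open>r\<close> has curvature \<open>1 / r\<close>.\<close>

definition boundary_curvature :: "(real^2) set \<Rightarrow> real^2 \<Rightarrow> real" where
  "boundary_curvature \<Omega> x =
     (THE k. \<exists>\<epsilon>>0. \<exists>\<gamma>. smooth_on {-\<epsilon><..<\<epsilon>} \<gamma> \<and> \<gamma> ` {-\<epsilon><..<\<epsilon>} \<subseteq> frontier \<Omega> \<and> \<gamma> 0 = x \<and>
        (\<forall>s\<in>{-\<epsilon><..<\<epsilon>}. norm (vector_derivative \<gamma> (at s)) = 1) \<and>
        k = - (vector_derivative (\<lambda>s. vector_derivative \<gamma> (at s)) (at 0) \<bullet> outward_normal \<Omega> x))"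


section \<open>Minkowski space and the cylinder\<close>

text \<open>The Minkowski space of dimension \<open>n + 1\<close> is \<open>(real^'n) \<times> real\<close>; the second component is
  the coordinate in the timelike direction.\<close>

definition mink :: "(real^'n) \<times> real \<Rightarrow> (real^'n) \<times> real \<Rightarrow> real" where
  "mink X Y = fst X \<bullet> fst Y - snd X * snd Y"

definition e_time :: "(real^'n) \<times> real" where
  "e_time = (0, 1)"

definition cylinder :: "(real^'n) set \<Rightarrow> ((real^'n) \<times> real) set" where
  "cylinder \<Omega> = frontier \<Omega> \<times> UNIV"

definition cylinder_normal :: "(real^'n) set \<Rightarrow> (real^'n) \<times> real \<Rightarrow> (real^'n) \<times> real" where
  "cylinder_normal \<Omega> q = (outward_normal \<Omega> (fst q), 0)"

text \<open>The lines in direction \<open>e_time\<close> through points of the cylinder lie in the cylinder, so the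
  derivative below is the intrinsic derivative of \<open>\<alpha>\<close> along \<open>e_time\<close>.\<close>

definition graphical_angle :: "(real^'n) set \<Rightarrow> ((real^'n) \<times> real \<Rightarrow> real) \<Rightarrow> bool" where
  "graphical_angle \<Omega> \<alpha> \<longleftrightarrow>
     (\<forall>q\<in>cylinder \<Omega>. ((\<lambda>s. \<alpha> (q + s *\<^sub>R e_time)) has_real_derivative 0) (at 0))"


section \<open>Spacelike disks\<close>

abbreviation disk :: "(real^'n) set" where
  "disk \<equiv> cball 0 1"

text \<open>At boundary points of the disk, derivatives are taken within the disk. They are unique
  there because the disk is convex with nonempty interior.\<close>

definition tangent_map ::
  "(real^'n \<Rightarrow> (real^'n) \<times> real) \<Rightarrow> real^'n \<Rightarrow> real^'n \<Rightarrow> (real^'n) \<times> real" where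
  "tangent_map f p = frechet_derivative f (at p within disk)"

definition first_fundamental_form ::
  "(real^'n \<Rightarrow> (real^'n) \<times> real) \<Rightarrow> real^'n \<Rightarrow> real^'n \<Rightarrow> real^'n \<Rightarrow> real" where
  "first_fundamental_form f p w z = mink (tangent_map f p w) (tangent_map f p z)"

text \<open>Positive definiteness of the induced metric makes \<open>f\<close> an immersion; since the disk is
  compact, an injective immersion of it is an embedding.\<close>

definition spacelike_embedding :: "(real^'n \<Rightarrow> (real^'n) \<times> real) \<Rightarrow> bool" where
  "spacelike_embedding f \<longleftrightarrow>
     smooth_on disk f \<and> inj_on f disk \<and>
     (\<forall>p\<in>disk. \<forall>w. w \<noteq> 0 \<longrightarrow> 0 < first_fundamental_form f p w w)"

text \<open>The orthogonal complement of a spacelike tangent space of dimension \<open>n\<close> is a timelike line,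
  so exactly one unit normal satisfies the sign condition.\<close>

definition unit_normal :: "(real^'n \<Rightarrow> (real^'n) \<times> real) \<Rightarrow> real^'n \<Rightarrow> (real^'n) \<times> real" where
  "unit_normal f p =
     (THE \<nu>. mink \<nu> \<nu> = -1 \<and> (\<forall>w. mink \<nu> (tangent_map f p w) = 0) \<and> 0 < - mink \<nu> e_time)"

definition gradient_function :: "(real^'n \<Rightarrow> (real^'n) \<times> real) \<Rightarrow> real^'n \<Rightarrow> real" where
  "gradient_function f p = - mink (unit_normal f p) e_time"

text \<open>As the ambient connection is flat, the derivative of the normal along \<open>f\<close> is the ordinary
  derivative of the vector-valued map \<open>unit_normal f\<close>.\<close>

definition second_fundamental_form ::
  "(real^'n \<Rightarrow> (real^'n) \<times> real) \<Rightarrow> real^'n \<Rightarrow> real^'n \<Rightarrow> real^'n \<Rightarrow> real" where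
  "second_fundamental_form f p w z =
     mink (frechet_derivative (unit_normal f) (at p within disk) w) (tangent_map f p z)"

text \<open>The trace is taken with respect to the induced metric: \<open>H = g\<^sup>i\<^sup>j A\<^sub>i\<^sub>j\<close>.\<close>

definition mean_curvature :: "(real^'n \<Rightarrow> (real^'n) \<times> real) \<Rightarrow> real^'n \<Rightarrow> real" where
  "mean_curvature f p =
     trace (matrix_inv (\<chi> i j. first_fundamental_form f p (axis i 1) (axis j 1)) **
            (\<chi> i j. second_fundamental_form f p (axis i 1) (axis j 1)))"


section \<open>Mean curvature flow with a Neumann boundary angle condition\<close>

definition boundary_angle_condition ::
  "(real^'n) set \<Rightarrow> ((real^'n) \<times> real \<Rightarrow> real) \<Rightarrow> (real^'n \<Rightarrow> (real^'n) \<times> real) \<Rightarrow> bool" where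
  "boundary_angle_condition \<Omega> \<alpha> f \<longleftrightarrow>
     (\<forall>p\<in>sphere 0 1. f p \<in> cylinder \<Omega> \<and>
        mink (unit_normal f p) (cylinder_normal \<Omega> (f p)) = \<alpha> (f p))"

definition compatible_initial_embedding ::
  "(real^'n) set \<Rightarrow> ((real^'n) \<times> real \<Rightarrow> real) \<Rightarrow> (real^'n \<Rightarrow> (real^'n) \<times> real) \<Rightarrow> bool" where
  "compatible_initial_embedding \<Omega> \<alpha> F\<^sub>0 \<longleftrightarrow>
     spacelike_embedding F\<^sub>0 \<and> boundary_angle_condition \<Omega> \<alpha> F\<^sub>0"

text \<open>The final time may be infinite.\<close>

definition time_interval :: "ereal \<Rightarrow> real set" where
  "time_interval T = {t. 0 \<le> t \<and> ereal t < T}"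

definition mcf_neumann ::
  "(real^'n) set \<Rightarrow> ((real^'n) \<times> real \<Rightarrow> real) \<Rightarrow> (real^'n \<Rightarrow> (real^'n) \<times> real) \<Rightarrow>
   ereal \<Rightarrow> (real^'n \<Rightarrow> real \<Rightarrow> (real^'n) \<times> real) \<Rightarrow> bool" where
  "mcf_neumann \<Omega> \<alpha> F\<^sub>0 T F \<longleftrightarrow>
     0 < T \<and>
     smooth_on (disk \<times> time_interval T) (\<lambda>(p, t). F p t) \<and>
     (\<forall>t\<in>time_interval T. spacelike_embedding (\<lambda>p. F p t)) \<and>
     (\<forall>t\<in>time_interval T. \<forall>p\<in>disk.
        mink (vector_derivative (F p) (at t within time_interval T)) (unit_normal (\<lambda>p. F p t) p)
          = - mean_curvature (\<lambda>p. F p t) p) \<and>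
     (\<forall>p\<in>disk. F p 0 = F\<^sub>0 p) \<and>
     (\<forall>t\<in>time_interval T. boundary_angle_condition \<Omega> \<alpha> (\<lambda>p. F p t))"

end

(* Locally the flow is a spacelike graph of a function u over the plane domain with
   u_t = (delta^ij + v^2 u_i u_j) u_ij, and H / v = u_t.

   First, u_t is bounded by its initial values. For a derivative f = D_e u in a fixed space-time
   direction e, a spatial maximum over the closed domain with Df = 0 satisfies f_t <= 0, even at a
   boundary point: when Df = 0 the Hessian is nonpositive in all inward directions, hence in all
   directions. So max (u_t - eps t) can only be attained initially: at a boundary maximum the time
   derivative of the angle condition v (Du . N) = alpha is an oblique condition that gives D u_t = 0,
   and no Hopf lemma is needed.

   Second, consider a maximum of |Du|^2 - eps t. In the interior, apply the first principle to
   f = q . Du with q the value of Du there. On the boundary, the tangential derivative of the angle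
   condition together with the bound on u_t shows that the outward derivative of |Du|^2 would be
   negative if v were large, because the curvature of the boundary is bounded below.

   The initial values of u_t and v depend on M_0 only, since two flows from M_0 are locally graphs of
   the same function at time 0. *)
theory Submission
  imports Defs
begin

section \<open>Calculus of smooth maps\<close>

text \<open>The flow is given only as a family of embedded disks: it is not known to be a global
  graph, and its points may also move tangentially. Hence all estimates are local. Near each
  parameter point a smooth extension of \<open>F\<close>, past the edge of the disk and past t = 0,
  is inverted in its horizontal part; this gives \<open>u\<close> on an open set of space-time, with
  two-sided derivatives. The price is that the equation for \<open>u\<close> is known only on the
  image of \<open>disk \<times> I\<close>. It can still be differentiated at edge points, because a
  function that vanishes on a convex set with interior has zero derivative there in every direction.

  A derivative of \<open>u\<close> in a fixed direction is the right object because, where its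
  gradient vanishes, the coefficients of the equation are stationary in that direction: only second
  order terms survive the linearization.

  In the final constant, \<open>A\<close> bounds the angle and its derivative, \<open>k\<close>
  bounds the curvature from below and \<open>C\<close> bounds u_t. On the boundary, 2 (1 + A^2)
  makes Du mostly tangential, 4 A / k lets the curvature beat the derivative of the angle, and 4 A C
  / k lets it beat u_t.\<close>

definition ddir :: "'a::euclidean_space \<Rightarrow> ('a \<Rightarrow> 'b::real_normed_vector) \<Rightarrow> 'a \<Rightarrow> 'b" where
  "ddir w f = (\<lambda>x. frechet_derivative f (at x) w)"

text \<open>Ordinary smoothness, with full derivatives at the points of \<open>U\<close> instead of
  local extensions. Data that are \<open>smooth_on\<close> are passed to this notion on an open set
  before they are differentiated.\<close>

definition smooth_in :: "'a::euclidean_space set \<Rightarrow> ('a \<Rightarrow> 'b::real_normed_vector) \<Rightarrow> bool" where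
  "smooth_in U f \<longleftrightarrow> (\<forall>k. Ck_on k U f)"

lemma Ck_on_Suc: "Ck_on (Suc k) U f \<longleftrightarrow> (\<forall>x\<in>U. f differentiable (at x)) \<and> (\<forall>w. Ck_on k U (ddir w f))"
  by (simp add: ddir_def)

declare Ck_on.simps(2)[simp del]

lemma ddir_eqI: "(f has_derivative D) (at x) \<Longrightarrow> ddir w f x = D w"
  unfolding ddir_def by (metis frechet_derivative_at)

lemma Ck_on_Suc_has_derivative:
  assumes "Ck_on (Suc k) U f" "x \<in> U"
  shows "(f has_derivative (\<lambda>w. ddir w f x)) (at x)"
  using assms unfolding Ck_on_Suc ddir_def by (simp add: frechet_derivative_works)

lemma Ck_on_cong:
  assumes "open U" "\<And>x. x \<in> U \<Longrightarrow> f x = g x"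
  shows "Ck_on k U f \<longleftrightarrow> Ck_on k U g"
proof -
  have "Ck_on k U g" if "Ck_on k U f" "\<And>x. x \<in> U \<Longrightarrow> f x = g x" for f g :: "'a \<Rightarrow> 'b"
    using that
  proof (induction k arbitrary: f g)
    case 0
    then show ?case by (auto intro: continuous_on_eq)
  next
    case (Suc k)
    have D: "(g has_derivative (\<lambda>w. ddir w f x)) (at x)" if "x \<in> U" for x
      by (rule has_derivative_transform_within_open[OF Ck_on_Suc_has_derivative[OF Suc.prems(1) that] assms(1) that])
        (use Suc.prems in auto)
    show ?case unfolding Ck_on_Suc
    proof (intro conjI ballI allI)
      show "g differentiable at x" if "x \<in> U" for x
        by (rule Derivative.differentiableI[OF D[OF that]])
      show "Ck_on k U (ddir w g)" for w
        by (rule Suc.IH[of "ddir w f"]) (use Suc.prems(1) in \<open>auto simp: Ck_on_Suc ddir_eqI[OF D]\<close>)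
    qed
  qed
  then show ?thesis using assms by metis
qed

lemma Ck_on_subset: "Ck_on k U f \<Longrightarrow> V \<subseteq> U \<Longrightarrow> Ck_on k V f"
  by (induction k arbitrary: f) (auto simp: Ck_on_Suc intro: continuous_on_subset)

lemma Ck_on_Suc_imp: "Ck_on (Suc k) U f \<Longrightarrow> Ck_on k U f"
proof (induction k arbitrary: f)
  case 0
  then show ?case
    by (simp add: Ck_on_Suc differentiable_at_imp_differentiable_on differentiable_imp_continuous_on)
next
  case (Suc k)
  have "Ck_on k U (ddir w f)" for w
    using Suc.IH Suc.prems unfolding Ck_on_Suc[of "Suc k"] by blast
  then show ?case using Suc.prems unfolding Ck_on_Suc[of _ _ f] by blast
qed

text \<open>Any explicit formula for the derivatives may serve, so each closure property below
  reduces to its differentiation rule and the induction hypothesis.\<close>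

lemma Ck_on_SucI:
  assumes "open U" "\<And>x. x \<in> U \<Longrightarrow> (f has_derivative (\<lambda>w. D w x)) (at x)" "\<And>w. Ck_on k U (D w)"
  shows "Ck_on (Suc k) U f"
proof -
  have "Ck_on k U (ddir w f)" for w
    by (subst Ck_on_cong[OF assms(1), where g="D w"]) (auto intro: assms(3) ddir_eqI assms(2))
  with assms(2) show ?thesis unfolding Ck_on_Suc by (auto intro: Derivative.differentiableI)
qed

lemma Ck_on_const: "Ck_on k U (\<lambda>x. c)"
  by (induction k arbitrary: c) (auto simp: Ck_on_Suc ddir_def)

lemma Ck_on_linear:
  assumes "open U" "bounded_linear L" "Ck_on k U f"
  shows "Ck_on k U (\<lambda>x. L (f x))"
  using assms(3)
proof (induction k arbitrary: f)
  case 0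
  then show ?case by (auto intro: bounded_linear.continuous_on[OF assms(2)])
next
  case (Suc k)
  show ?case
    by (rule Ck_on_SucI[OF assms(1), where D="\<lambda>w x. L (ddir w f x)"])
      (use Suc.IH Suc.prems in \<open>auto intro!: bounded_linear.has_derivative[OF assms(2)]
        Ck_on_Suc_has_derivative[OF Suc.prems] simp: Ck_on_Suc\<close>)
qed

lemma Ck_on_add:
  assumes "open U" "Ck_on k U f" "Ck_on k U g"
  shows "Ck_on k U (\<lambda>x. f x + g x)"
  using assms(2,3)
proof (induction k arbitrary: f g)
  case 0
  then show ?case by (auto intro: continuous_intros)
next
  case (Suc k)
  show ?case
    by (rule Ck_on_SucI[OF assms(1), where D="\<lambda>w x. ddir w f x + ddir w g x"])
      (use Suc.IH Suc.prems in \<open>auto intro!: has_derivative_add Ck_on_Suc_has_derivative[OF Suc.prems(1)]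
        Ck_on_Suc_has_derivative[OF Suc.prems(2)] simp: Ck_on_Suc\<close>)
qed

lemma Ck_on_sum:
  assumes "open U" "\<And>i. i \<in> I \<Longrightarrow> Ck_on k U (f i)"
  shows "Ck_on k U (\<lambda>x. \<Sum>i\<in>I. f i x)"
  using assms(2) by (induction I rule: infinite_finite_induct) (simp_all add: Ck_on_const Ck_on_add[OF assms(1)])

text \<open>In each term of the product rule one factor stays undifferentiated;
  \<open>Ck_on_Suc_imp\<close> lowers its order so that the induction hypothesis applies to
  it.\<close>

lemma Ck_on_bilinear:
  assumes "open U" "bounded_bilinear B" "Ck_on k U f" "Ck_on k U g"
  shows "Ck_on k U (\<lambda>x. B (f x) (g x))"
  using assms(3,4)
proof (induction k arbitrary: f g)
  case 0
  then show ?case by (auto intro: bounded_bilinear.continuous_on[OF assms(2)])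
next
  case (Suc k)
  note * = Ck_on_Suc_imp[OF Suc.prems(1)] Ck_on_Suc_imp[OF Suc.prems(2)]
  show ?case
    by (rule Ck_on_SucI[OF assms(1), where D="\<lambda>w x. B (f x) (ddir w g x) + B (ddir w f x) (g x)"])
      (use Suc.IH Suc.prems * in \<open>auto intro!: bounded_bilinear.FDERIV[OF assms(2)] Ck_on_add[OF assms(1)]
        Ck_on_Suc_has_derivative[OF Suc.prems(1)] Ck_on_Suc_has_derivative[OF Suc.prems(2)] simp: Ck_on_Suc\<close>)
qed

text \<open>In the chain rule the outer derivative is taken in the direction
  \<open>ddir w g x\<close>, which varies with \<open>x\<close>. Expanding it in the basis leaves
  derivatives in fixed directions, to which induction on the order applies.\<close>

lemma ddir_Basis_sum:
  fixes f :: "'a::euclidean_space \<Rightarrow> 'b::real_normed_vector"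
  assumes "f differentiable (at x)"
  shows "ddir w f x = (\<Sum>b\<in>Basis. (w \<bullet> b) *\<^sub>R ddir b f x)"
proof -
  interpret linear "\<lambda>w. ddir w f x"
    unfolding ddir_def using assms by (rule linear_frechet_derivative)
  have "ddir w f x = ddir (\<Sum>b\<in>Basis. (w \<bullet> b) *\<^sub>R b) f x" by (simp add: euclidean_representation)
  then show ?thesis by (simp add: sum scaleR)
qed

lemma Ck_on_compose:
  fixes f :: "'b::euclidean_space \<Rightarrow> 'c::real_normed_vector" and g :: "'a::euclidean_space \<Rightarrow> 'b"
  assumes "open U" "open V" "g ` U \<subseteq> V" "Ck_on k U g" "Ck_on k V f"
  shows "Ck_on k U (\<lambda>x. f (g x))"
  using assms(4,5)
proof (induction k arbitrary: f)
  case 0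
  then show ?case using assms(3) by (auto intro: continuous_on_compose2)
next
  case (Suc k)
  have gk: "Ck_on k U g" by (rule Ck_on_Suc_imp[OF Suc.prems(1)])
  have D: "((\<lambda>x. f (g x)) has_derivative (\<lambda>w. ddir (ddir w g x) f (g x))) (at x)" if "x \<in> U" for x
    using diff_chain_at[OF Ck_on_Suc_has_derivative[OF Suc.prems(1) that]
        Ck_on_Suc_has_derivative[OF Suc.prems(2), of "g x"]] that assms(3)
    by (auto simp: o_def)
  show ?case
  proof (rule Ck_on_SucI[OF assms(1),
        where D="\<lambda>w x. \<Sum>b\<in>Basis. (ddir w g x \<bullet> b) *\<^sub>R ddir b f (g x)"])
    show "((\<lambda>x. f (g x)) has_derivative (\<lambda>w. \<Sum>b\<in>Basis. (ddir w g x \<bullet> b) *\<^sub>R ddir b f (g x))) (at x)"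
      if "x \<in> U" for x
    proof (rule has_derivative_eq_rhs[OF D[OF that]], rule ext)
      have "f differentiable at (g x)" using Suc.prems(2) that assms(3) by (auto simp: Ck_on_Suc)
      then show "ddir (ddir w g x) f (g x) = (\<Sum>b\<in>Basis. (ddir w g x \<bullet> b) *\<^sub>R ddir b f (g x))" for w
        by (rule ddir_Basis_sum)
    qed
    show "Ck_on k U (\<lambda>x. \<Sum>b\<in>Basis. (ddir w g x \<bullet> b) *\<^sub>R ddir b f (g x))" for w
    proof (intro Ck_on_sum[OF assms(1)] Ck_on_bilinear[OF assms(1) bounded_bilinear_scaleR])
      show "Ck_on k U (\<lambda>x. ddir w g x \<bullet> b)" for b
        using Suc.prems(1) by (intro Ck_on_linear[OF assms(1) bounded_linear_inner_left]) (auto simp: Ck_on_Suc)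
      show "Ck_on k U (\<lambda>x. ddir b f (g x))" for b
        using Suc.prems(2) by (intro Suc.IH[OF gk]) (auto simp: Ck_on_Suc)
    qed
  qed
qed

lemma smooth_inD: "smooth_in U f \<Longrightarrow> x \<in> U \<Longrightarrow> (f has_derivative (\<lambda>w. ddir w f x)) (at x)"
  unfolding smooth_in_def using Ck_on_Suc_has_derivative by blast

lemma smooth_in_differentiable: "smooth_in U f \<Longrightarrow> x \<in> U \<Longrightarrow> f differentiable (at x)"
  using smooth_inD Derivative.differentiableI by blast

lemma smooth_in_ddir: "smooth_in U f \<Longrightarrow> smooth_in U (ddir w f)"
  unfolding smooth_in_def using Ck_on_Suc by blast

lemma smooth_in_continuous: "smooth_in U f \<Longrightarrow> continuous_on U f"
  unfolding smooth_in_def using Ck_on.simps(1) by blast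

lemma smooth_in_isCont: "smooth_in U f \<Longrightarrow> x \<in> U \<Longrightarrow> isCont f x"
  using has_derivative_continuous smooth_inD by blast

lemma smooth_in_subset: "smooth_in U f \<Longrightarrow> V \<subseteq> U \<Longrightarrow> smooth_in V f"
  unfolding smooth_in_def using Ck_on_subset by blast

lemma smooth_in_cong: "open U \<Longrightarrow> (\<And>x. x \<in> U \<Longrightarrow> f x = g x) \<Longrightarrow> smooth_in U f \<longleftrightarrow> smooth_in U g"
  unfolding smooth_in_def using Ck_on_cong by blast

lemma smooth_in_const: "smooth_in U (\<lambda>x. c)"
  unfolding smooth_in_def using Ck_on_const by blast

lemma smooth_in_linear: "open U \<Longrightarrow> bounded_linear L \<Longrightarrow> smooth_in U f \<Longrightarrow> smooth_in U (\<lambda>x. L (f x))"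
  unfolding smooth_in_def using Ck_on_linear by blast

lemma smooth_in_ident: "smooth_in U (\<lambda>x. x)"
proof -
  have "Ck_on k U (\<lambda>x. x)" for k
    by (cases k) (auto simp: Ck_on_Suc ddir_def intro: Ck_on_const)
  then show ?thesis by (simp add: smooth_in_def)
qed

lemma smooth_in_bounded_linear: "open U \<Longrightarrow> bounded_linear L \<Longrightarrow> smooth_in U L"
  using smooth_in_linear smooth_in_ident by blast

lemma smooth_in_add: "open U \<Longrightarrow> smooth_in U f \<Longrightarrow> smooth_in U g \<Longrightarrow> smooth_in U (\<lambda>x. f x + g x)"
  unfolding smooth_in_def using Ck_on_add by blast

lemma smooth_in_bilinear:
  "open U \<Longrightarrow> bounded_bilinear B \<Longrightarrow> smooth_in U f \<Longrightarrow> smooth_in U g \<Longrightarrow> smooth_in U (\<lambda>x. B (f x) (g x))"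
  unfolding smooth_in_def using Ck_on_bilinear by blast

lemma smooth_in_scaleR: "open U \<Longrightarrow> smooth_in U f \<Longrightarrow> smooth_in U g \<Longrightarrow> smooth_in U (\<lambda>x. f x *\<^sub>R g x)"
  by (rule smooth_in_bilinear[OF _ bounded_bilinear_scaleR])

lemma smooth_in_mult:
  fixes f g :: "_ \<Rightarrow> real"
  shows "open U \<Longrightarrow> smooth_in U f \<Longrightarrow> smooth_in U g \<Longrightarrow> smooth_in U (\<lambda>x. f x * g x)"
  by (rule smooth_in_bilinear[OF _ bounded_bilinear_mult])

lemma smooth_in_inner: "open U \<Longrightarrow> smooth_in U f \<Longrightarrow> smooth_in U g \<Longrightarrow> smooth_in U (\<lambda>x. f x \<bullet> g x)"
  by (rule smooth_in_bilinear[OF _ bounded_bilinear_inner])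

lemma smooth_in_minus: "open U \<Longrightarrow> smooth_in U f \<Longrightarrow> smooth_in U (\<lambda>x. - f x)"
  by (rule smooth_in_linear[OF _ bounded_linear_minus[OF bounded_linear_ident]])

lemma smooth_in_diff: "open U \<Longrightarrow> smooth_in U f \<Longrightarrow> smooth_in U g \<Longrightarrow> smooth_in U (\<lambda>x. f x - g x)"
  using smooth_in_add[of U f "\<lambda>x. - g x"] smooth_in_minus[of U g] by simp

lemma smooth_in_Pair:
  assumes "open U" "smooth_in U f" "smooth_in U g"
  shows "smooth_in U (\<lambda>x. (f x, g x))"
proof -
  have "smooth_in U (\<lambda>x. (f x, 0) + (0, g x))"
    by (intro smooth_in_add smooth_in_linear[of U "\<lambda>a. (a, 0)"] smooth_in_linear[of U "\<lambda>a. (0, a)"]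
        bounded_linear_Pair bounded_linear_ident bounded_linear_zero assms)
  then show ?thesis by simp
qed

lemma smooth_in_fst: "open U \<Longrightarrow> smooth_in U f \<Longrightarrow> smooth_in U (\<lambda>x. fst (f x))"
  by (rule smooth_in_linear[OF _ bounded_linear_fst])

lemma smooth_in_snd: "open U \<Longrightarrow> smooth_in U f \<Longrightarrow> smooth_in U (\<lambda>x. snd (f x))"
  by (rule smooth_in_linear[OF _ bounded_linear_snd])

lemma smooth_in_nth: "open U \<Longrightarrow> smooth_in U f \<Longrightarrow> smooth_in U (\<lambda>x. f x $ i)"
  by (rule smooth_in_linear[OF _ bounded_linear_vec_nth])

lemma smooth_in_compose:
  "open U \<Longrightarrow> open V \<Longrightarrow> g ` U \<subseteq> V \<Longrightarrow> smooth_in U g \<Longrightarrow> smooth_in V f \<Longrightarrow> smooth_in U (\<lambda>x. f (g x))"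
  unfolding smooth_in_def using Ck_on_compose by blast

text \<open>The exponent stays arbitrary in the induction, since differentiation lowers it by
  one.\<close>

lemma Ck_on_powr: "Ck_on k {0<..} (\<lambda>y::real. y powr a)"
proof (induction k arbitrary: a)
  case 0
  then show ?case by (auto intro!: continuous_intros)
next
  case (Suc k)
  have *: "((\<lambda>y. y powr a) has_derivative (\<lambda>w. (a * w) *\<^sub>R (x powr (a - 1)))) (at x)" if "x > 0" for x :: real
    using has_real_derivative_powr[OF that, of a]
    unfolding has_field_derivative_def
    by (rule has_derivative_eq_rhs) (simp add: fun_eq_iff)
  show ?case
    by (rule Ck_on_SucI[where D="\<lambda>w x. (a * w) *\<^sub>R (x powr (a - 1))"])
      (use * Ck_on_linear[OF _ bounded_linear_mult_right Suc] in auto)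
qed

lemma smooth_in_powr:
  assumes "open U" "smooth_in U f" "\<And>x. x \<in> U \<Longrightarrow> f x > (0::real)"
  shows "smooth_in U (\<lambda>x. f x powr a)"
  by (rule smooth_in_compose[of U "{0<..}" f]) (use assms in \<open>auto simp: smooth_in_def Ck_on_powr\<close>)

lemma smooth_in_inverse:
  fixes f :: "_ \<Rightarrow> real"
  assumes "open U" "smooth_in U f" "\<And>x. x \<in> U \<Longrightarrow> f x \<noteq> 0"
  shows "smooth_in U (\<lambda>x. inverse (f x))"
proof -
  \<comment> \<open>Squaring makes the base of the power positive whatever the sign of
    \<open>f\<close>.\<close>
  have "smooth_in U (\<lambda>x. f x * (f x * f x) powr (-1))"
    by (intro smooth_in_mult smooth_in_powr assms) (use assms(3) in \<open>auto simp: zero_less_mult_iff linorder_neq_iff\<close>)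
  then show ?thesis
    by (subst smooth_in_cong[OF assms(1), where g="\<lambda>x. f x * (f x * f x) powr (-1)"])
      (use assms(3) in \<open>auto simp: powr_minus divide_simps\<close>)
qed

lemma smooth_in_divide:
  fixes f g :: "_ \<Rightarrow> real"
  assumes "open U" "smooth_in U f" "smooth_in U g" "\<And>x. x \<in> U \<Longrightarrow> g x \<noteq> 0"
  shows "smooth_in U (\<lambda>x. f x / g x)"
  unfolding divide_inverse by (intro smooth_in_mult smooth_in_inverse assms)

text \<open>As for an autonomous differential equation: if the derivative of \<open>g\<close> is a
  smooth function of the value of \<open>g\<close>, each order of regularity yields the next. This
  gives smoothness of inverse charts and of the inverse of arclength.\<close>

lemma smooth_in_bootstrap:
  fixes g :: "'a::euclidean_space \<Rightarrow> 'b::euclidean_space"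
  assumes "open Y" "open U" "g ` Y \<subseteq> U"
    and "\<And>y. y \<in> Y \<Longrightarrow> (g has_derivative (\<lambda>w. B w (g y))) (at y)"
    and "\<And>w. smooth_in U (B w)"
  shows "smooth_in Y g"
proof -
  have "Ck_on k Y g" for k
  proof (induction k)
    case 0
    show ?case using assms(4)
      by (auto intro!: continuous_at_imp_continuous_on has_derivative_continuous)
  next
    case (Suc k)
    have "Ck_on k Y (\<lambda>y. B w (g y))" for w
      using Ck_on_compose[OF assms(1-3) Suc] assms(5) by (auto simp: smooth_in_def)
    with Ck_on_SucI[OF assms(1,4)] show ?case by blast
  qed
  then show ?thesis by (simp add: smooth_in_def)
qed

lemma smooth_onE:
  assumes "smooth_on S f" "x \<in> S"
  obtains U g where "open U" "x \<in> U" "smooth_in U g" "\<forall>y\<in>S \<inter> U. g y = f y"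
proof -
  from assms obtain U g where "open U" "x \<in> U" "\<forall>k. Ck_on k U g" "\<forall>y\<in>S \<inter> U. g y = f y"
    unfolding smooth_on_def by auto
  then show thesis by (intro that[of U g]) (auto simp: smooth_in_def)
qed

lemma Ck_on_local:
  assumes "\<And>x. x \<in> S \<Longrightarrow> \<exists>U. open U \<and> x \<in> U \<and> U \<subseteq> S \<and> Ck_on k U f"
  shows "Ck_on k S f"
  using assms
proof (induction k arbitrary: f)
  case 0
  have "isCont f x" if "x \<in> S" for x
    using 0[OF that] by (auto simp: continuous_on_eq_continuous_at)
  then show ?case by (auto intro: continuous_at_imp_continuous_on)
next
  case (Suc k)
  show ?case unfolding Ck_on_Suc
  proof (intro conjI ballI allI)
    show "f differentiable at x" if "x \<in> S" for x
      using Suc.prems[OF that] by (auto simp: Ck_on_Suc)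
    show "Ck_on k S (ddir w f)" for w
      by (rule Suc.IH) (use Suc.prems in \<open>fastforce simp: Ck_on_Suc\<close>)
  qed
qed

lemma smooth_on_openD:
  assumes "open S" "smooth_on S f"
  shows "smooth_in S f"
  unfolding smooth_in_def
proof (intro allI Ck_on_local)
  fix k x assume x: "x \<in> S"
  obtain U g where U: "open U" "x \<in> U" "smooth_in U g" "\<forall>y\<in>S \<inter> U. g y = f y"
    using smooth_onE[OF assms(2) x] .
  then have "smooth_in (U \<inter> S) f"
    using smooth_in_cong[of "U \<inter> S" f g] smooth_in_subset[of U g "U \<inter> S"] assms(1) by auto
  then show "\<exists>U. open U \<and> x \<in> U \<and> U \<subseteq> S \<and> Ck_on k U f"
    using U x assms(1) by (intro exI[of _ "U \<inter> S"]) (auto simp: smooth_in_def)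
qed

lemma smooth_in_imp_smooth_on:
  assumes "open S" "smooth_in S f"
  shows "smooth_on S f"
  unfolding smooth_on_def
  by (intro ballI exI[of _ S] exI[of _ f]) (use assms in \<open>auto simp: smooth_in_def\<close>)

lemma ddir_linear:
  assumes "smooth_in U f" "x \<in> U"
  shows "linear (\<lambda>w. ddir w f x)"
  unfolding ddir_def using smooth_in_differentiable[OF assms] by (rule linear_frechet_derivative)

section \<open>Derivatives within convex sets\<close>

lemma has_vector_derivative_ray:
  assumes "(f has_derivative L) (at p within S)" "\<And>s. s \<in> {0..1} \<Longrightarrow> p + s *\<^sub>R d \<in> S"
  shows "((\<lambda>s. f (p + s *\<^sub>R d)) has_vector_derivative L d) (at 0 within {0..1})"
proof -
  have "((\<lambda>s. p + s *\<^sub>R d) has_derivative (\<lambda>s. s *\<^sub>R d)) (at 0 within {0..1})"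
    by (auto intro!: derivative_eq_intros)
  moreover have "(f has_derivative L) (at (p + 0 *\<^sub>R d) within (\<lambda>s. p + s *\<^sub>R d) ` {0..1})"
    using assms by (auto intro: has_derivative_subset)
  ultimately have "((\<lambda>s. f (p + s *\<^sub>R d)) has_derivative (\<lambda>s. L (s *\<^sub>R d))) (at 0 within {0..1})"
    by (rule has_derivative_in_compose)
  then show ?thesis
    unfolding has_vector_derivative_def
    using linear_scale[OF has_derivative_linear[OF assms(1)]] by simp
qed

text \<open>\<open>L\<close> vanishes on all differences \<open>y - p\<close> with \<open>y\<close>
  in \<open>S\<close>, and these span the space because \<open>S\<close> contains a ball. Boundary
  points of \<open>S\<close> are included, which is what allows identities along the flow to be
  differentiated at the edge of the disk and at time 0.\<close>

lemma derivative_zero_on_convex: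
  fixes f :: "'a::euclidean_space \<Rightarrow> 'b::real_normed_vector"
  assumes "convex S" "interior S \<noteq> {}" "p \<in> S" "(f has_derivative L) (at p within S)"
    and "open U" "p \<in> U" "\<And>y. y \<in> S \<inter> U \<Longrightarrow> f y = 0"
  shows "L d = 0"
proof -
  have lin: "linear L" by (rule has_derivative_linear[OF assms(4)])
  have 1: "L (y - p) = 0" if y: "y \<in> S" for y
  proof -
    have S: "p + s *\<^sub>R (y - p) \<in> S" if "s \<in> {0..1}" for s
      using convexD_alt[OF assms(1) assms(3) y, of s] that by (simp add: algebra_simps)
    have v1: "((\<lambda>s. f (p + s *\<^sub>R (y - p))) has_vector_derivative L (y - p)) (at 0 within {0..1})"
      by (rule has_vector_derivative_ray[OF assms(4) S])
    have v2: "((\<lambda>s. f (p + s *\<^sub>R (y - p))) has_vector_derivative 0) (at 0 within {0..1})"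
    proof -
      have "((\<lambda>s::real. p + s *\<^sub>R (y - p)) \<longlongrightarrow> p + 0 *\<^sub>R (y - p)) (at 0)"
        by (intro tendsto_intros)
      then have "eventually (\<lambda>s. p + s *\<^sub>R (y - p) \<in> U) (at 0)"
        using assms(5,6) by (auto dest: topological_tendstoD)
      then obtain e where e: "e > 0" "\<And>s::real. s \<noteq> 0 \<Longrightarrow> dist s 0 < e \<Longrightarrow> p + s *\<^sub>R (y - p) \<in> U"
        by (auto simp: eventually_at)
      have "f (p + s *\<^sub>R (y - p)) = 0" if "s \<in> {0..1}" "dist s 0 < e" for s
        using e(2)[of s] that assms(3,6,7) S by (cases "s = 0") auto
      then show ?thesis
        by (intro has_vector_derivative_transform_within[OF has_vector_derivative_const[of 0] e(1)]) auto
    qed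
    show ?thesis
      using vector_derivative_unique_within[OF _ v1 v2] by (simp add: trivial_limit_within islimpt_Icc)
  qed
  obtain z e where z: "e > 0" "ball z e \<subseteq> S" using assms(2) by (auto simp: mem_interior)
  show ?thesis
  proof (cases "d = 0")
    case False
    define c where "c = e / (2 * norm d)"
    have c: "c > 0" "z + c *\<^sub>R d \<in> S" "z \<in> S"
      using z False by (auto simp: c_def dist_norm subset_iff)
    have "L (z + c *\<^sub>R d - p) = L (z - p) + c *\<^sub>R L d"
      using linear_add[OF lin, of "z - p" "c *\<^sub>R d"] linear_scale[OF lin] by (simp add: algebra_simps)
    with 1[OF c(2)] 1[OF c(3)] c(1) show ?thesis by simp
  qed (use linear_0[OF lin] in simp)
qed

lemma has_derivative_unique_on_convex:
  fixes f :: "'a::euclidean_space \<Rightarrow> 'b::real_normed_vector"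
  assumes "convex S" "interior S \<noteq> {}" "p \<in> S"
    and "(f has_derivative L) (at p within S)" "(f has_derivative M) (at p within S)"
  shows "L = M"
proof -
  have "((\<lambda>y. 0) has_derivative (\<lambda>d. L d - M d)) (at p within S)"
    using has_derivative_diff[OF assms(4,5)] by simp
  then have "L d - M d = 0" for d
    using derivative_zero_on_convex[OF assms(1-3), of "\<lambda>_. 0" "\<lambda>d. L d - M d" UNIV] by simp
  then show ?thesis by auto
qed

lemma frechet_derivative_within_convex:
  fixes f :: "'a::euclidean_space \<Rightarrow> 'b::real_normed_vector"
  assumes "convex S" "interior S \<noteq> {}" "p \<in> S" "(f has_derivative L) (at p within S)"
  shows "frechet_derivative f (at p within S) = L"
  using has_derivative_unique_on_convex[OF assms(1-3) _ assms(4)] assms(4)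
    frechet_derivative_works Derivative.differentiableI by blast

section \<open>Symmetry of second derivatives\<close>

lemma second_difference_mvt:
  fixes f :: "'a::euclidean_space \<Rightarrow> real"
  assumes "smooth_in (ball x r) f" "s > 0" "s * (norm v + norm w) < r"
  shows "\<exists>a b. 0 < a \<and> a < s \<and> 0 < b \<and> b < s \<and>
    f (x + s *\<^sub>R v + s *\<^sub>R w) - f (x + s *\<^sub>R v) - f (x + s *\<^sub>R w) + f x
      = s * s * ddir w (ddir v f) (x + a *\<^sub>R v + b *\<^sub>R w)"
proof -
  have inb: "x + a *\<^sub>R v + b *\<^sub>R w \<in> ball x r" if "0 \<le> a" "a \<le> s" "0 \<le> b" "b \<le> s" for a b
  proof -
    have "norm (a *\<^sub>R v + b *\<^sub>R w) \<le> a * norm v + b * norm w"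
      using that norm_triangle_ineq[of "a *\<^sub>R v" "b *\<^sub>R w"] by simp
    also have "\<dots> \<le> s * norm v + s * norm w"
      using that by (intro add_mono mult_right_mono) auto
    also have "\<dots> < r" using assms(3) by (simp add: algebra_simps)
    finally show ?thesis unfolding mem_ball by (subst dist_commute) (simp add: dist_norm add.assoc)
  qed
  note sm = assms(1) smooth_in_ddir[OF assms(1)]
  have D1: "((\<lambda>a. f (x + a *\<^sub>R v + b *\<^sub>R w)) has_derivative (\<lambda>h. h * ddir v f (x + a *\<^sub>R v + b *\<^sub>R w))) (at a within A)"
    if "0 \<le> a" "a \<le> s" "0 \<le> b" "b \<le> s" for a b A
  proof -
    have "((\<lambda>a. x + a *\<^sub>R v + b *\<^sub>R w) has_derivative (\<lambda>h. h *\<^sub>R v)) (at a within A)"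
      by (auto intro!: derivative_eq_intros)
    from has_derivative_compose[OF this smooth_inD[OF sm(1) inb[OF that]]]
    show ?thesis using linear_scale[OF ddir_linear[OF sm(1) inb[OF that]]] by simp
  qed
  have D2: "((\<lambda>b. ddir v f (x + a *\<^sub>R v + b *\<^sub>R w)) has_derivative (\<lambda>h. h * ddir w (ddir v f) (x + a *\<^sub>R v + b *\<^sub>R w))) (at b within A)"
    if "0 \<le> a" "a \<le> s" "0 \<le> b" "b \<le> s" for a b A
  proof -
    have "((\<lambda>b. x + a *\<^sub>R v + b *\<^sub>R w) has_derivative (\<lambda>h. h *\<^sub>R w)) (at b within A)"
      by (auto intro!: derivative_eq_intros)
    from has_derivative_compose[OF this smooth_inD[OF sm(2) inb[OF that]]]
    show ?thesis using linear_scale[OF ddir_linear[OF sm(2) inb[OF that]]] by simp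
  qed
  have "\<exists>a\<in>{0<..<s}. (f (x + s *\<^sub>R v + s *\<^sub>R w) - f (x + s *\<^sub>R v + 0 *\<^sub>R w)) - (f (x + 0 *\<^sub>R v + s *\<^sub>R w) - f (x + 0 *\<^sub>R v + 0 *\<^sub>R w))
     = (s - 0) * ddir v f (x + a *\<^sub>R v + s *\<^sub>R w) - (s - 0) * ddir v f (x + a *\<^sub>R v + 0 *\<^sub>R w)"
    by (rule mvt_simple[OF assms(2)]) (use assms(2) in \<open>auto intro!: has_derivative_diff D1[simplified] D1[of _ 0, simplified]\<close>)
  then obtain a where a: "0 < a" "a < s"
    "f (x + s *\<^sub>R v + s *\<^sub>R w) - f (x + s *\<^sub>R v) - f (x + s *\<^sub>R w) + f x
      = s * (ddir v f (x + a *\<^sub>R v + s *\<^sub>R w) - ddir v f (x + a *\<^sub>R v))"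
    by (auto simp: algebra_simps)
  have "\<exists>b\<in>{0<..<s}. ddir v f (x + a *\<^sub>R v + s *\<^sub>R w) - ddir v f (x + a *\<^sub>R v + 0 *\<^sub>R w)
     = (s - 0) * ddir w (ddir v f) (x + a *\<^sub>R v + b *\<^sub>R w)"
    by (rule mvt_simple[OF assms(2)]) (use assms(2) a in \<open>auto intro!: D2\<close>)
  then obtain b where b: "0 < b" "b < s" "ddir v f (x + a *\<^sub>R v + s *\<^sub>R w) - ddir v f (x + a *\<^sub>R v)
     = s * ddir w (ddir v f) (x + a *\<^sub>R v + b *\<^sub>R w)"
    by auto
  show ?thesis
    by (intro exI[of _ a] exI[of _ b] conjI a(1,2) b(1,2)) (simp add: a(3) b(3))
qed

text \<open>The second difference over a small parallelogram is symmetric in \<open>v\<close> and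
  \<open>w\<close>, and by the mean value theorem it equals \<open>s * s\<close> times either mixed
  derivative at some nearby point. Continuity of both makes them agree at \<open>x\<close>.\<close>

lemma ddir_commute:
  fixes f :: "'a::euclidean_space \<Rightarrow> real"
  assumes "open U" "smooth_in U f" "x \<in> U"
  shows "ddir v (ddir w f) x = ddir w (ddir v f) x"
proof (rule ccontr)
  assume ne: "ddir v (ddir w f) x \<noteq> ddir w (ddir v f) x"
  define e where "e = \<bar>ddir v (ddir w f) x - ddir w (ddir v f) x\<bar> / 2"
  have e: "e > 0" using ne by (simp add: e_def)
  obtain r where r: "r > 0" "ball x r \<subseteq> U" using assms(1,3) by (meson openE)
  note sm = smooth_in_ddir[OF smooth_in_ddir[OF assms(2)]]
  obtain d1 where d1: "d1 > 0" "\<And>y. dist y x < d1 \<Longrightarrow> dist (ddir v (ddir w f) y) (ddir v (ddir w f) x) < e"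
    using smooth_in_isCont[OF sm assms(3)] e unfolding continuous_at_eps_delta by (metis dist_norm)
  obtain d2 where d2: "d2 > 0" "\<And>y. dist y x < d2 \<Longrightarrow> dist (ddir w (ddir v f) y) (ddir w (ddir v f) x) < e"
    using smooth_in_isCont[OF sm assms(3)] e unfolding continuous_at_eps_delta by (metis dist_norm)
  define m where "m = min r (min d1 d2)"
  \<comment> \<open>This keeps the parallelogram within distance \<open>m\<close> of
    \<open>x\<close>; the added 1 covers \<open>v = w = 0\<close>.\<close>
  define s where "s = m / (norm v + norm w + 1)"
  have m: "m > 0" using r d1 d2 by (simp add: m_def)
  have s: "s > 0" using m by (simp add: s_def add_nonneg_pos)
  have "s * (norm v + norm w + 1) = m" by (simp add: s_def add_nonneg_eq_0_iff add_eq_0_iff_both_eq_0)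
  then have sm': "s * (norm v + norm w) < m" using s by (simp add: algebra_simps)
  have smr: "smooth_in (ball x r) f" using smooth_in_subset[OF assms(2) r(2)] .
  have near: "dist (x + a *\<^sub>R v + b *\<^sub>R w) x < m" if "0 < a" "a < s" "0 < b" "b < s" for a b
  proof -
    have "norm (a *\<^sub>R v + b *\<^sub>R w) \<le> a * norm v + b * norm w"
      using that norm_triangle_ineq[of "a *\<^sub>R v" "b *\<^sub>R w"] by simp
    also have "\<dots> \<le> s * norm v + s * norm w"
      using that by (intro add_mono mult_right_mono) auto
    also have "\<dots> < m" using sm' by (simp add: algebra_simps)
    finally show ?thesis by (simp add: dist_norm add.assoc)
  qed
  have "s * (norm v + norm w) < r" "s * (norm w + norm v) < r" using sm' by (auto simp: m_def add.commute)
  from second_difference_mvt[OF smr s this(1)] second_difference_mvt[OF smr s this(2)]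
  obtain a b a' b' where
    ab: "0 < a" "a < s" "0 < b" "b < s" "0 < a'" "a' < s" "0 < b'" "b' < s" and
    eq: "f (x + s *\<^sub>R v + s *\<^sub>R w) - f (x + s *\<^sub>R v) - f (x + s *\<^sub>R w) + f x
      = s * s * ddir w (ddir v f) (x + a *\<^sub>R v + b *\<^sub>R w)"
     "f (x + s *\<^sub>R w + s *\<^sub>R v) - f (x + s *\<^sub>R w) - f (x + s *\<^sub>R v) + f x
      = s * s * ddir v (ddir w f) (x + a' *\<^sub>R w + b' *\<^sub>R v)" by auto
  have swap: "x + s *\<^sub>R w + s *\<^sub>R v = x + s *\<^sub>R v + s *\<^sub>R w" by simp
  have "s * s * ddir w (ddir v f) (x + a *\<^sub>R v + b *\<^sub>R w) = s * s * ddir v (ddir w f) (x + a' *\<^sub>R w + b' *\<^sub>R v)"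
    using eq unfolding swap by linarith
  then have "ddir w (ddir v f) (x + a *\<^sub>R v + b *\<^sub>R w) = ddir v (ddir w f) (x + b' *\<^sub>R v + a' *\<^sub>R w)"
    using s by (simp add: add.assoc add.commute add.left_commute)
  moreover have "dist (ddir w (ddir v f) (x + a *\<^sub>R v + b *\<^sub>R w)) (ddir w (ddir v f) x) < e"
    by (rule d2(2)) (use near[OF ab(1-4)] in \<open>simp add: m_def\<close>)
  moreover have "dist (ddir v (ddir w f) (x + b' *\<^sub>R v + a' *\<^sub>R w)) (ddir v (ddir w f) x) < e"
    by (rule d1(2)) (use near[OF ab(7,8,5,6)] in \<open>simp add: m_def\<close>)
  moreover have "False" if "P = Q" "dist P a < \<bar>b - a\<bar> / 2" "dist Q b < \<bar>b - a\<bar> / 2" for P Q a b :: real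
    using dist_triangle_half_l[of a P "\<bar>b - a\<bar>" b] that
    by (simp add: dist_commute) (simp add: dist_real_def abs_minus_commute)
  ultimately show False unfolding e_def by metis
qed

section \<open>Inverting space-time charts that preserve time\<close>

definition chart_jacobian :: "((real^2) \<times> real \<Rightarrow> real^2) \<Rightarrow> (real^2) \<times> real \<Rightarrow> real" where
  "chart_jacobian X y = ddir (axis 1 1, 0) X y $ 1 * ddir (axis 2 1, 0) X y $ 2
                      - ddir (axis 1 1, 0) X y $ 2 * ddir (axis 2 1, 0) X y $ 1"

text \<open>Cramer's rule for the derivative of the map \<open>y \<mapsto> (X y, snd y)\<close>: the
  time component passes through, and its contribution to \<open>X\<close> is subtracted first. The
  explicit quotient shows that the inverse derivative depends smoothly on \<open>y\<close>.\<close>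

definition chart_inverse :: "((real^2) \<times> real \<Rightarrow> real^2) \<Rightarrow> (real^2) \<times> real \<Rightarrow> (real^2) \<times> real \<Rightarrow> (real^2) \<times> real" where
  "chart_inverse X w y =
    (let r = fst w - snd w *\<^sub>R ddir (0, 1) X y; a = ddir (axis 1 1, 0) X y; b = ddir (axis 2 1, 0) X y
     in (((r $ 1 * b $ 2 - r $ 2 * b $ 1) / chart_jacobian X y) *\<^sub>R axis 1 1
        + ((a $ 1 * r $ 2 - a $ 2 * r $ 1) / chart_jacobian X y) *\<^sub>R axis 2 1, snd w))"

lemma smooth_in_chart_jacobian: "open U \<Longrightarrow> smooth_in U X \<Longrightarrow> smooth_in U (chart_jacobian X)"
  unfolding chart_jacobian_def by (intro smooth_in_diff smooth_in_mult smooth_in_nth smooth_in_ddir)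

lemma smooth_in_chart_inverse:
  assumes "open U" "smooth_in U X" "\<And>y. y \<in> U \<Longrightarrow> chart_jacobian X y \<noteq> 0"
  shows "smooth_in U (chart_inverse X w)"
  unfolding chart_inverse_def Let_def
  by (intro smooth_in_Pair smooth_in_add smooth_in_scaleR smooth_in_divide smooth_in_diff smooth_in_mult
      smooth_in_nth smooth_in_ddir smooth_in_const smooth_in_chart_jacobian assms)

lemma ddir_axis:
  fixes X :: "(real^2) \<times> real \<Rightarrow> 'b::real_normed_vector"
  assumes "linear (\<lambda>w. ddir w X y)"
  shows "ddir (d, t) X y = d $ 1 *\<^sub>R ddir (axis 1 1, 0) X y + d $ 2 *\<^sub>R ddir (axis 2 1, 0) X y + t *\<^sub>R ddir (0, 1) X y"
proof -
  have "(d, t) = d $ 1 *\<^sub>R (axis 1 1, 0) + d $ 2 *\<^sub>R (axis 2 1, 0) + t *\<^sub>R (0, 1)"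
    by (simp add: vec_eq_iff forall_2 axis_def)
  then show ?thesis
    using linear_add[OF assms] linear_scale[OF assms] by metis
qed

lemma chart_jacobian_nz_iff:
  assumes "linear (\<lambda>w. ddir w X y)"
  shows "chart_jacobian X y \<noteq> 0 \<longleftrightarrow> (\<forall>d. ddir (d, 0) X y = 0 \<longrightarrow> d = 0)"
proof -
  define a b where "a = ddir (axis 1 1, 0) X y" and "b = ddir (axis 2 1, 0) X y"
  have e: "ddir (d, 0) X y = d $ 1 *\<^sub>R a + d $ 2 *\<^sub>R b" for d
    using ddir_axis[OF assms, of d 0] by (simp add: a_def b_def)
  have J: "chart_jacobian X y = a $ 1 * b $ 2 - a $ 2 * b $ 1" by (simp add: chart_jacobian_def a_def b_def)
  show ?thesis
  proof
    assume nz: "chart_jacobian X y \<noteq> 0"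
    show "\<forall>d. ddir (d, 0) X y = 0 \<longrightarrow> d = 0"
    proof (intro allI impI)
      fix d assume "ddir (d, 0) X y = 0"
      then have *: "d $ 1 * a $ 1 + d $ 2 * b $ 1 = 0" "d $ 1 * a $ 2 + d $ 2 * b $ 2 = 0"
        unfolding e by (auto simp: vec_eq_iff forall_2)
      have e1: "d $ 1 * chart_jacobian X y = (d $ 1 * a $ 1 + d $ 2 * b $ 1) * b $ 2 - (d $ 1 * a $ 2 + d $ 2 * b $ 2) * b $ 1"
        unfolding J by (simp add: algebra_simps)
      have e2: "d $ 2 * chart_jacobian X y = (d $ 1 * a $ 2 + d $ 2 * b $ 2) * a $ 1 - (d $ 1 * a $ 1 + d $ 2 * b $ 1) * a $ 2"
        unfolding J by (simp add: algebra_simps)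
      have "d $ 1 * chart_jacobian X y = 0" using e1 unfolding * by simp
      moreover have "d $ 2 * chart_jacobian X y = 0" using e2 unfolding * by simp
      ultimately show "d = 0" using nz by (simp add: vec_eq_iff forall_2)
    qed
  next
    assume inj: "\<forall>d. ddir (d, 0) X y = 0 \<longrightarrow> d = 0"
    show "chart_jacobian X y \<noteq> 0"
    proof
      assume z: "chart_jacobian X y = 0"
      then have J0: "a $ 1 * b $ 2 = a $ 2 * b $ 1" unfolding J by simp
      \<comment> \<open>The columns of a singular matrix supply two kernel vectors. If both are zero
        then so is the column \<open>a\<close>, and the first basis vector itself lies in the
        kernel.\<close>
      have "ddir (vector [b $ 1, - a $ 1], 0) X y = 0" "ddir (vector [b $ 2, - a $ 2], 0) X y = 0"
        unfolding e using J0 by (simp_all add: vec_eq_iff forall_2 mult.commute)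
      then have "vector [b $ 1, - a $ 1] = (0 :: real^2)" "vector [b $ 2, - a $ 2] = (0 :: real^2)"
        using inj[rule_format] by simp_all
      then have "a = 0" by (simp add: vec_eq_iff forall_2)
      then have "axis 1 1 = (0 :: real^2)" using inj[rule_format, of "axis 1 1"] by (simp add: a_def)
      then show False by simp
    qed
  qed
qed

lemma chart_inverse_right:
  assumes "linear (\<lambda>w. ddir w X y)" "chart_jacobian X y \<noteq> 0"
  shows "ddir (chart_inverse X w y) X y = fst w" "snd (chart_inverse X w y) = snd w"
proof -
  define r a b J where "r = fst w - snd w *\<^sub>R ddir (0, 1) X y" and "a = ddir (axis 1 1, 0) X y"
    and "b = ddir (axis 2 1, 0) X y" and "J = chart_jacobian X y"
  have J: "J = a $ 1 * b $ 2 - a $ 2 * b $ 1" by (simp add: J_def chart_jacobian_def a_def b_def)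
  have inv: "chart_inverse X w y = (((r $ 1 * b $ 2 - r $ 2 * b $ 1) / J) *\<^sub>R axis 1 1
      + ((a $ 1 * r $ 2 - a $ 2 * r $ 1) / J) *\<^sub>R axis 2 1, snd w)"
    by (simp add: chart_inverse_def Let_def r_def a_def b_def J_def)
  show "snd (chart_inverse X w y) = snd w" by (simp add: inv)
  have nz: "J \<noteq> 0" using assms(2) by (simp add: J_def)
  have c: "(P / J) * p + (Q / J) * q = z" if "P * p + Q * q = z * J" for P Q p q z
  proof -
    have "(P / J) * p + (Q / J) * q = (P * p + Q * q) / J" by (simp add: add_divide_distrib)
    then show ?thesis using that nz by simp
  qed
  have "((r $ 1 * b $ 2 - r $ 2 * b $ 1) / J) *\<^sub>R a + ((a $ 1 * r $ 2 - a $ 2 * r $ 1) / J) *\<^sub>R b = r"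
  proof -
    have "((r $ 1 * b $ 2 - r $ 2 * b $ 1) / J) * a $ 1 + ((a $ 1 * r $ 2 - a $ 2 * r $ 1) / J) * b $ 1 = r $ 1"
      by (rule c) (simp add: J algebra_simps)
    moreover have "((r $ 1 * b $ 2 - r $ 2 * b $ 1) / J) * a $ 2 + ((a $ 1 * r $ 2 - a $ 2 * r $ 1) / J) * b $ 2 = r $ 2"
      by (rule c) (simp add: J algebra_simps)
    ultimately show ?thesis by (simp add: vec_eq_iff forall_2)
  qed
  moreover have "ddir (d, snd w) X y = d $ 1 *\<^sub>R a + d $ 2 *\<^sub>R b + snd w *\<^sub>R ddir (0, 1) X y" for d
    using ddir_axis[OF assms(1), of d "snd w"] by (simp only: a_def b_def)
  ultimately have "ddir (chart_inverse X w y) X y = r + snd w *\<^sub>R ddir (0, 1) X y"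
    unfolding inv by (simp add: axis_def)
  then show "ddir (chart_inverse X w y) X y = fst w" by (simp add: r_def)
qed

text \<open>The inverse function theorem for \<open>y \<mapsto> (X y, snd y)\<close>, whose
  derivative is invertible exactly when the spatial derivative of \<open>X\<close> is. The theorem
  gives a differentiable inverse; its derivative is \<open>chart_inverse\<close> evaluated at the
  inverse, so bootstrapping makes it smooth.\<close>

lemma local_chart:
  fixes X :: "(real^2) \<times> real \<Rightarrow> real^2"
  assumes "open U" "smooth_in U X" "y0 \<in> U" "\<And>d. ddir (d, 0) X y0 = 0 \<Longrightarrow> d = 0"
  obtains V W \<Gamma> where "open V" "V \<subseteq> U" "y0 \<in> V" "open W" "(\<lambda>y. (X y, snd y)) ` V = W"
    "\<And>y. y \<in> V \<Longrightarrow> \<Gamma> (X y, snd y) = y" "\<Gamma> ` W = V" "smooth_in W \<Gamma>"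
    "\<And>y. y \<in> W \<Longrightarrow> (X (\<Gamma> y), snd (\<Gamma> y)) = y"
    "\<And>y d. y \<in> V \<Longrightarrow> ddir (d, 0) X y = 0 \<Longrightarrow> d = 0"
proof -
  define f where "f y = (X y, snd y)" for y
  define U1 where "U1 = U \<inter> chart_jacobian X -` (- {0})"
  note lin = ddir_linear[OF assms(2)]
  have oU1: "open U1" unfolding U1_def
    by (intro continuous_open_preimage smooth_in_continuous smooth_in_chart_jacobian assms) auto
  have y0: "y0 \<in> U1"
    using chart_jacobian_nz_iff[OF lin[OF assms(3)]] assms(3,4) by (auto simp: U1_def)
  have sm1: "smooth_in U1 X" using smooth_in_subset[OF assms(2)] by (auto simp: U1_def)
  have lin1: "linear (\<lambda>w. ddir w X y)" if "y \<in> U1" for y using ddir_linear[OF sm1 that] .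
  have nz: "chart_jacobian X y \<noteq> 0" if "y \<in> U1" for y using that by (auto simp: U1_def)
  define f' where "f' y = Blinfun (\<lambda>w. (ddir w X y, snd w))" for y
  have bl: "bounded_linear (\<lambda>w. (ddir w X y, snd w))" if "y \<in> U1" for y
    using lin1[OF that] by (intro bounded_linear_Pair bounded_linear_snd) (simp add: linear_conv_bounded_linear)
  have f': "blinfun_apply (f' y) w = (ddir w X y, snd w)" if "y \<in> U1" for y w
    unfolding f'_def by (simp add: bounded_linear_Blinfun_apply[OF bl[OF that]])
  have inj: "w = 0" if "y \<in> U1" "ddir w X y = 0" "snd w = 0" for y w
    using chart_jacobian_nz_iff[OF lin1[OF that(1)]] nz[OF that(1)] that(2,3) by (cases w) (auto simp: zero_prod_def)
  have right: "blinfun_apply (f' y) (chart_inverse X w y) = w" if "y \<in> U1" for y w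
    using chart_inverse_right[OF lin1[OF that] nz[OF that], of w] f'[OF that] by (simp add: prod_eq_iff)
  have injf': "inj (blinfun_apply (f' y))" if "y \<in> U1" for y
  proof (rule linear_injective_0[THEN iffD2])
    show "linear (blinfun_apply (f' y))" by (simp add: blinfun.bounded_linear_right bounded_linear.linear)
    show "\<forall>w. blinfun_apply (f' y) w = 0 \<longrightarrow> w = 0" using f'[OF that] inj[OF that] by (auto simp: zero_prod_def)
  qed
  have inv: "inv (blinfun_apply (f' y)) = (\<lambda>w. chart_inverse X w y)" if "y \<in> U1" for y
    by (rule ext) (rule inv_f_eq[OF injf'[OF that] right[OF that]])
  have derf: "(f has_derivative blinfun_apply (f' y)) (at y)" if "y \<in> U1" for y
  proof -
    have "(f has_derivative (\<lambda>w. (ddir w X y, snd w))) (at y)"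
      unfolding f_def by (intro has_derivative_Pair smooth_inD[OF sm1 that] has_derivative_snd has_derivative_ident)
    moreover have "(\<lambda>w. (ddir w X y, snd w)) = blinfun_apply (f' y)" using f'[OF that] by auto
    ultimately show ?thesis by simp
  qed
  have contf: "continuous_on U1 f'"
  proof (rule continuous_on_blinfun_componentwise)
    fix i :: "(real^2) \<times> real"
    have "continuous_on U1 (\<lambda>y. (ddir i X y, snd i))"
      by (intro continuous_intros smooth_in_continuous smooth_in_ddir sm1)
    then show "continuous_on U1 (\<lambda>x. blinfun_apply (f' x) i)"
      by (rule continuous_on_eq) (simp add: f')
  qed
  have "linear (inv (blinfun_apply (f' y0)))"
    by (rule inj_linear_imp_inv_linear[OF bounded_linear.linear[OF blinfun.bounded_linear_right] injf'[OF y0]])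
  then have "bounded_linear (inv (blinfun_apply (f' y0)))" by (simp add: linear_conv_bounded_linear)
  then have invf: "Blinfun (inv (blinfun_apply (f' y0))) o\<^sub>L f' y0 = id_blinfun"
    by (intro blinfun_eqI) (simp add: bounded_linear_Blinfun_apply inv_f_f[OF injf'[OF y0]])
  from inverse_function_theorem[OF oU1 derf contf y0 invf]
  obtain V W \<Gamma> g' where V: "open V" "V \<subseteq> U1" "y0 \<in> V" "open W" "f y0 \<in> W" and hom: "homeomorphism V W f \<Gamma>"
    and g': "\<And>y. y \<in> W \<Longrightarrow> (\<Gamma> has_derivative (g' y)) (at y)" "\<And>y. y \<in> W \<Longrightarrow> g' y = inv (blinfun_apply (f' (\<Gamma> y)))"
    by metis
  have im: "f ` V = W" "\<Gamma> ` W = V" "\<And>y. y \<in> V \<Longrightarrow> \<Gamma> (f y) = y" "\<And>y. y \<in> W \<Longrightarrow> f (\<Gamma> y) = y"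
    using hom by (auto simp: homeomorphism_def)
  have "smooth_in W \<Gamma>"
  proof (rule smooth_in_bootstrap[OF V(4) oU1])
    show "\<Gamma> ` W \<subseteq> U1" using im V by auto
    show "(\<Gamma> has_derivative (\<lambda>w. chart_inverse X w (\<Gamma> y))) (at y)" if "y \<in> W" for y
      using g'[OF that] inv[of "\<Gamma> y"] im V(2) that by auto
    show "smooth_in U1 (chart_inverse X w)" for w
      by (rule smooth_in_chart_inverse[OF oU1 sm1 nz])
  qed
  have fe: "f = (\<lambda>y. (X y, snd y))" by (simp add: f_def fun_eq_iff)
  show thesis
  proof (rule that[OF V(1) _ V(3,4) _ _ im(2) \<open>smooth_in W \<Gamma>\<close>])
    show "V \<subseteq> U" using V(2) by (auto simp: U1_def)
    show "(\<lambda>y. (X y, snd y)) ` V = W" using im(1) unfolding fe .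
    show "\<Gamma> (X y, snd y) = y" if "y \<in> V" for y using im(3)[OF that] unfolding f_def .
    show "(X (\<Gamma> y), snd (\<Gamma> y)) = y" if "y \<in> W" for y using im(4)[OF that] unfolding f_def .
    show "d = 0" if "y \<in> V" "ddir (d, 0) X y = 0" for y d
      using inj[of y "(d, 0)"] V(2) that by (auto simp: zero_prod_def)
  qed
qed

section \<open>Spacelike graphs\<close>

definition lorentz :: "real^2 \<Rightarrow> real" where
  "lorentz q = 1 / sqrt (1 - q \<bullet> q)"

definition grad :: "((real^2) \<times> real \<Rightarrow> real) \<Rightarrow> (real^2) \<times> real \<Rightarrow> real^2" where
  "grad u y = (\<chi> i. ddir (axis i 1, 0) u y)"

lemma lorentz_pos: "q \<bullet> q < 1 \<Longrightarrow> lorentz q > 0"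
  by (simp add: lorentz_def)

lemma lorentz_square: "q \<bullet> q < 1 \<Longrightarrow> lorentz q ^ 2 * (1 - q \<bullet> q) = 1"
  by (simp add: lorentz_def power_divide)

lemma has_derivative_lorentz:
  assumes "(g has_derivative g') (at z within S)" "g z \<bullet> g z < 1"
  shows "((\<lambda>z. lorentz (g z)) has_derivative (\<lambda>w. lorentz (g z) ^ 3 * (g z \<bullet> g' w))) (at z within S)"
proof -
  define x where "x = g z \<bullet> g z"
  have x: "0 < 1 - x" using assms(2) by (simp add: x_def)
  have "((\<lambda>z. g z \<bullet> g z) has_derivative (\<lambda>w. 2 * (g z \<bullet> g' w))) (at z within S)"
    by (rule has_derivative_eq_rhs[OF has_derivative_inner[OF assms(1) assms(1)]])
      (simp add: fun_eq_iff inner_commute)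
  moreover have "((\<lambda>x. 1 / sqrt (1 - x)) has_real_derivative (1 / sqrt (1 - x)) ^ 3 / 2) (at x)"
  proof -
    have "sqrt (1 - x) ^ 3 = (1 - x) * sqrt (1 - x)" using x by (simp add: power3_eq_cube)
    then show ?thesis using x
      by (auto intro!: derivative_eq_intros simp: field_simps power_divide)
  qed
  ultimately have "((\<lambda>z. 1 / sqrt (1 - g z \<bullet> g z)) has_derivative
      (\<lambda>w. (1 / sqrt (1 - x)) ^ 3 / 2 * (2 * (g z \<bullet> g' w)))) (at z within S)"
    unfolding x_def has_field_derivative_def by (rule has_derivative_compose)
  then show ?thesis by (simp add: lorentz_def[abs_def] x_def)
qed

lemma inner_grad:
  assumes "smooth_in W u" "y \<in> W"
  shows "grad u y \<bullet> d = ddir (d, 0) u y"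
  using ddir_axis[OF ddir_linear[OF assms], of d 0]
  by (simp add: grad_def inner_vec_def sum_2 mult.commute)

lemma ddir_time_split:
  assumes "smooth_in W u" "y \<in> W"
  shows "ddir (d, s) u y = grad u y \<bullet> d + s * ddir (0, 1) u y"
  using ddir_axis[OF ddir_linear[OF assms], of d s]
  by (simp add: grad_def inner_vec_def sum_2 mult.commute)

text \<open>Symmetry of second derivatives moves the direction inside. Thus
  \<open>grad (ddir w u) y = 0\<close> says at once that \<open>ddir w u\<close> is critical in
  space and that the slope is stationary in the direction \<open>w\<close>; the linearization rests
  on this double reading.\<close>

lemma has_derivative_grad:
  assumes "open W" "smooth_in W u" "y \<in> W"
  shows "(grad u has_derivative (\<lambda>w. grad (ddir w u) y)) (at y)"
proof -
  have e: "grad u = (\<lambda>y. ddir (axis 1 1, 0) u y *\<^sub>R axis 1 1 + ddir (axis 2 1, 0) u y *\<^sub>R axis 2 1)" for u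
    by (rule ext) (simp add: grad_def vec_eq_iff forall_2 axis_def)
  have "(grad u has_derivative (\<lambda>w. ddir w (ddir (axis 1 1, 0) u) y *\<^sub>R axis 1 1
      + ddir w (ddir (axis 2 1, 0) u) y *\<^sub>R axis 2 1)) (at y)"
    unfolding e by (intro has_derivative_add has_derivative_scaleR_left smooth_inD[OF smooth_in_ddir[OF assms(2)] assms(3)])
  then show ?thesis
    by (rule has_derivative_eq_rhs) (simp add: e ddir_commute[OF assms])
qed

lemma grad_ddir_symmetric:
  assumes "open W" "smooth_in W u" "y \<in> W"
  shows "grad (ddir (a, 0) u) y \<bullet> b = grad (ddir (b, 0) u) y \<bullet> a"
  using inner_grad[OF smooth_in_ddir[OF assms(2)] assms(3)] ddir_commute[OF assms] by metis

text \<open>The quotient H / v of a graph. In the last term the direction is frozen at its value at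
  \<open>y\<close>, so the outer derivative does not act on it.\<close>

definition second_trace :: "((real^2) \<times> real \<Rightarrow> real) \<Rightarrow> (real^2) \<times> real \<Rightarrow> real" where
  "second_trace u y = ddir (axis 1 1, 0) (ddir (axis 1 1, 0) u) y + ddir (axis 2 1, 0) (ddir (axis 2 1, 0) u) y
     + lorentz (grad u y) ^ 2 * ddir (grad u y, 0) (ddir (grad u y, 0) u) y"

text \<open>On a spacelike graph the metric is \<open>J\<^sup>T (1 - q q\<^sup>T) J\<close> and the second fundamental form is
  \<open>v J\<^sup>T D\<^sup>2u J\<close>, so the parametrization \<open>J\<close> drops out of the trace.\<close>

lemma trace_congruence:
  fixes J S R M :: "real^2^2"
  assumes "invertible J" "R ** S = mat 1"
  shows "trace (matrix_inv (transpose J ** S ** J) ** (transpose J ** M ** J)) = trace (R ** M)"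
proof -
  obtain K where K: "J ** K = mat 1" "K ** J = mat 1" using assms(1) by (auto simp: invertible_def)
  have S: "S ** R = mat 1" using assms(2) matrix_left_right_inverse by blast
  have tK: "transpose J ** transpose K = mat 1" "transpose K ** transpose J = mat 1"
    using K by (metis matrix_transpose_mul transpose_mat)+
  define A where "A = transpose J ** S ** J"
  define B where "B = K ** R ** transpose K"
  have "A ** B = transpose J ** (S ** ((J ** K) ** (R ** transpose K)))"
    by (simp add: A_def B_def matrix_mul_assoc)
  also have "\<dots> = transpose J ** ((S ** R) ** transpose K)" by (simp add: K matrix_mul_assoc)
  finally have AB: "A ** B = mat 1" by (simp add: S tK)
  then have BA: "B ** A = mat 1" using matrix_left_right_inverse by blast
  have "matrix_inv A = B"
  proof -
    have "\<exists>A'. A ** A' = mat 1 \<and> A' ** A = mat 1" using AB BA by blast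
    then have "A ** matrix_inv A = mat 1" unfolding matrix_inv_def by (rule someI2_ex) simp
    then have "B ** (A ** matrix_inv A) = B" by simp
    then show ?thesis by (simp add: matrix_mul_assoc BA)
  qed
  then have "trace (matrix_inv A ** (transpose J ** M ** J)) = trace (B ** (transpose J ** M ** J))" by simp
  also have "B ** (transpose J ** M ** J) = (K ** R) ** ((transpose K ** transpose J) ** (M ** J))"
    by (simp add: B_def matrix_mul_assoc)
  also have "\<dots> = K ** (R ** M ** J)" by (simp add: tK matrix_mul_assoc)
  also have "trace \<dots> = trace (R ** M ** J ** K)" by (rule trace_mul_sym)
  also have "R ** M ** J ** K = R ** M ** (J ** K)" by (simp add: matrix_mul_assoc)
  finally show ?thesis by (simp add: K A_def)
qed

text \<open>Orthogonality to the tangent space involves only the image of \<open>J\<close>, which is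
  the whole plane. It forces a multiple of \<open>(q, 1)\<close>, and the norm and the sign then fix
  the factor.\<close>

lemma unit_normal_graph:
  fixes f :: "real^2 \<Rightarrow> (real^2) \<times> real"
  assumes "tangent_map f p = (\<lambda>w. (J w, q \<bullet> J w))" "surj J" "q \<bullet> q < 1"
  shows "unit_normal f p = lorentz q *\<^sub>R (q, 1)"
  unfolding unit_normal_def
proof (rule the_equality)
  define v where "v = lorentz q"
  have v: "v > 0" "v ^ 2 * (1 - q \<bullet> q) = 1" using lorentz_pos lorentz_square assms(3) by (auto simp: v_def)
  have "mink (v *\<^sub>R (q, 1)) (v *\<^sub>R (q, 1)) = - (v ^ 2 * (1 - q \<bullet> q))"
    by (simp add: mink_def power2_eq_square algebra_simps)
  then show "mink (lorentz q *\<^sub>R (q, 1)) (lorentz q *\<^sub>R (q, 1)) = - 1 \<and>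
     (\<forall>w. mink (lorentz q *\<^sub>R (q, 1)) (tangent_map f p w) = 0) \<and> 0 < - mink (lorentz q *\<^sub>R (q, 1)) e_time"
    using v by (simp add: v_def[symmetric]) (simp add: mink_def assms(1) e_time_def)
  fix \<nu> :: "(real^2) \<times> real"
  assume \<nu>: "mink \<nu> \<nu> = - 1 \<and> (\<forall>w. mink \<nu> (tangent_map f p w) = 0) \<and> 0 < - mink \<nu> e_time"
  obtain a b where ab: "\<nu> = (a, b)" by (cases \<nu>)
  have "b > 0" using \<nu> by (simp add: ab mink_def e_time_def)
  have "(a - b *\<^sub>R q) \<bullet> J w = 0" for w
    using \<nu> by (simp add: ab mink_def assms(1) inner_diff_left)
  moreover obtain w where "J w = a - b *\<^sub>R q" using assms(2) by (metis surjD)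
  ultimately have a: "a = b *\<^sub>R q" by (metis inner_eq_zero_iff right_minus_eq)
  have "b ^ 2 * (1 - q \<bullet> q) = 1" using \<nu> by (simp add: ab mink_def a power2_eq_square algebra_simps)
  then have "b ^ 2 * (1 - q \<bullet> q) = v ^ 2 * (1 - q \<bullet> q)" using v by simp
  then have "b ^ 2 = v ^ 2" using assms(3) by simp
  then have "b = v" using \<open>b > 0\<close> v(1) by (simp add: power2_eq_iff)
  then show "\<nu> = lorentz q *\<^sub>R (q, 1)" by (simp add: ab a v_def)
qed

section \<open>The flow in local graph coordinates\<close>

lemma convex_disk: "convex (disk :: (real^'n) set)" "interior (disk :: (real^'n) set) \<noteq> {}"
  by auto

lemma ereal_less_mono: "x \<le> y \<Longrightarrow> ereal y < T \<Longrightarrow> ereal x < T"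
  by (metis ereal_less_eq(3) le_less_trans)

lemma convex_time_interval: "convex (time_interval T)"
proof -
  have "is_interval (time_interval T)"
    unfolding is_interval_1 time_interval_def by (auto intro: ereal_less_mono)
  then show ?thesis by (simp add: is_interval_convex_1)
qed

lemma time_interval_prefix: "t \<in> time_interval T \<Longrightarrow> 0 \<le> s \<Longrightarrow> s \<le> t \<Longrightarrow> s \<in> time_interval T"
  unfolding time_interval_def by (auto intro: ereal_less_mono)

lemma time_interval_extends:
  assumes "t \<in> time_interval T"
  obtains s where "s > t" "{t..s} \<subseteq> time_interval T"
proof -
  have "ereal t < T" "0 \<le> t" using assms by (auto simp: time_interval_def)
  then obtain s where "t < s" "ereal s < T" using ereal_dense2[of "ereal t" T] by auto
  then show thesis using \<open>0 \<le> t\<close> by (intro that[of s]) (auto simp: time_interval_def intro: ereal_less_mono)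
qed

locale flow =
  fixes \<Omega> :: "(real^2) set" and \<alpha> :: "(real^2) \<times> real \<Rightarrow> real" and F\<^sub>0 :: "real^2 \<Rightarrow> (real^2) \<times> real"
    and T :: ereal and F :: "real^2 \<Rightarrow> real \<Rightarrow> (real^2) \<times> real"
  assumes mcf: "mcf_neumann \<Omega> \<alpha> F\<^sub>0 T F"
begin

abbreviation "I \<equiv> time_interval T"

lemma zero_in_I: "0 \<in> I"
  using mcf by (simp add: mcf_neumann_def time_interval_def zero_ereal_def)

lemma spacelike: "t \<in> I \<Longrightarrow> spacelike_embedding (\<lambda>p. F p t)"
  using mcf by (simp add: mcf_neumann_def)

lemma convex_domain: "convex (disk \<times> I)" "interior (disk \<times> I :: ((real^2) \<times> real) set) \<noteq> {}"
proof -
  show "convex (disk \<times> I)" by (intro convex_Times convex_disk convex_time_interval)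
  obtain s where s: "s > 0" "{0..s} \<subseteq> I" using time_interval_extends[OF zero_in_I] by blast
  have "interior {0..s} \<subseteq> interior I" by (rule interior_mono[OF s(2)])
  then have "s / 2 \<in> interior I" using s(1) by auto
  moreover have "0 \<in> interior (disk :: (real^2) set)" by simp
  ultimately show "interior (disk \<times> I :: ((real^2) \<times> real) set) \<noteq> {}" unfolding interior_Times by blast
qed

lemma nontrivial_time: "t \<in> I \<Longrightarrow> at t within I \<noteq> bot"
proof -
  assume t: "t \<in> I"
  obtain s where s: "s > t" "{t..s} \<subseteq> I" using time_interval_extends[OF t] by blast
  have "t islimpt {t..s}" using s(1) by simp
  then have "t islimpt I" using s(2) islimpt_subset by blast
  then show ?thesis by (simp add: trivial_limit_within)
qed

end

text \<open>\<open>X\<close> extends the horizontal part of \<open>F\<close> to an open set that may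
  stick out of \<open>disk \<times> I\<close>, and \<open>u\<close> lives on an open set as well. So
  derivatives are unrestricted, whereas facts about the flow are available only at images of points
  of \<open>disk \<times> I\<close>.\<close>

locale graph_chart = flow +
  fixes V W :: "((real^2) \<times> real) set" and X :: "(real^2) \<times> real \<Rightarrow> real^2" and u :: "(real^2) \<times> real \<Rightarrow> real"
  assumes open_V: "open V" and open_W: "open W" and smooth_X: "smooth_in V X" and smooth_u: "smooth_in W u"
    and chart_into: "y \<in> V \<Longrightarrow> (X y, snd y) \<in> W"
    and immersed: "y \<in> V \<Longrightarrow> ddir (d, 0) X y = 0 \<Longrightarrow> d = 0"
    and F_graph: "(p, t) \<in> V \<Longrightarrow> p \<in> disk \<Longrightarrow> t \<in> I \<Longrightarrow> F p t = (X (p, t), u (X (p, t), t))"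

text \<open>A nonzero tangent vector without horizontal part would have nonpositive Minkowski
  square, so on a spacelike surface the horizontal projection is an immersion.
  \<open>local_chart\<close> inverts it, and \<open>u\<close> is the height composed with that
  inverse.\<close>

lemma (in flow) chart_exists:
  assumes "p0 \<in> disk" "t0 \<in> I"
  obtains V W X u where "(p0, t0) \<in> V" "graph_chart \<Omega> \<alpha> F\<^sub>0 T F V W X u"
proof -
  have "smooth_on (disk \<times> I) (\<lambda>(p, t). F p t)" using mcf by (simp add: mcf_neumann_def)
  from smooth_onE[OF this, of "(p0, t0)"] assms
  obtain U g where U: "open U" "(p0, t0) \<in> U" "smooth_in U g" "\<forall>y\<in>disk \<times> I \<inter> U. g y = (\<lambda>(p, t). F p t) y"
    by auto
  define X where "X y = fst (g y)" for y
  define Z where "Z y = snd (g y)" for y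
  have sX: "smooth_in U X" unfolding X_def[abs_def] by (rule smooth_in_fst[OF U(1,3)])
  have sZ: "smooth_in U Z" unfolding Z_def[abs_def] by (rule smooth_in_snd[OF U(1,3)])
  have tan: "tangent_map (\<lambda>p. F p t0) p0 d = (ddir (d, 0) X (p0, t0), ddir (d, 0) Z (p0, t0))" for d
  proof -
    have "((\<lambda>p. (p, t0)) has_derivative (\<lambda>d. (d, 0))) (at p0 within disk)"
      by (intro has_derivative_Pair has_derivative_ident has_derivative_const)
    from has_derivative_compose[OF this smooth_inD[OF sX U(2)]] has_derivative_compose[OF this smooth_inD[OF sZ U(2)]]
    have D: "((\<lambda>p. (X (p, t0), Z (p, t0))) has_derivative (\<lambda>d. (ddir (d, 0) X (p0, t0), ddir (d, 0) Z (p0, t0)))) (at p0 within disk)"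
      by (rule has_derivative_Pair)
    have "open ((\<lambda>p. (p, t0)) -` U)" by (rule open_vimage[OF U(1)]) (intro continuous_intros)
    then obtain e where e: "e > 0" "ball p0 e \<subseteq> (\<lambda>p. (p, t0)) -` U" using U(2) by (metis openE vimageI)
    have "((\<lambda>p. F p t0) has_derivative (\<lambda>d. (ddir (d, 0) X (p0, t0), ddir (d, 0) Z (p0, t0)))) (at p0 within disk)"
    proof (rule has_derivative_transform_within[OF D e(1) assms(1)])
      fix p assume "p \<in> disk" "dist p p0 < e"
      then have "(p, t0) \<in> disk \<times> I \<inter> U" using e(2) assms(2) by (auto simp: dist_commute subset_iff)
      then show "(X (p, t0), Z (p, t0)) = F p t0" using U(4) by (auto simp: X_def Z_def)
    qed
    from frechet_derivative_within_convex[OF convex_disk assms(1) this]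
    show ?thesis unfolding tangent_map_def by simp
  qed
  have inj: "d = 0" if "ddir (d, 0) X (p0, t0) = 0" for d
  proof (rule ccontr)
    assume "d \<noteq> 0"
    then have "0 < first_fundamental_form (\<lambda>p. F p t0) p0 d d"
      using spacelike[OF assms(2)] assms(1) by (simp add: spacelike_embedding_def)
    then show False using that by (simp add: first_fundamental_form_def tan mink_def not_square_less_zero)
  qed
  show thesis
  proof (rule local_chart[OF U(1) sX U(2) inj])
    fix V W \<Gamma> assume V: "open V" "V \<subseteq> U" "(p0, t0) \<in> V" "open W" "(\<lambda>y. (X y, snd y)) ` V = W"
      "\<And>y. y \<in> V \<Longrightarrow> \<Gamma> (X y, snd y) = y" "\<Gamma> ` W = V" "smooth_in W \<Gamma>"
      "\<And>y. y \<in> W \<Longrightarrow> (X (\<Gamma> y), snd (\<Gamma> y)) = y"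
      "\<And>y d. y \<in> V \<Longrightarrow> ddir (d, 0) X y = 0 \<Longrightarrow> d = 0"
    have "graph_chart \<Omega> \<alpha> F\<^sub>0 T F V W X (\<lambda>y. Z (\<Gamma> y))"
    proof
      show "open V" "open W" by fact+
      show "smooth_in V X" using smooth_in_subset[OF sX V(2)] .
      show "smooth_in W (\<lambda>y. Z (\<Gamma> y))"
        by (rule smooth_in_compose[OF V(4) U(1) _ V(8) sZ]) (use V(2,7) in auto)
      show "(X y, snd y) \<in> W" if "y \<in> V" for y using V(5) that by auto
      show "d = 0" if "y \<in> V" "ddir (d, 0) X y = 0" for y d using V(10) that .
      show "F p t = (X (p, t), Z (\<Gamma> (X (p, t), t)))" if "(p, t) \<in> V" "p \<in> disk" "t \<in> I" for p t
      proof -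
        have "\<Gamma> (X (p, t), t) = (p, t)" using V(6)[OF that(1)] by simp
        moreover have "(p, t) \<in> disk \<times> I \<inter> U" using that V(2) by auto
        then have "g (p, t) = F p t" using U(4) by auto
        ultimately show ?thesis by (simp add: X_def Z_def)
      qed
    qed
    with V(3) show thesis by (rule that)
  qed
qed

context graph_chart
begin

definition G :: "(real^2) \<times> real \<Rightarrow> (real^2) \<times> real" where
  "G y = (X y, snd y)"

definition slope :: "real^2 \<Rightarrow> real \<Rightarrow> real^2" where
  "slope p t = grad u (G (p, t))"

lemma G_in: "y \<in> V \<Longrightarrow> G y \<in> W"
  unfolding G_def by (rule chart_into)

lemma linear_X: "y \<in> V \<Longrightarrow> linear (\<lambda>w. ddir w X y)"
  by (rule ddir_linear[OF smooth_X])

lemma has_derivative_pullback: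
  assumes "y \<in> V" "(h has_derivative h') (at (G y))"
  shows "((\<lambda>y. h (G y)) has_derivative (\<lambda>w. h' (ddir w X y, snd w))) (at y)"
proof -
  have "(G has_derivative (\<lambda>w. (ddir w X y, snd w))) (at y)"
    unfolding G_def[abs_def]
    by (intro has_derivative_Pair smooth_inD[OF smooth_X assms(1)] has_derivative_snd has_derivative_ident)
  from has_derivative_compose[OF this assms(2)] show ?thesis .
qed

lemma has_derivative_pullback_space:
  assumes "(p, t) \<in> V" "(h has_derivative h') (at (G (p, t)))"
  shows "((\<lambda>p. h (G (p, t))) has_derivative (\<lambda>d. h' (ddir (d, 0) X (p, t), 0))) (at p within S)"
proof -
  have "((\<lambda>p. (p, t)) has_derivative (\<lambda>d. (d, 0))) (at p within S)"
    by (intro has_derivative_Pair has_derivative_ident has_derivative_const)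
  from has_derivative_compose[OF this has_derivative_pullback[OF assms]] show ?thesis by simp
qed

lemma has_derivative_pullback_time:
  assumes "(p, t) \<in> V" "(h has_derivative h') (at (G (p, t)))"
  shows "((\<lambda>t. h (G (p, t))) has_vector_derivative h' (ddir (0, 1) X (p, t), 1)) (at t within S)"
proof -
  have "((\<lambda>t. (p, t)) has_derivative (\<lambda>s. (0, s))) (at t within S)"
    by (intro has_derivative_Pair has_derivative_ident has_derivative_const)
  from has_derivative_compose[OF this has_derivative_pullback[OF assms]]
  have D: "((\<lambda>t. h (G (p, t))) has_derivative (\<lambda>s. h' (ddir (0, s) X (p, t), s))) (at t within S)" by simp
  have "h' (ddir (0, s) X (p, t), s) = s *\<^sub>R h' (ddir (0, 1) X (p, t), 1)" for s
    using linear_scale[OF linear_X[OF assms(1)], of s "(0, 1)"]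
      linear_scale[OF has_derivative_linear[OF assms(2)], of s "(ddir (0, 1) X (p, t), 1)"] by simp
  then have "(\<lambda>s. h' (ddir (0, s) X (p, t), s)) = (\<lambda>s. s *\<^sub>R h' (ddir (0, 1) X (p, t), 1))" by (rule ext)
  with D show ?thesis unfolding has_vector_derivative_def by (simp only:)
qed

lemma surj_immersion:
  assumes "y \<in> V"
  shows "surj (\<lambda>d. ddir (d, 0) X y)"
proof (rule linear_injective_imp_surjective)
  show lin: "linear (\<lambda>d. ddir (d, 0) X y)"
    using linear_add[OF linear_X[OF assms], of "(_, 0)" "(_, 0)"] linear_scale[OF linear_X[OF assms], of _ "(_, 0)"]
    by (intro linearI) simp_all
  show "inj (\<lambda>d. ddir (d, 0) X y)"
    using immersed[OF assms] by (subst linear_injective_0[OF lin]) auto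
qed simp

lemma space_nbhd:
  assumes "(p, t) \<in> V"
  obtains e where "e > 0" "\<And>p'. dist p' p < e \<Longrightarrow> (p', t) \<in> V"
proof -
  have "open ((\<lambda>p. (p, t)) -` V)" by (rule open_vimage[OF open_V]) (intro continuous_intros)
  then obtain e where "e > 0" "ball p e \<subseteq> (\<lambda>p. (p, t)) -` V" using assms by (metis openE vimageI)
  then show thesis by (intro that[of e]) (auto simp: dist_commute subset_iff)
qed

lemma time_nbhd:
  assumes "(p, t) \<in> V"
  obtains e where "e > 0" "\<And>t'. dist t' t < e \<Longrightarrow> (p, t') \<in> V"
proof -
  have "open ((\<lambda>t. (p, t)) -` V)" by (rule open_vimage[OF open_V]) (intro continuous_intros)
  then obtain e where "e > 0" "ball t e \<subseteq> (\<lambda>t. (p, t)) -` V" using assms by (metis openE vimageI)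
  then show thesis by (intro that[of e]) (auto simp: dist_commute subset_iff)
qed

lemma has_derivative_transform_space:
  assumes "(p, t) \<in> V" "p \<in> disk" "(f has_derivative D) (at p within disk)"
    and "\<And>p'. p' \<in> disk \<Longrightarrow> (p', t) \<in> V \<Longrightarrow> f p' = g p'"
  shows "(g has_derivative D) (at p within disk)"
proof -
  obtain e where "e > 0" "\<And>p'. dist p' p < e \<Longrightarrow> (p', t) \<in> V" by (rule space_nbhd[OF assms(1)]) blast
  then show ?thesis by (intro has_derivative_transform_within[OF assms(3) _ assms(2)] assms(4)) auto
qed

context
  fixes p t assumes y: "(p, t) \<in> V" "p \<in> disk" "t \<in> I"
begin

lemma tangent_map_graph:
  "tangent_map (\<lambda>p. F p t) p = (\<lambda>d. (ddir (d, 0) X (p, t), slope p t \<bullet> ddir (d, 0) X (p, t)))"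
proof -
  have D1: "((\<lambda>p. X (p, t)) has_derivative (\<lambda>d. ddir (d, 0) X (p, t))) (at p within disk)"
  proof -
    have "((\<lambda>p. (p, t)) has_derivative (\<lambda>d. (d, 0))) (at p within disk)"
      by (intro has_derivative_Pair has_derivative_ident has_derivative_const)
    from has_derivative_compose[OF this smooth_inD[OF smooth_X y(1)]] show ?thesis .
  qed
  have "((\<lambda>p. (X (p, t), u (G (p, t)))) has_derivative
      (\<lambda>d. (ddir (d, 0) X (p, t), ddir (ddir (d, 0) X (p, t), 0) u (G (p, t))))) (at p within disk)"
    by (rule has_derivative_Pair[OF D1 has_derivative_pullback_space[OF y(1) smooth_inD[OF smooth_u G_in[OF y(1)]]]])
  then have "((\<lambda>p. F p t) has_derivative
      (\<lambda>d. (ddir (d, 0) X (p, t), ddir (ddir (d, 0) X (p, t), 0) u (G (p, t))))) (at p within disk)"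
    by (rule has_derivative_transform_space[OF y(1,2)]) (simp add: F_graph y(3) G_def)
  from frechet_derivative_within_convex[OF convex_disk y(2) this] show ?thesis
    by (simp add: tangent_map_def slope_def inner_grad[OF smooth_u G_in[OF y(1)]])
qed

text \<open>Spacelikeness is tested in the steepest direction: the tangent vector over the
  horizontal vector q = \<open>slope p t\<close> has squared length |q|^2 (1 - |q|^2).\<close>

lemma slope_less_1: "slope p t \<bullet> slope p t < 1"
proof (cases "slope p t = 0")
  case False
  obtain d where "slope p t = ddir (d, 0) X (p, t)"
    using surjD[OF surj_immersion[OF y(1)], of "slope p t"] by blast
  then have d: "ddir (d, 0) X (p, t) = slope p t" by simp
  have "d \<noteq> 0"
  proof
    assume "d = 0"
    then have "slope p t = 0" using d linear_0[OF linear_X[OF y(1)]] by (simp add: zero_prod_def)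
    then show False using False by simp
  qed
  then have "0 < first_fundamental_form (\<lambda>p. F p t) p d d"
    using spacelike[OF y(3)] y(2) by (simp add: spacelike_embedding_def)
  then have "0 < slope p t \<bullet> slope p t - (slope p t \<bullet> slope p t) * (slope p t \<bullet> slope p t)"
    by (simp add: first_fundamental_form_def tangent_map_graph mink_def d)
  then have "0 < (slope p t \<bullet> slope p t) * (1 - slope p t \<bullet> slope p t)" by (simp add: algebra_simps)
  then show ?thesis using inner_ge_zero[of "slope p t"] by (auto simp: zero_less_mult_iff)
qed simp

lemma unit_normal_eq: "unit_normal (\<lambda>p. F p t) p = lorentz (slope p t) *\<^sub>R (slope p t, 1)"
  by (rule unit_normal_graph[OF tangent_map_graph surj_immersion[OF y(1)] slope_less_1])

lemma gradient_function_eq: "gradient_function (\<lambda>p. F p t) p = lorentz (slope p t)"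
  by (simp add: gradient_function_def unit_normal_eq mink_def e_time_def)

end

text \<open>The derivative of v (q, 1) consists of v (Dq, 0) and a multiple of (q, 1). The latter is
  normal and disappears against tangent vectors, which leaves v times the Hessian of
  \<open>u\<close>.\<close>

lemma second_fundamental_form_graph:
  assumes y: "(p, t) \<in> V" "p \<in> disk" "t \<in> I"
  shows "second_fundamental_form (\<lambda>p. F p t) p w z
    = lorentz (slope p t) * ddir (ddir (z, 0) X (p, t), 0) (ddir (ddir (w, 0) X (p, t), 0) u) (G (p, t))"
proof -
  define q where "q = slope p t"
  have q: "q \<bullet> q < 1" using slope_less_1[OF y] by (simp add: q_def)
  define q' where "q' d = grad (ddir (ddir (d, 0) X (p, t), 0) u) (G (p, t))" for d
  note W = G_in[OF y(1)]
  have "(grad u has_derivative (\<lambda>w. grad (ddir w u) (G (p, t)))) (at (G (p, t)))"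
    by (rule has_derivative_grad[OF open_W smooth_u W])
  from has_derivative_pullback_space[OF y(1) this]
  have Dq: "((\<lambda>p. slope p t) has_derivative q') (at p within disk)"
    by (simp add: slope_def[abs_def] q'_def[abs_def])
  have Dv: "((\<lambda>p. lorentz (slope p t)) has_derivative (\<lambda>d. lorentz q ^ 3 * (q \<bullet> q' d))) (at p within disk)"
    using has_derivative_lorentz[OF Dq] q by (simp add: q_def)
  have "((\<lambda>p. lorentz (slope p t) *\<^sub>R (slope p t, 1)) has_derivative
     (\<lambda>d. lorentz (slope p t) *\<^sub>R (q' d, 0) + (lorentz q ^ 3 * (q \<bullet> q' d)) *\<^sub>R (slope p t, 1))) (at p within disk)"
    by (intro has_derivative_scaleR Dv has_derivative_Pair Dq has_derivative_const)
  then have "(unit_normal (\<lambda>p. F p t) has_derivative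
     (\<lambda>d. lorentz (slope p t) *\<^sub>R (q' d, 0) + (lorentz q ^ 3 * (q \<bullet> q' d)) *\<^sub>R (slope p t, 1))) (at p within disk)"
    by (rule has_derivative_transform_space[OF y(1,2)]) (simp add: unit_normal_eq y(3))
  from frechet_derivative_within_convex[OF convex_disk y(2) this]
  have "second_fundamental_form (\<lambda>p. F p t) p w z = lorentz q * (q' w \<bullet> ddir (z, 0) X (p, t))"
    by (simp add: second_fundamental_form_def tangent_map_graph[OF y] q_def mink_def inner_add_left)
  then show ?thesis
    by (simp add: q'_def q_def inner_grad[OF smooth_in_ddir[OF smooth_u] W])
qed

lemma mean_curvature_graph:
  assumes y: "(p, t) \<in> V" "p \<in> disk" "t \<in> I"
  shows "mean_curvature (\<lambda>p. F p t) p = lorentz (slope p t) * second_trace u (G (p, t))"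
proof -
  define q v where "q = slope p t" and "v = lorentz q"
  have q: "q \<bullet> q < 1" using slope_less_1[OF y] by (simp add: q_def)
  have v: "v > 0" "v ^ 2 * (1 - q \<bullet> q) = 1" using lorentz_pos lorentz_square q by (auto simp: v_def)
  note W = G_in[OF y(1)]
  define j where "j i = ddir (axis i 1, 0) X (p, t)" for i :: 2
  define m where "m k l = ddir (axis k 1, 0) (ddir (axis l 1, 0) u) (G (p, t))" for k l :: 2
  have m: "ddir (a, 0) (ddir (b, 0) u) (G (p, t)) = a $ 1 * b $ 1 * m 1 1 + a $ 1 * b $ 2 * m 1 2 + a $ 2 * b $ 1 * m 2 1 + a $ 2 * b $ 2 * m 2 2"
    for a b
  proof -
    have 1: "ddir (a, 0) (ddir (b, 0) u) (G (p, t))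
       = a $ 1 * ddir (axis 1 1, 0) (ddir (b, 0) u) (G (p, t)) + a $ 2 * ddir (axis 2 1, 0) (ddir (b, 0) u) (G (p, t))"
      using ddir_axis[OF ddir_linear[OF smooth_in_ddir[OF smooth_u] W], of a 0] by simp
    have "m k l = ddir (axis l 1, 0) (ddir (axis k 1, 0) u) (G (p, t))" for k l
      unfolding m_def by (rule ddir_commute[OF open_W smooth_u W])
    moreover have "ddir (axis k 1, 0) (ddir (b, 0) u) (G (p, t)) = ddir (b, 0) (ddir (axis k 1, 0) u) (G (p, t))" for k
      by (rule ddir_commute[OF open_W smooth_u W])
    ultimately have 2: "ddir (axis k 1, 0) (ddir (b, 0) u) (G (p, t)) = b $ 1 * m k 1 + b $ 2 * m k 2" for k
      using ddir_axis[OF ddir_linear[OF smooth_in_ddir[OF smooth_u] W], of b 0 "(axis k 1, 0)"] by simp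
    show ?thesis unfolding 1 2 by (simp add: algebra_simps)
  qed
  define J :: "real^2^2" where "J = (\<chi> k i. j i $ k)"
  define S :: "real^2^2" where "S = (\<chi> k l. (if k = l then 1 else 0) - q $ k * q $ l)"
  define R :: "real^2^2" where "R = (\<chi> k l. (if k = l then 1 else 0) + v ^ 2 * q $ k * q $ l)"
  define M :: "real^2^2" where "M = (\<chi> k l. m k l)"
  have qq: "q \<bullet> q = q $ 1 ^ 2 + q $ 2 ^ 2" by (simp add: inner_vec_def sum_2 power2_eq_square)
  have "det J \<noteq> 0"
  proof -
    have "chart_jacobian X (p, t) \<noteq> 0"
      using chart_jacobian_nz_iff[OF linear_X[OF y(1)]] immersed[OF y(1)] by blast
    then show ?thesis by (simp add: det_2 J_def j_def chart_jacobian_def mult.commute)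
  qed
  then have invJ: "invertible J" by (simp add: invertible_det_nz)
  \<comment> \<open>Inversion of a rank one perturbation: (1 - q q^T)^(-1) = 1 + v^2 q q^T when v^2
    (1 - |q|^2) = 1. The second row follows from the first by exchanging the coordinates.\<close>
  have RS: "R ** S = mat 1"
  proof -
    have e: "v ^ 2 * (1 - (q $ 1 ^ 2 + q $ 2 ^ 2)) = 1" using v(2) by (simp add: qq)
    have "(1 + v ^ 2 * a * a) * (1 - a * a) + v ^ 2 * a * b * (- (b * a)) = 1"
      "(1 + v ^ 2 * a * a) * (- (a * b)) + v ^ 2 * a * b * (1 - b * b) = 0"
      if "v ^ 2 * (1 - (a ^ 2 + b ^ 2)) = 1" for a b
    proof -
      have "(1 + v ^ 2 * a * a) * (1 - a * a) + v ^ 2 * a * b * (- (b * a)) = 1 - a * a + a * a * (v ^ 2 * (1 - (a ^ 2 + b ^ 2)))"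
        by (simp add: algebra_simps power2_eq_square)
      then show "(1 + v ^ 2 * a * a) * (1 - a * a) + v ^ 2 * a * b * (- (b * a)) = 1" by (simp add: that)
      have "(1 + v ^ 2 * a * a) * (- (a * b)) + v ^ 2 * a * b * (1 - b * b) = - (a * b) + a * b * (v ^ 2 * (1 - (a ^ 2 + b ^ 2)))"
        by (simp add: algebra_simps power2_eq_square)
      then show "(1 + v ^ 2 * a * a) * (- (a * b)) + v ^ 2 * a * b * (1 - b * b) = 0" by (simp add: that)
    qed
    note * = this
    show ?thesis
      using *[OF e] *[of "q $ 2" "q $ 1"] e
      by (simp add: vec_eq_iff forall_2 matrix_matrix_mult_def sum_2 R_def S_def mat_def algebra_simps)
  qed
  have g: "(\<chi> i k. first_fundamental_form (\<lambda>p. F p t) p (axis i 1) (axis k 1)) = transpose J ** S ** J"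
    by (simp add: vec_eq_iff forall_2 matrix_matrix_mult_def sum_2 transpose_def J_def S_def
        first_fundamental_form_def tangent_map_graph[OF y] mink_def inner_vec_def j_def[symmetric] q_def[symmetric])
      (simp add: algebra_simps)
  have A: "(\<chi> i k. second_fundamental_form (\<lambda>p. F p t) p (axis i 1) (axis k 1)) = transpose J ** (\<chi> k l. v * m k l) ** J"
    by (simp add: vec_eq_iff forall_2 matrix_matrix_mult_def sum_2 transpose_def J_def
        second_fundamental_form_graph[OF y] m j_def[symmetric] q_def[symmetric] v_def[symmetric])
      (simp add: algebra_simps m_def ddir_commute[OF open_W smooth_u W, of "(axis 2 1, 0)" "(axis 1 1, 0)"])
  have "mean_curvature (\<lambda>p. F p t) p = trace (R ** (\<chi> k l. v * m k l))"
    unfolding mean_curvature_def g A by (rule trace_congruence[OF invJ RS])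
  also have "\<dots> = v * (m 1 1 + m 2 2 + v ^ 2 * ddir (q, 0) (ddir (q, 0) u) (G (p, t)))"
    unfolding m by (simp add: trace_def sum_2 matrix_matrix_mult_def R_def algebra_simps)
  finally show ?thesis
    by (simp add: second_trace_def q_def v_def m_def slope_def)
qed

text \<open>A horizontal velocity x' of the parametrization contributes (x', q . x') to the velocity
  of \<open>F\<close>. This is tangential and cancels against the normal v (q, 1), so only - v u_t
  remains to be compared with - H.\<close>

lemma flow_equation:
  assumes y: "(p, t) \<in> V" "p \<in> disk" "t \<in> I"
  shows "ddir (0, 1) u (G (p, t)) = second_trace u (G (p, t))"
proof -
  define q v where "q = slope p t" and "v = lorentz q"
  have v: "v > 0" using lorentz_pos slope_less_1[OF y] by (auto simp: v_def q_def)
  define x' where "x' = ddir (0, 1) X (p, t)"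
  note W = G_in[OF y(1)]
  have DX: "((\<lambda>t. X (p, t)) has_vector_derivative x') (at t within I)"
  proof -
    have "((\<lambda>t. (p, t)) has_derivative (\<lambda>s. (0, s))) (at t within I)"
      by (intro has_derivative_Pair has_derivative_ident has_derivative_const)
    from has_derivative_compose[OF this smooth_inD[OF smooth_X y(1)]]
    have D: "((\<lambda>t. X (p, t)) has_derivative (\<lambda>s. ddir (0, s) X (p, t))) (at t within I)" by simp
    have "ddir (0, s) X (p, t) = s *\<^sub>R x'" for s
      unfolding x'_def using linear_scale[OF linear_X[OF y(1)], of s "(0, 1)"] by simp
    then have "(\<lambda>s. ddir (0, s) X (p, t)) = (\<lambda>s. s *\<^sub>R x')" by (rule ext)
    with D show ?thesis unfolding has_vector_derivative_def by (simp only:)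
  qed
  have D: "((\<lambda>t. (X (p, t), u (G (p, t)))) has_vector_derivative (x', ddir (x', 1) u (G (p, t)))) (at t within I)"
    unfolding x'_def
    by (intro has_vector_derivative_Pair DX[unfolded x'_def] has_derivative_pullback_time[OF y(1) smooth_inD[OF smooth_u W]])
  obtain e where e: "e > 0" "\<And>t'. dist t' t < e \<Longrightarrow> (p, t') \<in> V" by (rule time_nbhd[OF y(1)]) blast
  have "(F p has_vector_derivative (x', ddir (x', 1) u (G (p, t)))) (at t within I)"
    by (rule has_vector_derivative_transform_within[OF D e(1) y(3)]) (simp add: F_graph[OF e(2) y(2)] G_def)
  then have "vector_derivative (F p) (at t within I) = (x', ddir (x', 1) u (G (p, t)))"
    by (rule vector_derivative_within[OF nontrivial_time[OF y(3)]])
  moreover have "ddir (x', 1) u (G (p, t)) = q \<bullet> x' + ddir (0, 1) u (G (p, t))"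
    using ddir_time_split[OF smooth_u W, of x' 1] by (simp add: q_def slope_def)
  moreover have "mink (vector_derivative (F p) (at t within I)) (unit_normal (\<lambda>p. F p t) p) = - mean_curvature (\<lambda>p. F p t) p"
    using mcf y by (simp add: mcf_neumann_def)
  ultimately have "- (v * ddir (0, 1) u (G (p, t))) = - (v * second_trace u (G (p, t)))"
    unfolding unit_normal_eq[OF y] mean_curvature_graph[OF y] q_def[symmetric] v_def[symmetric]
    by (simp add: mink_def inner_commute algebra_simps)
  then show ?thesis using v by simp
qed

end

section \<open>The linearized equation at a maximum\<close>

lemma ddir_cong_open:
  assumes "open W" "z \<in> W" "f differentiable (at z)" "\<And>y. y \<in> W \<Longrightarrow> f y = g y"
  shows "ddir w f z = ddir w g z"
  unfolding ddir_def using frechet_derivative_transform_within_open[OF assms(3,1,2,4)] by simp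

lemma ddir_commute3:
  fixes u :: "'a::euclidean_space \<Rightarrow> real"
  assumes "open W" "smooth_in W u" "z \<in> W"
  shows "ddir a (ddir b (ddir c u)) z = ddir b (ddir c (ddir a u)) z"
proof -
  have "ddir a (ddir b (ddir c u)) z = ddir b (ddir a (ddir c u)) z"
    by (rule ddir_commute[OF assms(1) smooth_in_ddir[OF assms(2)] assms(3)])
  also have "\<dots> = ddir b (ddir c (ddir a u)) z"
    by (rule ddir_cong_open[OF assms(1,3) smooth_in_differentiable[OF smooth_in_ddir[OF smooth_in_ddir[OF assms(2)]] assms(3)]])
      (rule ddir_commute[OF assms(1,2)])
  finally show ?thesis .
qed

lemma ddir2_expand:
  fixes h :: "(real^2) \<times> real \<Rightarrow> real"
  assumes "open W" "smooth_in W h" "z \<in> W"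
  shows "ddir (a, 0) (ddir (b, 0) h) z
    = a $ 1 * b $ 1 * ddir (axis 1 1, 0) (ddir (axis 1 1, 0) h) z
      + (a $ 1 * b $ 2 + a $ 2 * b $ 1) * ddir (axis 1 1, 0) (ddir (axis 2 1, 0) h) z
      + a $ 2 * b $ 2 * ddir (axis 2 1, 0) (ddir (axis 2 1, 0) h) z"
proof -
  have c: "ddir v (ddir w h) z = ddir w (ddir v h) z" for v w by (rule ddir_commute[OF assms])
  have e: "ddir (d, 0) (ddir w h) z = d $ 1 * ddir (axis 1 1, 0) (ddir w h) z + d $ 2 * ddir (axis 2 1, 0) (ddir w h) z" for d w
    using ddir_axis[OF ddir_linear[OF smooth_in_ddir[OF assms(2)] assms(3)], of d 0] by simp
  have "ddir (a, 0) (ddir (b, 0) h) z = a $ 1 * ddir (b, 0) (ddir (axis 1 1, 0) h) z + a $ 2 * ddir (b, 0) (ddir (axis 2 1, 0) h) z"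
    unfolding e[of a] c[of "(axis 1 1, 0)" "(b, 0)"] c[of "(axis 2 1, 0)" "(b, 0)"] ..
  then show ?thesis
    unfolding e[of b] c[of "(axis 2 1, 0)" "(axis 1 1, 0)"] by algebra
qed

lemma second_trace_expand:
  assumes "open W" "smooth_in W u" "z \<in> W"
  shows "second_trace u z = ddir (axis 1 1, 0) (ddir (axis 1 1, 0) u) z + ddir (axis 2 1, 0) (ddir (axis 2 1, 0) u) z
     + lorentz (grad u z) ^ 2 * (grad u z $ 1 ^ 2 * ddir (axis 1 1, 0) (ddir (axis 1 1, 0) u) z
      + 2 * grad u z $ 1 * grad u z $ 2 * ddir (axis 1 1, 0) (ddir (axis 2 1, 0) u) z
      + grad u z $ 2 ^ 2 * ddir (axis 2 1, 0) (ddir (axis 2 1, 0) u) z)"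
  unfolding second_trace_def
  by (subst ddir2_expand[OF assms]) (simp add: power2_eq_square algebra_simps)

lemma inner_zero_imp_vec: "(\<And>a. q \<bullet> a = (0::real)) \<Longrightarrow> q = 0"
  using inner_eq_zero_iff by blast

context graph_chart
begin

text \<open>Every space-time direction below the graph comes from a parameter direction, so an
  identity along the flow can be differentiated in any direction \<open>e\<close>.\<close>

lemma surj_G:
  assumes "y \<in> V"
  obtains w where "ddir w X y = fst e" "snd w = snd e"
proof -
  obtain d where d: "fst e - snd e *\<^sub>R ddir (0, 1) X y = ddir (d, 0) X y"
    using surjD[OF surj_immersion[OF assms], of "fst e - snd e *\<^sub>R ddir (0, 1) X y"] by blast
  have "ddir ((d, 0) + snd e *\<^sub>R (0, 1)) X y = ddir (d, 0) X y + snd e *\<^sub>R ddir (0, 1) X y"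
    using linear_add[OF linear_X[OF assms], of "(d, 0)" "snd e *\<^sub>R (0, 1)"]
      linear_scale[OF linear_X[OF assms], of "snd e" "(0, 1)"] by simp
  with d have "ddir (d, snd e) X y = fst e" by (simp add: algebra_simps)
  then show thesis by (intro that[of "(d, snd e)"]) auto
qed

text \<open>The flow equation is differentiated in the direction \<open>e\<close>, where edge points
  are handled by \<open>derivative_zero_on_convex\<close>. The coefficients depend on Du alone, and
  by symmetry \<open>crit\<close> says that Du is stationary in the direction \<open>e\<close>, so
  only the derivatives of u_t and of the Hessian contribute.\<close>

lemma linearized_equation:
  assumes y: "(p, t) \<in> V" "p \<in> disk" "t \<in> I" and crit: "grad (ddir e u) (G (p, t)) = 0"
  shows "ddir (0, 1) (ddir e u) (G (p, t)) =
    ddir (axis 1 1, 0) (ddir (axis 1 1, 0) (ddir e u)) (G (p, t))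
    + ddir (axis 2 1, 0) (ddir (axis 2 1, 0) (ddir e u)) (G (p, t))
    + lorentz (slope p t) ^ 2 * ddir (slope p t, 0) (ddir (slope p t, 0) (ddir e u)) (G (p, t))"
proof -
  define a b c11 c12 c22 where "a k = ddir (axis k 1, 0) u" and "b = ddir (0, 1) u"
    and "c11 = ddir (axis 1 1, 0) (ddir (axis 1 1, 0) u)" and "c12 = ddir (axis 1 1, 0) (ddir (axis 2 1, 0) u)"
    and "c22 = ddir (axis 2 1, 0) (ddir (axis 2 1, 0) u)" for k :: 2
  \<comment> \<open>The flow equation multiplied by 1 - |Du|^2, which clears \<open>lorentz\<close>
    and leaves a polynomial in derivatives of \<open>u\<close>.\<close>
  define P where "P z = (1 - (a 1 z * a 1 z + a 2 z * a 2 z)) * (b z - c11 z - c22 z)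
    - (a 1 z * a 1 z * c11 z + 2 * (a 1 z * a 2 z * c12 z) + a 2 z * a 2 z * c22 z)" for z
  note W = G_in[OF y(1)]
  define z where "z = G (p, t)"
  have W': "z \<in> W" using W by (simp add: z_def)
  have sm: "smooth_in W (a k)" "smooth_in W b" "smooth_in W c11" "smooth_in W c12" "smooth_in W c22" for k
    unfolding a_def b_def c11_def c12_def c22_def by (intro smooth_in_ddir smooth_u)+
  have vanish: "P (G y) = 0" if "y \<in> disk \<times> I \<inter> V" for y
  proof -
    obtain p' t' where y': "y = (p', t')" "(p', t') \<in> V" "p' \<in> disk" "t' \<in> I" using \<open>y \<in> disk \<times> I \<inter> V\<close> by auto
    note W'' = G_in[OF y'(2)]
    define z' where "z' = G (p', t')"
    define q where "q = grad u z'"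
    have ak: "q $ k = a k z'" for k by (simp add: q_def grad_def a_def)
    have qq: "q \<bullet> q < 1" using slope_less_1[OF y'(2-4)] by (simp add: q_def z'_def slope_def)
    have qe: "q \<bullet> q = a 1 z' * a 1 z' + a 2 z' * a 2 z'" by (simp add: inner_vec_def sum_2 ak)
    have "b z' = second_trace u z'" using flow_equation[OF y'(2-4)] by (simp add: b_def z'_def)
    also have "\<dots> = c11 z' + c22 z' + lorentz q ^ 2 * (a 1 z' ^ 2 * c11 z' + 2 * a 1 z' * a 2 z' * c12 z' + a 2 z' ^ 2 * c22 z')"
      using second_trace_expand[OF open_W smooth_u W''] by (simp add: z'_def[symmetric] q_def[symmetric] ak c11_def c12_def c22_def)
    finally have "b z' - c11 z' - c22 z' = lorentz q ^ 2 * (a 1 z' ^ 2 * c11 z' + 2 * a 1 z' * a 2 z' * c12 z' + a 2 z' ^ 2 * c22 z')"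
      by simp
    then have "(1 - q \<bullet> q) * (b z' - c11 z' - c22 z') = (lorentz q ^ 2 * (1 - q \<bullet> q)) * (a 1 z' ^ 2 * c11 z' + 2 * a 1 z' * a 2 z' * c12 z' + a 2 z' ^ 2 * c22 z')"
      by simp
    also have "lorentz q ^ 2 * (1 - q \<bullet> q) = 1" by (rule lorentz_square[OF qq])
    finally show ?thesis unfolding y'(1) z'_def[symmetric] P_def qe by (simp add: power2_eq_square algebra_simps)
  qed
  define P' where "P' w = (1 - (a 1 z * a 1 z + a 2 z * a 2 z)) * (ddir w b z - ddir w c11 z - ddir w c22 z)
    - 2 * (a 1 z * ddir w (a 1) z + a 2 z * ddir w (a 2) z) * (b z - c11 z - c22 z)
    - (a 1 z * a 1 z * ddir w c11 z + 2 * (a 1 z * a 2 z * ddir w c12 z) + a 2 z * a 2 z * ddir w c22 z)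
    - (2 * a 1 z * ddir w (a 1) z * c11 z + 2 * ((a 1 z * ddir w (a 2) z + ddir w (a 1) z * a 2 z) * c12 z) + 2 * a 2 z * ddir w (a 2) z * c22 z)" for w
  have DP: "(P has_derivative P') (at z)"
    unfolding P_def[abs_def] P'_def[abs_def]
    by (rule derivative_eq_intros smooth_inD[OF sm(1) W'] smooth_inD[OF sm(2) W'] smooth_inD[OF sm(3) W']
        smooth_inD[OF sm(4) W'] smooth_inD[OF sm(5) W'] refl)+ (simp add: algebra_simps)
  have D: "((\<lambda>y. P (G y)) has_derivative (\<lambda>w. P' (ddir w X (p, t), snd w))) (at (p, t) within disk \<times> I)"
    by (rule has_derivative_at_withinI[OF has_derivative_pullback[OF y(1) DP[unfolded z_def]]])
  obtain w where w: "ddir w X (p, t) = fst e" "snd w = snd e" by (rule surj_G[OF y(1), where e=e])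
  have "P' (ddir w X (p, t), snd w) = 0"
    by (rule derivative_zero_on_convex[OF convex_domain _ D open_V y(1) vanish]) (use y in auto)
  then have P': "P' e = 0" by (simp add: w)
  define f where "f = ddir e u"
  have "ddir e (a k) z = grad f z $ k" for k
    unfolding a_def f_def grad_def vec_lambda_beta by (rule ddir_commute[OF open_W smooth_u W'])
  then have ak: "ddir e (a k) z = 0" for k using crit by (simp add: f_def z_def)
  have b: "ddir e b z = ddir (0, 1) f z" unfolding b_def f_def by (rule ddir_commute[OF open_W smooth_u W'])
  have c: "ddir e c11 z = ddir (axis 1 1, 0) (ddir (axis 1 1, 0) f) z"
    "ddir e c12 z = ddir (axis 1 1, 0) (ddir (axis 2 1, 0) f) z"
    "ddir e c22 z = ddir (axis 2 1, 0) (ddir (axis 2 1, 0) f) z"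
    unfolding c11_def c12_def c22_def f_def by (rule ddir_commute3[OF open_W smooth_u W'])+
  define q where "q = slope p t"
  have qk: "q $ k = a k z" for k by (simp add: q_def slope_def grad_def a_def z_def)
  have qe: "q \<bullet> q = a 1 z * a 1 z + a 2 z * a 2 z" by (simp add: inner_vec_def sum_2 qk)
  have qf: "ddir (q, 0) (ddir (q, 0) f) z = a 1 z * a 1 z * ddir e c11 z + 2 * (a 1 z * a 2 z * ddir e c12 z) + a 2 z * a 2 z * ddir e c22 z"
    unfolding f_def ddir2_expand[OF open_W smooth_in_ddir[OF smooth_u] W', of q q] c[unfolded f_def] qk by simp
  have "(1 - q \<bullet> q) * (ddir (0, 1) f z - ddir e c11 z - ddir e c22 z) = ddir (q, 0) (ddir (q, 0) f) z"
    using P' unfolding P'_def ak b qe qf by simp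
  then have "(lorentz q ^ 2 * (1 - q \<bullet> q)) * (ddir (0, 1) f z - ddir e c11 z - ddir e c22 z) = lorentz q ^ 2 * ddir (q, 0) (ddir (q, 0) f) z"
    by (simp add: mult.assoc)
  moreover have "lorentz q ^ 2 * (1 - q \<bullet> q) = 1"
    unfolding q_def by (rule lorentz_square[OF slope_less_1[OF y]])
  ultimately have "ddir (0, 1) f z - ddir e c11 z - ddir e c22 z = lorentz q ^ 2 * ddir (q, 0) (ddir (q, 0) f) z" by simp
  then show ?thesis unfolding c unfolding f_def q_def z_def by simp
qed

section \<open>Spatial maxima over the closed disk\<close>

lemma ray_derivative:
  assumes y: "(p, t) \<in> V" and h: "(h has_derivative h') (at (G (p, t)))" and S: "\<And>s. s \<in> {0..1} \<Longrightarrow> p + s *\<^sub>R d \<in> S"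
  shows "((\<lambda>s. h (G (p + s *\<^sub>R d, t))) has_vector_derivative h' (ddir (d, 0) X (p, t), 0)) (at 0 within {0..1})"
  by (rule has_vector_derivative_ray[OF has_derivative_pullback_space[OF y h] S])

lemma first_variation:
  assumes y: "(p, t) \<in> V" "p \<in> disk" and h: "(h has_derivative h') (at (G (p, t)))"
    and max: "\<And>p'. p' \<in> disk \<Longrightarrow> (p', t) \<in> V \<Longrightarrow> h (G (p', t)) \<le> (h (G (p, t)) :: real)"
    and x: "x \<in> disk"
  shows "h' (ddir (x - p, 0) X (p, t), 0) \<le> 0"
proof (rule ccontr)
  assume "\<not> ?thesis"
  then have pos: "h' (ddir (x - p, 0) X (p, t), 0) > 0" by simp
  have S: "p + s *\<^sub>R (x - p) \<in> disk" if "s \<in> {0..1}" for s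
    using convexD_alt[OF convex_disk(1) y(2) x, of s] that by (simp add: algebra_simps)
  obtain e where e: "e > 0" "\<And>p'. dist p' p < e \<Longrightarrow> (p', t) \<in> V" by (rule space_nbhd[OF y(1)]) blast
  have "((\<lambda>s. h (G (p + s *\<^sub>R (x - p), t))) has_real_derivative h' (ddir (x - p, 0) X (p, t), 0)) (at 0 within {0..1})"
    using ray_derivative[OF y(1) h S] by (simp add: has_real_derivative_iff_has_vector_derivative)
  from has_real_derivative_pos_inc_right[OF this pos]
  obtain \<delta> where \<delta>: "\<delta> > 0" "\<And>s. 0 < s \<Longrightarrow> s \<in> {0..1} \<Longrightarrow> s < \<delta> \<Longrightarrow> h (G (p, t)) < h (G (p + s *\<^sub>R (x - p), t))"
    by auto
  \<comment> \<open>Short enough to stay on the segment to \<open>x\<close>, in the range of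
    increase and in the chart; the added 1 covers \<open>x = p\<close>.\<close>
  define s where "s = Min {1, \<delta> / 2, e / (2 * (norm (x - p) + 1))}"
  have n: "norm (x - p) + 1 > 0" by (simp add: add_nonneg_pos)
  have s: "0 < s" "s \<le> 1" "s < \<delta>" "s \<le> e / (2 * (norm (x - p) + 1))" using \<delta>(1) e(1) n by (auto simp: s_def)
  have "s * norm (x - p) < e"
  proof -
    have "s * norm (x - p) \<le> s * (norm (x - p) + 1)" using s(1) by simp
    also have "\<dots> \<le> e / (2 * (norm (x - p) + 1)) * (norm (x - p) + 1)" using s(4) n by (intro mult_right_mono) auto
    also have "\<dots> = e / 2" using n by (simp add: field_simps)
    finally show ?thesis using e(1) by simp
  qed
  then have "(p + s *\<^sub>R (x - p), t) \<in> V" using s(1) by (intro e(2)) (simp add: dist_norm)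
  then show False using max[of "p + s *\<^sub>R (x - p)"] S[of s] \<delta>(2)[of s] s by auto
qed

text \<open>The segment from \<open>p\<close> to \<open>x\<close> is mapped to a curve in the plane.
  The acceleration of that curve is paired with the gradient of \<open>h\<close>, which vanishes, so
  the second derivative along it is the pure Hessian term. If that were positive, \<open>h\<close>
  would grow along the segment.\<close>

lemma second_variation:
  assumes y: "(p, t) \<in> V" "p \<in> disk" and h: "smooth_in W h" and crit: "grad h (G (p, t)) = 0"
    and max: "\<And>p'. p' \<in> disk \<Longrightarrow> (p', t) \<in> V \<Longrightarrow> h (G (p', t)) \<le> (h (G (p, t)) :: real)"
    and x: "x \<in> disk"
  shows "ddir (ddir (x - p, 0) X (p, t), 0) (ddir (ddir (x - p, 0) X (p, t), 0) h) (G (p, t)) \<le> 0"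
proof (rule ccontr)
  define d where "d = x - p"
  define k where "k = ddir (d, 0) X (p, t)"
  assume "\<not> ?thesis"
  then have pos: "ddir (k, 0) (ddir (k, 0) h) (G (p, t)) > 0" by (simp add: k_def d_def)
  note W = G_in[OF y(1)]
  have S: "p + s *\<^sub>R d \<in> disk" if "s \<in> {0..1}" for s
    using convexD_alt[OF convex_disk(1) y(2) x, of s] that by (simp add: algebra_simps d_def)
  obtain e where e: "e > 0" "\<And>p'. dist p' p < e \<Longrightarrow> (p', t) \<in> V" by (rule space_nbhd[OF y(1)]) blast
  \<comment> \<open>The derivative of \<open>h\<close> along the segment. Only its derivative at 0
    and its sign for small \<open>s\<close> are needed; the mean value theorem does the
    rest.\<close>
  define \<psi> where "\<psi> s = grad h (G (p + s *\<^sub>R d, t)) \<bullet> ddir (d, 0) X (p + s *\<^sub>R d, t)" for s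
  have near: "(p + s *\<^sub>R d, t) \<in> V" if "0 \<le> s" "s \<le> e / (2 * (norm d + 1))" for s
  proof -
    have n: "norm d + 1 > 0" by (simp add: add_nonneg_pos)
    have "s * norm d \<le> s * (norm d + 1)" using that by (simp add: mult_left_mono)
    also have "\<dots> \<le> e / (2 * (norm d + 1)) * (norm d + 1)" using that n by (intro mult_right_mono) auto
    also have "\<dots> = e / 2" using n by (simp add: field_simps)
    finally show ?thesis using e(1) that by (intro e(2)) (simp add: dist_norm)
  qed
  have D\<psi>: "(\<psi> has_real_derivative ddir (k, 0) (ddir (k, 0) h) (G (p, t))) (at 0 within {0..1})"
  proof -
    have 1: "((\<lambda>s. grad h (G (p + s *\<^sub>R d, t))) has_vector_derivative grad (ddir (k, 0) h) (G (p, t))) (at 0 within {0..1})"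
      unfolding k_def by (rule ray_derivative[OF y(1) has_derivative_grad[OF open_W h W] S])
    have sl: "((\<lambda>p. (p, t)) has_derivative (\<lambda>d. (d, 0))) (at p within disk)"
      by (intro has_derivative_Pair has_derivative_ident has_derivative_const)
    have 2: "((\<lambda>s. ddir (d, 0) X (p + s *\<^sub>R d, t)) has_vector_derivative ddir (d, 0) (ddir (d, 0) X) (p, t)) (at 0 within {0..1})"
      by (rule has_vector_derivative_ray[OF has_derivative_compose[OF sl smooth_inD[OF smooth_in_ddir[OF smooth_X] y(1)]] S])
    have "(\<psi> has_vector_derivative (grad h (G (p + 0 *\<^sub>R d, t)) \<bullet> ddir (d, 0) (ddir (d, 0) X) (p, t)
        + grad (ddir (k, 0) h) (G (p, t)) \<bullet> ddir (d, 0) X (p + 0 *\<^sub>R d, t))) (at 0 within {0..1})"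
      unfolding \<psi>_def[abs_def]
      by (rule bounded_bilinear.has_vector_derivative[OF bounded_bilinear_inner 1 2])
    then show ?thesis
      by (simp add: crit inner_grad[OF smooth_in_ddir[OF h] W] k_def has_real_derivative_iff_has_vector_derivative)
  qed
  from has_real_derivative_pos_inc_right[OF D\<psi> pos]
  obtain \<delta> where \<delta>: "\<delta> > 0" "\<And>s. 0 < s \<Longrightarrow> s \<in> {0..1} \<Longrightarrow> s < \<delta> \<Longrightarrow> \<psi> 0 < \<psi> s" by auto
  have \<psi>0: "\<psi> 0 = 0" by (simp add: \<psi>_def crit)
  define s where "s = Min {1, \<delta> / 2, e / (2 * (norm d + 1))}"
  have n: "norm d + 1 > 0" by (simp add: add_nonneg_pos)
  have s: "0 < s" "s \<le> 1" "s < \<delta>" "s \<le> e / (2 * (norm d + 1))" using \<delta>(1) e(1) n by (auto simp: s_def)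
  have D: "((\<lambda>r. h (G (p + r *\<^sub>R d, t))) has_derivative (\<lambda>x. x * \<psi> r)) (at r within {0..s})" if r: "0 \<le> r" "r \<le> s" for r
  proof -
    have rV: "(p + r *\<^sub>R d, t) \<in> V" using near r s(4) by auto
    have "((\<lambda>r. p + r *\<^sub>R d) has_derivative (\<lambda>x. x *\<^sub>R d)) (at r within {0..s})"
      by (auto intro!: derivative_eq_intros)
    from has_derivative_compose[OF this has_derivative_pullback_space[OF rV smooth_inD[OF h G_in[OF rV]]]]
    have "((\<lambda>r. h (G (p + r *\<^sub>R d, t))) has_derivative
        (\<lambda>x. ddir (ddir (x *\<^sub>R d, 0) X (p + r *\<^sub>R d, t), 0) h (G (p + r *\<^sub>R d, t)))) (at r within {0..s})" by simp
    moreover have "ddir (ddir (x *\<^sub>R d, 0) X (p + r *\<^sub>R d, t), 0) h (G (p + r *\<^sub>R d, t)) = x * \<psi> r" for x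
      using linear_scale[OF linear_X[OF rV], of x "(d, 0)"]
      by (simp add: \<psi>_def inner_grad[OF h G_in[OF rV], symmetric])
    ultimately show ?thesis by simp
  qed
  obtain r where r: "r \<in> {0<..<s}" "h (G (p + s *\<^sub>R d, t)) - h (G (p + 0 *\<^sub>R d, t)) = (s - 0) * \<psi> r"
    using mvt_simple[OF s(1), of "\<lambda>r. h (G (p + r *\<^sub>R d, t))" "\<lambda>r x. x * \<psi> r"] D by auto
  have "\<psi> r > 0" using \<delta>(2)[of r] r(1) s \<psi>0 by auto
  then have "h (G (p + s *\<^sub>R d, t)) > h (G (p, t))" using r(2) mult_pos_pos[OF s(1), of "\<psi> r"] by simp
  then show False using max[OF S[of s] near[of s]] s by auto
qed

text \<open>The sign is known for directions pointing into the disk. Directions with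
  \<open>d \<bullet> p \<le> 0\<close> are limits of the inward directions
  \<open>d - \<epsilon> *\<^sub>R p\<close>, and since a quadratic form is even, \<open>d\<close> or
  \<open>- d\<close> always falls into that half plane.\<close>

lemma hessian_nonpos:
  assumes y: "(p, t) \<in> V" "p \<in> disk" and h: "smooth_in W h" and crit: "grad h (G (p, t)) = 0"
    and max: "\<And>p'. p' \<in> disk \<Longrightarrow> (p', t) \<in> V \<Longrightarrow> h (G (p', t)) \<le> (h (G (p, t)) :: real)"
  shows "ddir (a, 0) (ddir (a, 0) h) (G (p, t)) \<le> 0"
proof -
  note W = G_in[OF y(1)]
  define Q where "Q a = ddir (a, 0) (ddir (a, 0) h) (G (p, t))" for a
  have Q: "Q a = a $ 1 * a $ 1 * Q (axis 1 1) + (a $ 1 * a $ 2 + a $ 2 * a $ 1) * ddir (axis 1 1, 0) (ddir (axis 2 1, 0) h) (G (p, t))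
     + a $ 2 * a $ 2 * Q (axis 2 1)" for a
    unfolding Q_def by (rule ddir2_expand[OF open_W h W])
  have Qs: "Q (c *\<^sub>R a) = c * c * Q a" for c a
    unfolding Q[of "c *\<^sub>R a"] Q[of a] by (simp add: algebra_simps)
  define J where "J d = ddir (d, 0) X (p, t)" for d
  have J: "J (d + d') = J d + J d'" "J (c *\<^sub>R d) = c *\<^sub>R J d" for c d d'
    using linear_add[OF linear_X[OF y(1)], of "(d, 0)" "(d', 0)"] linear_scale[OF linear_X[OF y(1)], of c "(d, 0)"]
    by (simp_all add: J_def)
  have inward: "Q (J d) \<le> 0" if "c > 0" "p + c *\<^sub>R d \<in> disk" for c d
  proof -
    have "Q (J (p + c *\<^sub>R d - p)) \<le> 0"
      unfolding Q_def J_def by (rule second_variation[OF y h crit max that(2)])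
    then have "c * c * Q (J d) \<le> 0" by (simp add: J(2) Qs)
    then show ?thesis using that(1) by (simp add: mult_le_0_iff)
  qed
  have half: "Q (J d) \<le> 0" if d: "d \<bullet> p \<le> 0" for d
  proof -
    have eps: "Q (J d - \<epsilon> *\<^sub>R J p) \<le> 0" if "\<epsilon> > 0" "\<epsilon> < 1" for \<epsilon>
    proof -
      \<comment> \<open>With this step length the squared norm of the endpoint is at most 1 - c
        \<epsilon> + c^2 (\<epsilon>^2 - 1), so the endpoint stays in the disk even when
        \<open>d\<close> is tangent to the circle.\<close>
      define c where "c = \<epsilon> / (1 + d \<bullet> d)"
      have dd: "0 \<le> d \<bullet> d" by simp
      have c: "c > 0" "c * (1 + d \<bullet> d) = \<epsilon>" using dd that by (simp_all add: c_def add_pos_nonneg less_imp_neq[symmetric, OF add_pos_nonneg])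
      have "c \<le> c * (1 + d \<bullet> d)" using c(1) dd by simp
      then have c1: "c \<le> \<epsilon>" using c(2) by simp
      then have ce: "c * \<epsilon> < 1" using that c(1) by (smt (verit) mult_less_cancel_left2 mult_le_one)
      have pp: "p \<bullet> p \<le> 1" using y(2) by (simp add: norm_eq_sqrt_inner)
      have "(p + c *\<^sub>R (d - \<epsilon> *\<^sub>R p)) \<bullet> (p + c *\<^sub>R (d - \<epsilon> *\<^sub>R p))
          = (1 - c * \<epsilon>) * (1 - c * \<epsilon>) * (p \<bullet> p) + 2 * c * (1 - c * \<epsilon>) * (d \<bullet> p) + c * c * (d \<bullet> d)"
        by (simp add: inner_add_left inner_add_right inner_diff_left inner_diff_right inner_commute algebra_simps)
      also have "\<dots> \<le> (1 - c * \<epsilon>) * (1 - c * \<epsilon>) * 1 + 0 + c * c * (d \<bullet> d)"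
        using pp ce c(1) d by (intro add_mono mult_left_mono mult_nonneg_nonpos) auto
      also have "\<dots> = 1 - 2 * c * \<epsilon> + c * c * \<epsilon> * \<epsilon> + c * (c * (1 + d \<bullet> d)) - c * c"
        by (simp add: algebra_simps)
      also have "\<dots> = 1 - c * \<epsilon> + c * c * (\<epsilon> * \<epsilon> - 1)"
        unfolding c(2) by (simp add: algebra_simps)
      also have "\<dots> \<le> 1"
      proof -
        have "\<epsilon> * \<epsilon> \<le> 1" using that by (simp add: mult_le_one)
        then have "c * c * (\<epsilon> * \<epsilon> - 1) \<le> 0" by (intro mult_nonneg_nonpos) auto
        moreover have "c * \<epsilon> \<ge> 0" using c(1) that by simp
        ultimately show ?thesis by linarith
      qed
      finally have "p + c *\<^sub>R (d - \<epsilon> *\<^sub>R p) \<in> disk" by (simp add: norm_eq_sqrt_inner)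
      from inward[OF c(1) this] have "Q (J (d + (- \<epsilon>) *\<^sub>R p)) \<le> 0" by simp
      then show ?thesis unfolding J by simp
    qed
    have "((\<lambda>\<epsilon>. Q (J d - \<epsilon> *\<^sub>R J p)) \<longlongrightarrow> Q (J d - 0 *\<^sub>R J p)) (at_right 0)"
      unfolding Q[of "J d - _ *\<^sub>R J p"] by (intro tendsto_intros)
    moreover have "eventually (\<lambda>\<epsilon>. Q (J d - \<epsilon> *\<^sub>R J p) \<le> 0) (at_right 0)"
      unfolding eventually_at_right_field by (intro exI[of _ 1]) (use eps in auto)
    ultimately have "Q (J d - 0 *\<^sub>R J p) \<le> 0" by (intro tendsto_upperbound) auto
    then show ?thesis by simp
  qed
  obtain d where d: "a = J d" using surjD[OF surj_immersion[OF y(1)], of a] unfolding J_def by blast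
  show ?thesis
  proof (cases "d \<bullet> p \<le> 0")
    case True
    then show ?thesis using half d by (simp add: Q_def)
  next
    case False
    then have "Q (J (- 1 *\<^sub>R d)) \<le> 0" by (intro half) simp
    then show ?thesis unfolding J(2) Qs by (simp add: d Q_def)
  qed
qed

text \<open>The matrix 1 + v^2 q q^T is positive, so a nonpositive Hessian gives the sign. The
  derivative following a fixed parameter \<open>p\<close> agrees with the time derivative at a fixed
  place, because the horizontal drift is paired with a vanishing gradient.\<close>

lemma linearized_maximum:
  assumes y: "(p, t) \<in> V" "p \<in> disk" "t \<in> I" and crit: "grad (ddir e u) (G (p, t)) = 0"
    and max: "\<And>p'. p' \<in> disk \<Longrightarrow> (p', t) \<in> V \<Longrightarrow> ddir e u (G (p', t)) \<le> ddir e u (G (p, t))"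
  shows "ddir (0, 1) (ddir e u) (G (p, t)) \<le> 0"
    "((\<lambda>t. ddir e u (G (p, t))) has_real_derivative ddir (0, 1) (ddir e u) (G (p, t))) (at t within S)"
proof -
  note f = smooth_in_ddir[OF smooth_u, of e] and W = G_in[OF y(1)]
  have "ddir (a, 0) (ddir (a, 0) (ddir e u)) (G (p, t)) \<le> 0" for a
    by (rule hessian_nonpos[OF y(1,2) f crit max])
  then show "ddir (0, 1) (ddir e u) (G (p, t)) \<le> 0"
    unfolding linearized_equation[OF y crit] by (intro add_nonpos_nonpos mult_nonneg_nonpos) auto
  show "((\<lambda>t. ddir e u (G (p, t))) has_real_derivative ddir (0, 1) (ddir e u) (G (p, t))) (at t within S)"
    using has_derivative_pullback_time[OF y(1) smooth_inD[OF f W]]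
    by (simp add: has_real_derivative_iff_has_vector_derivative ddir_time_split[OF f W, of "ddir (0, 1) X (p, t)" 1] crit)
qed

lemma interior_critical:
  assumes y: "(p, t) \<in> V" "p \<in> ball 0 1" and h: "smooth_in W h"
    and max: "\<And>p'. p' \<in> disk \<Longrightarrow> (p', t) \<in> V \<Longrightarrow> h (G (p', t)) \<le> (h (G (p, t)) :: real)"
  shows "grad h (G (p, t)) = 0"
proof -
  note W = G_in[OF y(1)]
  obtain e where e: "e > 0" "\<And>p'. dist p' p < e \<Longrightarrow> (p', t) \<in> V" by (rule space_nbhd[OF y(1)]) blast
  have "((\<lambda>p. h (G (p, t))) has_derivative (\<lambda>d. ddir (ddir (d, 0) X (p, t), 0) h (G (p, t)))) (at p)"
    by (rule has_derivative_pullback_space[OF y(1) smooth_inD[OF h W]])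
  moreover have "\<forall>p'\<in>ball p e \<inter> ball 0 1. h (G (p', t)) \<le> h (G (p, t))"
    using e(2) max by (auto simp: dist_commute)
  ultimately have z: "(\<lambda>d. ddir (ddir (d, 0) X (p, t), 0) h (G (p, t))) = (\<lambda>d. 0)"
    using y(2) e(1) by (intro differential_zero_maxmin[of p "ball p e \<inter> ball 0 1"]) auto
  show ?thesis
  proof (rule inner_zero_imp_vec)
    fix a
    obtain d where "a = ddir (d, 0) X (p, t)" using surjD[OF surj_immersion[OF y(1)], of a] by blast
    then show "grad h (G (p, t)) \<bullet> a = 0" using fun_cong[OF z, of d] by (simp add: inner_grad[OF h W])
  qed
qed

end

section \<open>The boundary curve\<close>

definition gradient :: "(real^2 \<Rightarrow> real) \<Rightarrow> real^2 \<Rightarrow> real^2" where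
  "gradient \<rho> x = (\<chi> i. ddir (axis i 1) \<rho> x)"

lemma inner_gradient:
  assumes "smooth_in N \<rho>" "x \<in> N"
  shows "gradient \<rho> x \<bullet> w = ddir w \<rho> x"
proof -
  have "w = w $ 1 *\<^sub>R axis 1 1 + w $ 2 *\<^sub>R axis 2 1"
    by (simp add: vec_eq_iff forall_2 axis_def)
  then have "ddir w \<rho> x = ddir (w $ 1 *\<^sub>R axis 1 1 + w $ 2 *\<^sub>R axis 2 1) \<rho> x" by simp
  also have "\<dots> = w $ 1 *\<^sub>R ddir (axis 1 1) \<rho> x + w $ 2 *\<^sub>R ddir (axis 2 1) \<rho> x"
    unfolding linear_add[OF ddir_linear[OF assms]] linear_scale[OF ddir_linear[OF assms]] ..
  finally show ?thesis by (simp add: gradient_def inner_vec_def sum_2 mult.commute)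
qed

lemma gradient_GDERIV:
  assumes "smooth_in N \<rho>" "x \<in> N"
  shows "GDERIV \<rho> x :> gradient \<rho> x"
proof -
  have "(\<rho> has_derivative (\<lambda>w. w \<bullet> gradient \<rho> x)) (at x)"
    by (rule has_derivative_eq_rhs[OF smooth_inD[OF assms]])
      (simp add: fun_eq_iff inner_gradient[OF assms, symmetric] inner_commute)
  then show ?thesis by (simp add: gderiv_def)
qed

lemma GDERIV_unique_real:
  assumes "GDERIV \<rho> x :> g" "GDERIV \<rho> x :> h"
  shows "g = h"
proof -
  have "(\<lambda>w. w \<bullet> g) = (\<lambda>w. w \<bullet> h)"
    using assms unfolding gderiv_def by (rule has_derivative_unique)
  then have "\<And>w. w \<bullet> g = w \<bullet> h" by (rule fun_cong)
  then show ?thesis using vector_eq_ldot by blast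
qed

lemma has_derivative_gradient:
  assumes "open N" "smooth_in N \<rho>" "x \<in> N"
  shows "(gradient \<rho> has_derivative (\<lambda>w. gradient (ddir w \<rho>) x)) (at x)"
proof -
  have e: "gradient \<rho> = (\<lambda>y. ddir (axis 1 1) \<rho> y *\<^sub>R axis 1 1 + ddir (axis 2 1) \<rho> y *\<^sub>R axis 2 1)" for \<rho>
    by (rule ext) (simp add: gradient_def vec_eq_iff forall_2 axis_def)
  have "(gradient \<rho> has_derivative (\<lambda>w. ddir w (ddir (axis 1 1) \<rho>) x *\<^sub>R axis 1 1
      + ddir w (ddir (axis 2 1) \<rho>) x *\<^sub>R axis 2 1)) (at x)"
    unfolding e by (intro has_derivative_add has_derivative_scaleR_left smooth_inD[OF smooth_in_ddir[OF assms(2)] assms(3)])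
  then show ?thesis
    by (rule has_derivative_eq_rhs) (simp add: e ddir_commute[OF assms])
qed

section \<open>Orthogonality in the plane\<close>

definition perp :: "real^2 \<Rightarrow> real^2" where
  "perp a = vector [- a $ 2, a $ 1]"

lemma perp_nth [simp]: "perp a $ 1 = - a $ 2" "perp a $ 2 = a $ 1"
  by (simp_all add: perp_def)

lemma inner_2: "a \<bullet> b = a $ 1 * b $ 1 + a $ 2 * b $ 2" for a b :: "real^2"
  by (simp add: inner_vec_def sum_2)

lemma inner_perp [simp]: "a \<bullet> perp a = 0" "perp a \<bullet> a = 0" "perp a \<bullet> perp b = a \<bullet> b"
  by (simp_all add: inner_2 algebra_simps)

lemma norm_perp [simp]: "norm (perp a) = norm a"
  by (simp add: norm_eq_sqrt_inner)

lemma orthogonal_imp_perp: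
  fixes n :: "real^2"
  assumes "n \<noteq> 0" "n \<bullet> a = 0"
  obtains c where "a = c *\<^sub>R perp n"
proof -
  have n: "n \<bullet> n \<noteq> 0" using assms(1) by simp
  have "(n \<bullet> n) *\<^sub>R a = (a \<bullet> perp n) *\<^sub>R perp n + (n \<bullet> a) *\<^sub>R n"
    by (simp add: vec_eq_iff forall_2 inner_2 algebra_simps)
  then have "(n \<bullet> n) *\<^sub>R a = (a \<bullet> perp n) *\<^sub>R perp n" using assms(2) by simp
  then have "inverse (n \<bullet> n) *\<^sub>R ((n \<bullet> n) *\<^sub>R a) = inverse (n \<bullet> n) *\<^sub>R ((a \<bullet> perp n) *\<^sub>R perp n)" by simp
  then have "a = (inverse (n \<bullet> n) * (a \<bullet> perp n)) *\<^sub>R perp n" using n by simp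
  then show thesis by (rule that)
qed

lemma unit_orthogonal_cases:
  fixes n :: "real^2"
  assumes "n \<noteq> 0" "n \<bullet> a = 0" "n \<bullet> b = 0" "norm a = 1" "norm b = 1"
  shows "a = b \<or> a = - b"
proof -
  obtain c where c: "a = c *\<^sub>R perp n" by (rule orthogonal_imp_perp[OF assms(1,2)])
  obtain d where d: "b = d *\<^sub>R perp n" by (rule orthogonal_imp_perp[OF assms(1,3)])
  have "\<bar>c\<bar> * norm n = \<bar>d\<bar> * norm n" using assms(4,5) unfolding c d by simp
  then have "c = d \<or> c = - d" using assms(1) by (auto simp: abs_eq_iff)
  then show ?thesis unfolding c d by auto
qed

text \<open>A local defining function freed from its base point, with ordinary smoothness and an
  explicit gradient, so that it can be differentiated at every point of \<open>N\<close>.\<close>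

locale defining_function =
  fixes \<Omega> N :: "(real^2) set" and \<rho> :: "real^2 \<Rightarrow> real"
  assumes closed_domain: "closed \<Omega>" and open_N: "open N" and smooth_rho: "smooth_in N \<rho>"
    and gradient_nz: "x \<in> N \<Longrightarrow> gradient \<rho> x \<noteq> 0"
    and sublevel: "\<Omega> \<inter> N = {x \<in> N. \<rho> x \<le> 0}"
begin

lemma in_domain_iff: "y \<in> N \<Longrightarrow> y \<in> \<Omega> \<longleftrightarrow> \<rho> y \<le> 0"
  using sublevel by (simp add: set_eq_iff) blast

text \<open>\<open>\<rho> < 0\<close> is an open condition. A zero of \<open>\<rho>\<close> in the
  interior would be a local maximum of \<open>\<rho>\<close>, which the nonzero gradient
  excludes.\<close>

lemma rho_frontier_iff:
  assumes "x \<in> N"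
  shows "x \<in> frontier \<Omega> \<longleftrightarrow> \<rho> x = 0"
proof
  assume x: "x \<in> frontier \<Omega>"
  then have "x \<in> \<Omega>" "x \<notin> interior \<Omega>" using closed_domain by (auto simp: frontier_def)
  then have le: "\<rho> x \<le> 0" using in_domain_iff[OF assms] by simp
  have "\<not> \<rho> x < 0"
  proof
    assume "\<rho> x < 0"
    have op: "open (N \<inter> \<rho> -` {..<0})"
      by (rule continuous_open_preimage[OF smooth_in_continuous[OF smooth_rho] open_N open_lessThan])
    have sub: "N \<inter> \<rho> -` {..<0} \<subseteq> \<Omega>" by (auto simp: in_domain_iff)
    have "x \<in> interior \<Omega>" by (rule interiorI[OF op _ sub]) (use \<open>\<rho> x < 0\<close> assms in auto)
    then show False using \<open>x \<notin> interior \<Omega>\<close> by simp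
  qed
  with le show "\<rho> x = 0" by simp
next
  assume 0: "\<rho> x = 0"
  have "x \<in> \<Omega>" using in_domain_iff[OF assms] 0 by simp
  moreover have "x \<notin> interior \<Omega>"
  proof
    assume x: "x \<in> interior \<Omega>"
    have max: "\<forall>y\<in>interior \<Omega> \<inter> N. \<rho> y \<le> \<rho> x" using in_domain_iff interior_subset[of \<Omega>] 0 by auto
    have "x \<in> interior \<Omega> \<inter> N" "open (interior \<Omega> \<inter> N)" using x assms open_N by auto
    from differential_zero_maxmin[OF this smooth_inD[OF smooth_rho assms] disjI1[OF max]]
    have "(\<lambda>w. ddir w \<rho> x) = (\<lambda>w. 0)" .
    from fun_cong[OF this] have "gradient \<rho> x = 0" unfolding gradient_def by (simp add: vec_eq_iff)
    then show False using gradient_nz[OF assms] by simp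
  qed
  ultimately show "x \<in> frontier \<Omega>" using closed_domain by (simp add: frontier_def)
qed

lemma enters_domain:
  assumes x: "x \<in> N" "x \<in> frontier \<Omega>" and w: "gradient \<rho> x \<bullet> w < 0"
  obtains d where "d > 0" "\<And>s. 0 < s \<Longrightarrow> s < d \<Longrightarrow> x + s *\<^sub>R w \<in> \<Omega>"
proof -
  have 0: "\<rho> x = 0" using rho_frontier_iff x by simp
  have "((\<lambda>s. x + s *\<^sub>R w) has_derivative (\<lambda>s. s *\<^sub>R w)) (at 0)"
    by (auto intro!: derivative_eq_intros)
  moreover have "(\<rho> has_derivative (\<lambda>w. ddir w \<rho> x)) (at (x + 0 *\<^sub>R w))" using smooth_inD[OF smooth_rho x(1)] by simp
  ultimately have "((\<lambda>s. \<rho> (x + s *\<^sub>R w)) has_derivative (\<lambda>s. ddir (s *\<^sub>R w) \<rho> x)) (at 0)"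
    by (rule has_derivative_compose)
  moreover have "ddir (s *\<^sub>R w) \<rho> x = (gradient \<rho> x \<bullet> w) * s" for s
    unfolding inner_gradient[OF smooth_rho x(1), symmetric] by simp
  ultimately have "((\<lambda>s. \<rho> (x + s *\<^sub>R w)) has_real_derivative (gradient \<rho> x \<bullet> w)) (at 0)"
    by (simp add: has_field_derivative_def)
  from DERIV_neg_dec_right[OF this w] obtain d where d: "d > 0" "\<And>s. 0 < s \<Longrightarrow> s < d \<Longrightarrow> \<rho> (x + s *\<^sub>R w) < 0"
    using 0 by auto
  have "open ((\<lambda>s. x + s *\<^sub>R w) -` N)" by (rule open_vimage[OF open_N]) (intro continuous_intros)
  then obtain e where e: "e > 0" "ball 0 e \<subseteq> (\<lambda>s. x + s *\<^sub>R w) -` N" using x(1) by (auto elim: openE[of _ 0])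
  have "x + s *\<^sub>R w \<in> \<Omega>" if "0 < s" "s < min d e" for s
  proof -
    have "x + s *\<^sub>R w \<in> N" using e(2) that by (auto simp: subset_iff)
    moreover have "\<rho> (x + s *\<^sub>R w) \<le> 0" using d(2)[of s] that by simp
    ultimately show ?thesis by (simp add: in_domain_iff)
  qed
  then show thesis using d(1) e(1) by (intro that[of "min d e"]) auto
qed

text \<open>If the unit normals \<open>n\<close> and \<open>n'\<close> differed, then along
  \<open>n' - n\<close> the function \<open>\<rho>\<close> would decrease and \<open>\<rho>'\<close>
  would increase to first order. Points close to \<open>x\<close> would lie both in the domain and
  outside it.\<close>

lemma normal_of_other_defining_function:
  assumes "defining_function \<Omega> N' \<rho>'" and x: "x \<in> N" "x \<in> N'" "x \<in> frontier \<Omega>"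
  shows "gradient \<rho>' x /\<^sub>R norm (gradient \<rho>' x) = gradient \<rho> x /\<^sub>R norm (gradient \<rho> x)"
proof (rule ccontr)
  interpret o: defining_function \<Omega> N' \<rho>' by fact
  define g g' where "g = gradient \<rho> x" and "g' = gradient \<rho>' x"
  define n n' where "n = g /\<^sub>R norm g" and "n' = g' /\<^sub>R norm g'"
  have nz: "norm g > 0" "norm g' > 0" using gradient_nz[OF x(1)] o.gradient_nz[OF x(2)] by (auto simp: g_def g'_def)
  have unit: "n \<bullet> n = 1" "n' \<bullet> n' = 1" using nz by (auto simp: n_def n'_def dot_square_norm power2_eq_square)
  have gn: "g = norm g *\<^sub>R n" "g' = norm g' *\<^sub>R n'" using nz by (auto simp: n_def n'_def)
  assume "\<not> ?thesis"
  then have "n' - n \<noteq> 0" by (simp add: n_def n'_def g_def g'_def)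
  then have "0 < (n' - n) \<bullet> (n' - n)" by simp
  then have lt: "n \<bullet> n' < 1" using unit by (simp add: inner_diff_left inner_diff_right inner_commute)
  have "g \<bullet> (n' - n) = norm g * (n \<bullet> n' - 1)" by (subst gn(1)) (simp add: inner_diff_right unit right_diff_distrib)
  then have "g \<bullet> (n' - n) < 0" using lt nz by (simp add: mult_pos_neg)
  then obtain d where d: "d > 0" "\<And>s. 0 < s \<Longrightarrow> s < d \<Longrightarrow> x + s *\<^sub>R (n' - n) \<in> \<Omega>"
    using enters_domain[OF x(1,3)] unfolding g_def by blast
  have "((\<lambda>s. x + s *\<^sub>R (n' - n)) has_derivative (\<lambda>s. s *\<^sub>R (n' - n))) (at 0)"
    by (auto intro!: derivative_eq_intros)
  moreover have "(\<rho>' has_derivative (\<lambda>w. ddir w \<rho>' x)) (at (x + 0 *\<^sub>R (n' - n)))" using smooth_inD[OF o.smooth_rho x(2)] by simp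
  ultimately have "((\<lambda>s. \<rho>' (x + s *\<^sub>R (n' - n))) has_derivative (\<lambda>s. ddir (s *\<^sub>R (n' - n)) \<rho>' x)) (at 0)"
    by (rule has_derivative_compose)
  moreover have "ddir (s *\<^sub>R (n' - n)) \<rho>' x = (g' \<bullet> (n' - n)) * s" for s
    unfolding inner_gradient[OF o.smooth_rho x(2), symmetric] g'_def by simp
  ultimately have D: "((\<lambda>s. \<rho>' (x + s *\<^sub>R (n' - n))) has_real_derivative (g' \<bullet> (n' - n))) (at 0)"
    by (simp add: has_field_derivative_def)
  have "g' \<bullet> (n' - n) = norm g' * (1 - n \<bullet> n')" by (subst gn(2)) (simp add: inner_diff_right unit inner_commute right_diff_distrib)
  then have "g' \<bullet> (n' - n) > 0" using lt nz by simp
  from DERIV_pos_inc_right[OF D this] o.rho_frontier_iff[OF x(2)] x(3)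
  obtain d' where d': "d' > 0" "\<And>s. 0 < s \<Longrightarrow> s < d' \<Longrightarrow> \<rho>' (x + s *\<^sub>R (n' - n)) > 0" by auto
  have "open ((\<lambda>s. x + s *\<^sub>R (n' - n)) -` N')" by (rule open_vimage[OF o.open_N]) (intro continuous_intros)
  then obtain e where e: "e > 0" "ball 0 e \<subseteq> (\<lambda>s. x + s *\<^sub>R (n' - n)) -` N'" using x(2) by (auto elim: openE[of _ 0])
  define s where "s = Min {d, d', e} / 2"
  have s: "0 < s" "s < d" "s < d'" "s < e" using d(1) d'(1) e(1) by (auto simp: s_def min_def)
  have "x + s *\<^sub>R (n' - n) \<in> N'" using e(2) s by (auto simp: subset_iff)
  then have "x + s *\<^sub>R (n' - n) \<in> {y \<in> N'. \<rho>' y \<le> 0}"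
    unfolding o.sublevel[symmetric] using d(2)[OF s(1,2)] by simp
  then show False using d'(2)[OF s(1,3)] by simp
qed

end

lemma local_defining_functionD:
  assumes "closed \<Omega>" "local_defining_function \<Omega> x U \<rho>"
  shows "defining_function \<Omega> U \<rho>" "x \<in> U"
proof -
  have U: "open U" "smooth_on U \<rho>" "x \<in> U" "\<forall>y\<in>U. \<not> (GDERIV \<rho> y :> 0)" "\<Omega> \<inter> U = {y \<in> U. \<rho> y \<le> 0}"
    using assms(2) by (auto simp: local_defining_function_def)
  have sm: "smooth_in U \<rho>" by (rule smooth_on_openD[OF U(1,2)])
  show "defining_function \<Omega> U \<rho>"
  proof
    show "gradient \<rho> y \<noteq> 0" if "y \<in> U" for y using gradient_GDERIV[OF sm that] U(4) that by auto
  qed (use U sm assms(1) in auto)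
  show "x \<in> U" by fact
qed

lemma (in defining_function) local_defining_functionI:
  assumes "x \<in> N"
  shows "local_defining_function \<Omega> x N \<rho>"
  unfolding local_defining_function_def
proof (intro conjI ballI)
  show "\<not> (GDERIV \<rho> y :> 0)" if "y \<in> N" for y
    using GDERIV_unique_real[OF gradient_GDERIV[OF smooth_rho that]] gradient_nz[OF that] by blast
qed (use assms open_N sublevel smooth_in_imp_smooth_on[OF open_N smooth_rho] in auto)

lemma (in defining_function) outward_normal_eq:
  assumes x: "x \<in> N" "x \<in> frontier \<Omega>"
  shows "outward_normal \<Omega> x = gradient \<rho> x /\<^sub>R norm (gradient \<rho> x)"
  unfolding outward_normal_def
proof (rule the_equality)
  show "\<exists>U \<rho>' g. local_defining_function \<Omega> x U \<rho>' \<and> GDERIV \<rho>' x :> g \<and> gradient \<rho> x /\<^sub>R norm (gradient \<rho> x) = g /\<^sub>R norm g"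
    using local_defining_functionI[OF x(1)] gradient_GDERIV[OF smooth_rho x(1)] by blast
  fix n assume "\<exists>U \<rho>' g. local_defining_function \<Omega> x U \<rho>' \<and> GDERIV \<rho>' x :> g \<and> n = g /\<^sub>R norm g"
  then obtain U \<rho>' g where U: "local_defining_function \<Omega> x U \<rho>'" "GDERIV \<rho>' x :> g" "n = g /\<^sub>R norm g" by blast
  note D = local_defining_functionD[OF closed_domain U(1)]
  interpret o: defining_function \<Omega> U \<rho>' by (rule D(1))
  have "g = gradient \<rho>' x" by (rule GDERIV_unique_real[OF U(2) gradient_GDERIV[OF o.smooth_rho D(2)]])
  then show "n = gradient \<rho> x /\<^sub>R norm (gradient \<rho> x)"
    using normal_of_other_defining_function[OF D(1) x(1) D(2) x(2)] U(3) by simp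
qed

section \<open>Boundary curves and curvature\<close>

lemma has_vector_derivative_ddir:
  fixes c :: "real \<Rightarrow> 'b::real_normed_vector"
  assumes "smooth_in S c" "s \<in> S"
  shows "(c has_vector_derivative ddir 1 c s) (at s)"
proof -
  have "ddir h c s = h *\<^sub>R ddir 1 c s" for h
    using linear_scale[OF ddir_linear[OF assms], of h 1] by simp
  then have "(\<lambda>h. ddir h c s) = (\<lambda>h. h *\<^sub>R ddir 1 c s)" by (rule ext)
  with smooth_inD[OF assms] show ?thesis unfolding has_vector_derivative_def by (simp only:)
qed

lemma (in defining_function) has_vector_derivative_rho_compose:
  assumes "c s \<in> N" "(c has_vector_derivative c') (at s within S)"
  shows "((\<lambda>s. \<rho> (c s)) has_vector_derivative gradient \<rho> (c s) \<bullet> c') (at s within S)"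
    "((\<lambda>s. gradient \<rho> (c s)) has_vector_derivative gradient (ddir c' \<rho>) (c s)) (at s within S)"
proof -
  have D: "(c has_derivative (\<lambda>h. h *\<^sub>R c')) (at s within S)" using assms(2) by (simp add: has_vector_derivative_def)
  have e: "ddir (h *\<^sub>R c') \<rho> y = h *\<^sub>R ddir c' \<rho> y" if "y \<in> N" for h y
    by (rule linear_scale[OF ddir_linear[OF smooth_rho that]])
  have "((\<lambda>s. \<rho> (c s)) has_derivative (\<lambda>h. ddir (h *\<^sub>R c') \<rho> (c s))) (at s within S)"
    by (rule has_derivative_compose[OF D smooth_inD[OF smooth_rho assms(1)]])
  then show "((\<lambda>s. \<rho> (c s)) has_vector_derivative gradient \<rho> (c s) \<bullet> c') (at s within S)"
    unfolding has_vector_derivative_def inner_gradient[OF smooth_rho assms(1)] e[OF assms(1)] .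
  have G: "((\<lambda>s. gradient \<rho> (c s)) has_derivative (\<lambda>h. gradient (ddir (h *\<^sub>R c') \<rho>) (c s))) (at s within S)"
    by (rule has_derivative_compose[OF D has_derivative_gradient[OF open_N smooth_rho assms(1)]])
  have "gradient (ddir (h *\<^sub>R c') \<rho>) (c s) = h *\<^sub>R gradient (ddir c' \<rho>) (c s)" for h
  proof -
    have "ddir (axis i 1) (ddir (h *\<^sub>R c') \<rho>) (c s) = h * ddir (axis i 1) (ddir c' \<rho>) (c s)" for i
      unfolding ddir_commute[OF open_N smooth_rho assms(1), of "axis i 1"]
      using linear_scale[OF ddir_linear[OF smooth_in_ddir[OF smooth_rho] assms(1)], of h c'] by simp
    then show ?thesis by (simp add: gradient_def vec_eq_iff)
  qed
  then have "(\<lambda>h. gradient (ddir (h *\<^sub>R c') \<rho>) (c s)) = (\<lambda>h. h *\<^sub>R gradient (ddir c' \<rho>) (c s))" by (rule ext)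
  with G show "((\<lambda>s. gradient \<rho> (c s)) has_vector_derivative gradient (ddir c' \<rho>) (c s)) (at s within S)"
    unfolding has_vector_derivative_def by (simp only:)
qed

text \<open>The identity \<open>\<rho> (\<gamma> s) = 0\<close> is differentiated once and then
  again. This expresses the normal acceleration of any boundary curve by the Hessian of
  \<open>\<rho>\<close> at its velocity.\<close>

lemma (in defining_function) second_derivative_boundary_curve:
  fixes \<gamma> :: "real \<Rightarrow> real^2" and \<epsilon> :: real
  assumes \<epsilon>: "\<epsilon> > 0" and \<gamma>: "smooth_in {-\<epsilon><..<\<epsilon>} \<gamma>" "\<gamma> ` {-\<epsilon><..<\<epsilon>} \<subseteq> frontier \<Omega>" and x: "\<gamma> 0 \<in> N"
  shows "gradient \<rho> (\<gamma> 0) \<bullet> ddir 1 \<gamma> 0 = 0"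
    "gradient \<rho> (\<gamma> 0) \<bullet> ddir 1 (ddir 1 \<gamma>) 0 = - ddir (ddir 1 \<gamma> 0) (ddir (ddir 1 \<gamma> 0) \<rho>) (\<gamma> 0)"
proof -
  define S where "S = {-\<epsilon><..<\<epsilon>} \<inter> \<gamma> -` N"
  have S: "open S" "0 \<in> S" "S \<subseteq> {-\<epsilon><..<\<epsilon>}" unfolding S_def
    using x \<epsilon> by (auto intro!: continuous_open_preimage[OF smooth_in_continuous[OF \<gamma>(1)] _ open_N])
  note D = has_vector_derivative_ddir[OF \<gamma>(1)]
  have SN: "\<gamma> s \<in> N" "s \<in> {-\<epsilon><..<\<epsilon>}" if "s \<in> S" for s using that by (auto simp: S_def)
  have first: "gradient \<rho> (\<gamma> s) \<bullet> ddir 1 \<gamma> s = 0" if s: "s \<in> S" for s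
  proof -
    have "\<rho> (\<gamma> r) = 0" if "r \<in> S" for r
    proof -
      have "\<gamma> r \<in> frontier \<Omega>" using \<gamma>(2) SN(2)[OF that] by blast
      then show ?thesis using rho_frontier_iff[OF SN(1)[OF that]] by simp
    qed
    then have "((\<lambda>s. \<rho> (\<gamma> s)) has_vector_derivative 0) (at s)"
      using has_vector_derivative_transform_within_open[OF has_vector_derivative_const[of 0] S(1) s, of "\<lambda>s. \<rho> (\<gamma> s)"] by auto
    from vector_derivative_unique_at[OF has_vector_derivative_rho_compose(1)[OF SN(1)[OF s] D[OF SN(2)[OF s]]] this]
    show ?thesis .
  qed
  show "gradient \<rho> (\<gamma> 0) \<bullet> ddir 1 \<gamma> 0 = 0" by (rule first[OF S(2)])
  have "((\<lambda>s. gradient \<rho> (\<gamma> s) \<bullet> ddir 1 \<gamma> s) has_vector_derivative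
     gradient \<rho> (\<gamma> 0) \<bullet> ddir 1 (ddir 1 \<gamma>) 0 + gradient (ddir (ddir 1 \<gamma> 0) \<rho>) (\<gamma> 0) \<bullet> ddir 1 \<gamma> 0) (at 0)"
    by (rule bounded_bilinear.has_vector_derivative[OF bounded_bilinear_inner
        has_vector_derivative_rho_compose(2)[OF SN(1)[OF S(2)] D[OF SN(2)[OF S(2)]]]
        has_vector_derivative_ddir[OF smooth_in_ddir[OF \<gamma>(1)] SN(2)[OF S(2)]]])
  moreover have "((\<lambda>s. gradient \<rho> (\<gamma> s) \<bullet> ddir 1 \<gamma> s) has_vector_derivative 0) (at 0)"
    using has_vector_derivative_transform_within_open[OF has_vector_derivative_const[of 0] S(1,2), of "\<lambda>s. gradient \<rho> (\<gamma> s) \<bullet> ddir 1 \<gamma> s"] first by auto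
  ultimately have "gradient \<rho> (\<gamma> 0) \<bullet> ddir 1 (ddir 1 \<gamma>) 0 + gradient (ddir (ddir 1 \<gamma> 0) \<rho>) (\<gamma> 0) \<bullet> ddir 1 \<gamma> 0 = 0"
    by (rule vector_derivative_unique_at)
  then show "gradient \<rho> (\<gamma> 0) \<bullet> ddir 1 (ddir 1 \<gamma>) 0 = - ddir (ddir 1 \<gamma> 0) (ddir (ddir 1 \<gamma> 0) \<rho>) (\<gamma> 0)"
    by (simp add: inner_gradient[OF smooth_in_ddir[OF smooth_rho] x])
qed

text \<open>The level curve of \<open>\<rho>\<close> through \<open>x\<close> is obtained by inverting the chart \<open>y \<mapsto> (\<rho> y, \<tau> \<bullet> (y - x))\<close>.\<close>

lemma (in defining_function) boundary_curve_exists: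
  assumes x: "x \<in> N" "x \<in> frontier \<Omega>"
  obtains \<delta> :: real and c :: "real \<Rightarrow> real^2" where "\<delta> > 0" "smooth_in {-\<delta><..<\<delta>} c" "c ` {-\<delta><..<\<delta>} \<subseteq> frontier \<Omega>" "c 0 = x"
    "\<And>s. s \<in> {-\<delta><..<\<delta>} \<Longrightarrow> 1 \<le> norm (ddir 1 c s)"
proof -
  define g where "g = gradient \<rho> x"
  have g: "g \<noteq> 0" using gradient_nz[OF x(1)] by (simp add: g_def)
  define \<tau> where "\<tau> = perp g /\<^sub>R norm g"
  have \<tau>: "norm \<tau> = 1" "g \<bullet> \<tau> = 0" using g by (auto simp: \<tau>_def)
  \<comment> \<open>A dummy time variable, on which \<open>X\<close> does not depend, makes
    \<open>local_chart\<close> applicable.\<close>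
  define X where "X y = \<rho> (fst y) *\<^sub>R axis 1 1 + (\<tau> \<bullet> (fst y - x)) *\<^sub>R (axis 2 1 :: real^2)" for y :: "(real^2) \<times> real"
  define U where "U = N \<times> (UNIV :: real set)"
  have U: "open U" "(x, 0) \<in> U" using open_N x(1) by (auto simp: U_def open_Times)
  have sfst: "smooth_in U fst" by (rule smooth_in_bounded_linear[OF U(1) bounded_linear_fst])
  have srho: "smooth_in U (\<lambda>y. \<rho> (fst y))"
    by (rule smooth_in_compose[OF U(1) open_N _ sfst smooth_rho]) (auto simp: U_def)
  have sX: "smooth_in U X" unfolding X_def[abs_def]
    by (intro smooth_in_add smooth_in_scaleR smooth_in_const smooth_in_inner smooth_in_diff sfst srho U(1))
  have dX: "ddir (d, 0) X (x, 0) = (g \<bullet> d) *\<^sub>R axis 1 1 + (\<tau> \<bullet> d) *\<^sub>R axis 2 1" for d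
  proof -
    have "((\<lambda>y::(real^2) \<times> real. \<rho> (fst y)) has_derivative (\<lambda>w. ddir (fst w) \<rho> x)) (at (x, 0))"
      using has_derivative_compose[OF has_derivative_fst[OF has_derivative_ident], of \<rho> "\<lambda>w. ddir w \<rho> x" "(x, 0)"]
        smooth_inD[OF smooth_rho x(1)] by simp
    moreover have "((\<lambda>y::(real^2) \<times> real. \<tau> \<bullet> (fst y - x)) has_derivative (\<lambda>w. \<tau> \<bullet> fst w)) (at (x, 0))"
      by (auto intro!: derivative_eq_intros)
    ultimately have "(X has_derivative (\<lambda>w. ddir (fst w) \<rho> x *\<^sub>R axis 1 1 + (\<tau> \<bullet> fst w) *\<^sub>R axis 2 1)) (at (x, 0))"
      unfolding X_def[abs_def] by (intro has_derivative_add has_derivative_scaleR_left)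
    from ddir_eqI[OF this, of "(d, 0)"] show ?thesis by (simp add: g_def inner_gradient[OF smooth_rho x(1)])
  qed
  have inj: "d = 0" if "ddir (d, 0) X (x, 0) = 0" for d
  proof -
    have z: "g \<bullet> d = 0" "\<tau> \<bullet> d = 0" using that unfolding dX by (auto simp: vec_eq_iff forall_2 axis_def)
    obtain c where c: "d = c *\<^sub>R perp g" by (rule orthogonal_imp_perp[OF g z(1)])
    have "c * (g \<bullet> g) = 0" using z(2) g unfolding c \<tau>_def by simp
    then show "d = 0" using g by (simp add: c)
  qed
  show thesis
  proof (rule local_chart[OF U(1) sX U(2) inj])
    fix V W \<Gamma> assume V: "open V" "V \<subseteq> U" "(x, 0) \<in> V" "open W" "(\<lambda>y. (X y, snd y)) ` V = W"
      "\<And>y. y \<in> V \<Longrightarrow> \<Gamma> (X y, snd y) = y" "\<Gamma> ` W = V" "smooth_in W \<Gamma>"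
      "\<And>y. y \<in> W \<Longrightarrow> (X (\<Gamma> y), snd (\<Gamma> y)) = y"
    have X0: "X (x, 0) = 0" using rho_frontier_iff[OF x(1)] x(2) by (simp add: X_def)
    define l where "l s = (s *\<^sub>R axis 2 1 :: real^2, 0 :: real)" for s :: real
    have bl: "bounded_linear l" unfolding l_def[abs_def]
      by (intro bounded_linear_Pair bounded_linear_zero bounded_linear_scaleR_left)
    have "(0, 0) \<in> W" using V(5) V(3) X0 by (metis (no_types, lifting) image_eqI snd_conv)
    then have l0: "l 0 \<in> W" by (simp add: l_def)
    have "open (l -` W)" by (rule open_vimage[OF V(4)]) (rule linear_continuous_on[OF bl])
    then obtain \<delta> where \<delta>: "\<delta> > 0" "ball 0 \<delta> \<subseteq> l -` W" using l0 by (auto elim: openE[of _ 0])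
    have lW: "l s \<in> W" if "s \<in> {-\<delta><..<\<delta>}" for s using \<delta>(2) that by (auto simp: subset_iff)
    define c where "c s = fst (\<Gamma> (l s))" for s
    have sc: "smooth_in {-\<delta><..<\<delta>} c" unfolding c_def[abs_def]
      by (intro smooth_in_fst open_greaterThanLessThan smooth_in_compose[OF _ V(4) _ smooth_in_bounded_linear[OF _ bl] V(8)])
        (use lW in auto)
    have c: "c s \<in> N" "\<rho> (c s) = 0" "\<tau> \<bullet> (c s - x) = s" if s: "s \<in> {-\<delta><..<\<delta>}" for s
    proof -
      have "\<Gamma> (l s) \<in> U" using lW[OF s] V(2,7) by auto
      then show "c s \<in> N" by (auto simp: U_def c_def)
      have "X (\<Gamma> (l s)) = s *\<^sub>R axis 2 1" using V(9)[OF lW[OF s]] by (simp add: l_def prod_eq_iff)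
      then show "\<rho> (c s) = 0" "\<tau> \<bullet> (c s - x) = s" by (auto simp: X_def c_def vec_eq_iff forall_2 axis_def)
    qed
    show thesis
    proof (rule that[OF \<delta>(1) sc])
      show "c ` {-\<delta><..<\<delta>} \<subseteq> frontier \<Omega>" using c rho_frontier_iff by auto
      have "\<Gamma> (l 0) = (x, 0)" using V(6)[OF V(3)] X0 by (simp add: l_def)
      then show "c 0 = x" by (simp add: c_def)
      fix s assume s: "s \<in> {-\<delta><..<\<delta>}"
      \<comment> \<open>The parameter is the coordinate along the unit vector \<open>\<tau>\<close>,
        so the velocity has component 1 along \<open>\<tau>\<close> and norm at least 1.\<close>
      have "((\<lambda>s. \<tau> \<bullet> (c s - x)) has_vector_derivative \<tau> \<bullet> (ddir 1 c s - 0)) (at s)"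
        by (intro bounded_linear.has_vector_derivative[OF bounded_linear_inner_right] has_vector_derivative_diff
            has_vector_derivative_ddir[OF sc s] has_vector_derivative_const)
      moreover have "((\<lambda>s. \<tau> \<bullet> (c s - x)) has_vector_derivative 1) (at s)"
        by (rule has_vector_derivative_transform_within_open[OF has_vector_derivative_id _ s]) (auto simp: c(3))
      ultimately have "\<tau> \<bullet> (ddir 1 c s - 0) = 1" by (rule vector_derivative_unique_at)
      then show "1 \<le> norm (ddir 1 c s)" using Cauchy_Schwarz_ineq2[of \<tau> "ddir 1 c s"] \<tau>(1) by simp
    qed
  qed
qed

text \<open>As the speed is at least 1, arclength is injective and grows at least as fast as the
  parameter. The derivative of its inverse \<open>\<theta>\<close> is the reciprocal speed at
  \<open>\<theta>\<close>, a smooth function of \<open>\<theta>\<close>, so bootstrapping gives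
  smoothness.\<close>

lemma arclength_parametrization:
  fixes c :: "real \<Rightarrow> real^2" and \<delta> :: real
  assumes \<delta>: "\<delta> > 0" and c: "smooth_in {-\<delta><..<\<delta>} c" and reg: "\<And>s. s \<in> {-\<delta><..<\<delta>} \<Longrightarrow> 1 \<le> norm (ddir 1 c s)"
  obtains \<epsilon> :: real and \<gamma> :: "real \<Rightarrow> real^2" where "\<epsilon> > 0" "smooth_in {-\<epsilon><..<\<epsilon>} \<gamma>"
    "\<gamma> ` {-\<epsilon><..<\<epsilon>} \<subseteq> c ` {-\<delta><..<\<delta>}" "\<gamma> 0 = c 0" "\<And>s. s \<in> {-\<epsilon><..<\<epsilon>} \<Longrightarrow> norm (ddir 1 \<gamma> s) = 1"
proof -
  define D where "D = {-\<delta><..<\<delta>}"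
  \<comment> \<open>Halving provides a compact interval inside the domain of \<open>c\<close> on
    which the speed can be integrated.\<close>
  define b where "b = \<delta> / 2"
  define S where "S = {-b<..<b}"
  have b: "b > 0" "S \<subseteq> D" "{-b..b} \<subseteq> D" using \<delta> by (auto simp: b_def S_def D_def)
  note sc = c[folded D_def] and reg = reg[folded D_def]
  have sc': "smooth_in D (ddir 1 c)" by (rule smooth_in_ddir[OF sc])
  define h where "h s = norm (ddir 1 c s)" for s
  have ch: "continuous_on {-b..b} h" unfolding h_def[abs_def]
    by (intro continuous_intros continuous_on_subset[OF smooth_in_continuous[OF sc'] b(3)])
  have h1: "1 \<le> h s" if "s \<in> D" for s using reg[OF that] by (simp add: h_def)
  define \<sigma> where "\<sigma> s = integral {-b..s} h - integral {-b..0} h" for s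
  have d\<sigma>: "(\<sigma> has_real_derivative h s) (at s)" if "s \<in> S" for s
  proof -
    have "((\<lambda>x. integral {-b..x} h) has_real_derivative h s) (at s within {-b..b})"
      by (rule integral_has_real_derivative[OF ch]) (use that in \<open>auto simp: S_def\<close>)
    then have "((\<lambda>x. integral {-b..x} h) has_real_derivative h s) (at s)"
      using that at_within_interior[of s "{-b..b}"] by (simp add: S_def)
    then show ?thesis unfolding \<sigma>_def[abs_def] by (auto intro!: derivative_eq_intros)
  qed
  have grow: "y - x \<le> \<sigma> y - \<sigma> x" if "x \<in> S" "y \<in> S" "x \<le> y" for x y
  proof (cases "x = y")
    case False
    then have xy: "x < y" using that by simp
    have "\<exists>z>x. z < y \<and> \<sigma> y - \<sigma> x = (y - x) * h z"
      by (rule MVT2[OF xy]) (use that in \<open>auto simp: S_def intro!: d\<sigma>\<close>)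
    then obtain z where z: "x < z" "z < y" "\<sigma> y - \<sigma> x = (y - x) * h z" by blast
    have "z \<in> D" using that z b(2) by (auto simp: S_def)
    then have "(y - x) * 1 \<le> (y - x) * h z" using h1 xy by (intro mult_left_mono) auto
    then show ?thesis using z by simp
  qed simp
  have inj: "inj_on \<sigma> S"
  proof (rule inj_onI)
    fix x y assume xy: "x \<in> S" "y \<in> S" "\<sigma> x = \<sigma> y"
    show "x = y"
    proof (cases "x \<le> y")
      case True
      then show ?thesis using grow[OF xy(1,2)] xy(3) by simp
    next
      case False
      then show ?thesis using grow[OF xy(2,1)] xy(3) by simp
    qed
  qed
  \<comment> \<open>The closed interval of radius \<open>\<epsilon>\<close> lies in
    \<open>S\<close>. Since \<open>\<sigma>\<close> grows at rate at least 1 and vanishes at 0, its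
    image covers the open interval of the same radius.\<close>
  define \<epsilon> where "\<epsilon> = b / 2"
  have \<epsilon>: "\<epsilon> > 0" "{-\<epsilon>..\<epsilon>} \<subseteq> S" "0 \<in> S" using b(1) by (auto simp: \<epsilon>_def S_def)
  have \<sigma>0: "\<sigma> 0 = 0" by (simp add: \<sigma>_def)
  define \<theta> where "\<theta> = inv_into S \<sigma>"
  have \<theta>\<sigma>: "\<theta> (\<sigma> s) = s" if "s \<in> S" for s using inv_into_f_f[OF inj that] by (simp add: \<theta>_def)
  have surj: "\<exists>s\<in>S. \<sigma> s = r" if r: "r \<in> {-\<epsilon><..<\<epsilon>}" for r
  proof -
    have "\<epsilon> \<in> {-\<epsilon>..\<epsilon>}" "-\<epsilon> \<in> {-\<epsilon>..\<epsilon>}" using \<epsilon>(1) by auto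
    then have "\<epsilon> \<in> S" "-\<epsilon> \<in> S" using \<epsilon>(2) by blast+
    then have "\<sigma> (-\<epsilon>) \<le> r" "r \<le> \<sigma> \<epsilon>" using grow[of 0 \<epsilon>] grow[of "-\<epsilon>" 0] \<epsilon>(1,3) r \<sigma>0 by auto
    moreover have "continuous_on {-\<epsilon>..\<epsilon>} \<sigma>"
      using DERIV_isCont[OF d\<sigma>] \<epsilon>(2) by (intro continuous_at_imp_continuous_on ballI) blast
    ultimately have "\<exists>s\<ge>-\<epsilon>. s \<le> \<epsilon> \<and> \<sigma> s = r" using \<epsilon>(1) by (intro IVT') auto
    then show ?thesis using \<epsilon>(2) by auto
  qed
  have \<theta>: "\<theta> r \<in> S" "\<sigma> (\<theta> r) = r" if r: "r \<in> {-\<epsilon><..<\<epsilon>}" for r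
  proof -
    obtain s where s: "s \<in> S" "\<sigma> s = r" using surj[OF r] by blast
    then show "\<theta> r \<in> S" "\<sigma> (\<theta> r) = r" using \<theta>\<sigma>[OF s(1)] by auto
  qed
  \<comment> \<open>The reciprocal speed, written as a power of the inner product so that it is
    visibly smooth.\<close>
  define B where "B w s = w * (ddir 1 c s \<bullet> ddir 1 c s) powr (-1/2)" for w s
  have Bh: "B w s = w / h s" if "s \<in> D" for w s
  proof -
    have pos: "0 < ddir 1 c s \<bullet> ddir 1 c s" using h1[OF that] unfolding h_def by (cases "ddir 1 c s = 0") auto
    have "(ddir 1 c s \<bullet> ddir 1 c s) powr (-1/2) = inverse ((ddir 1 c s \<bullet> ddir 1 c s) powr (1/2))"
      using powr_minus[of "ddir 1 c s \<bullet> ddir 1 c s" "1/2"] by simp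
    also have "(ddir 1 c s \<bullet> ddir 1 c s) powr (1/2) = h s"
      unfolding h_def norm_eq_sqrt_inner by (rule powr_half_sqrt) (use pos in linarith)
    finally have "B w s = w * inverse (h s)" unfolding B_def by (simp only:)
    then show ?thesis by (simp only: divide_inverse)
  qed
  have sB: "smooth_in D (B w)" for w
  proof -
    have "0 < ddir 1 c s \<bullet> ddir 1 c s" if "s \<in> D" for s
      using h1[OF that] unfolding h_def by (cases "ddir 1 c s = 0") auto
    then show ?thesis unfolding B_def[abs_def]
      by (intro smooth_in_mult smooth_in_const smooth_in_powr smooth_in_inner sc') (auto simp: D_def)
  qed
  have d\<theta>: "(\<theta> has_derivative (\<lambda>w. w / h (\<theta> r))) (at r)" if r: "r \<in> {-\<epsilon><..<\<epsilon>}" for r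
  proof -
    have "(\<theta> has_derivative (\<lambda>w. w / h (\<theta> r))) (at (\<sigma> (\<theta> r)))"
    proof (rule has_derivative_inverse_on[where S=S and f'="\<lambda>x. (*) (h x)" and g'="\<lambda>x w. w / h x"])
      show "open S" by (simp add: S_def)
      show "(\<sigma> has_derivative (*) (h x)) (at x)" if "x \<in> S" for x
        using d\<sigma>[OF that] by (simp add: has_field_derivative_def)
      have "h (\<theta> r) \<noteq> 0" using h1[of "\<theta> r"] \<theta>(1)[OF r] b(2) by auto
      then show "(*) (h (\<theta> r)) \<circ> (\<lambda>w. w / h (\<theta> r)) = id" by (simp add: fun_eq_iff)
    qed (use \<theta>\<sigma> \<theta>(1)[OF r] in auto)
    then show ?thesis by (simp add: \<theta>(2)[OF r])
  qed
  have s\<theta>: "smooth_in {-\<epsilon><..<\<epsilon>} \<theta>"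
  proof (rule smooth_in_bootstrap[OF _ _ _ _ sB])
    show "open {-\<epsilon><..<\<epsilon>}" "open D" by (simp_all add: D_def)
    show "\<theta> ` {-\<epsilon><..<\<epsilon>} \<subseteq> D" using \<theta>(1) b(2) by auto
    show "(\<theta> has_derivative (\<lambda>w. B w (\<theta> r))) (at r)" if r: "r \<in> {-\<epsilon><..<\<epsilon>}" for r
    proof -
      have "\<theta> r \<in> D" using \<theta>(1)[OF r] b(2) by auto
      then show ?thesis using d\<theta>[OF r] by (simp add: Bh)
    qed
  qed
  show thesis
  proof (rule that[OF \<epsilon>(1), of "\<lambda>r. c (\<theta> r)"])
    show "smooth_in {-\<epsilon><..<\<epsilon>} (\<lambda>r. c (\<theta> r))"
      by (rule smooth_in_compose[OF _ _ _ s\<theta> sc]) (use \<theta>(1) b(2) in \<open>auto simp: D_def\<close>)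
    show "(\<lambda>r. c (\<theta> r)) ` {-\<epsilon><..<\<epsilon>} \<subseteq> c ` {-\<delta><..<\<delta>}" using \<theta>(1) b(2) unfolding D_def by blast
    show "c (\<theta> 0) = c 0" using \<theta>\<sigma>[OF \<epsilon>(3)] \<sigma>0 by simp
    fix r assume r: "r \<in> {-\<epsilon><..<\<epsilon>}"
    have rD: "\<theta> r \<in> D" using \<theta>(1)[OF r] b(2) by auto
    from has_derivative_compose[OF d\<theta>[OF r] smooth_inD[OF sc rD]]
    have "ddir 1 (\<lambda>r. c (\<theta> r)) r = ddir (1 / h (\<theta> r)) c (\<theta> r)" by (rule ddir_eqI)
    also have "\<dots> = (1 / h (\<theta> r)) *\<^sub>R ddir 1 c (\<theta> r)"
      using linear_scale[OF ddir_linear[OF sc rD], of "1 / h (\<theta> r)" 1] by simp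
    finally show "norm (ddir 1 (\<lambda>r. c (\<theta> r)) r) = 1" using h1[OF rD] unfolding h_def by (cases "ddir 1 c (\<theta> r) = 0") auto
  qed
qed

lemma vector_derivative_ddir:
  fixes \<gamma> :: "real \<Rightarrow> real^2"
  assumes "smooth_in S \<gamma>" "s \<in> S"
  shows "vector_derivative \<gamma> (at s) = ddir 1 \<gamma> s"
  by (rule vector_derivative_at[OF has_vector_derivative_ddir[OF assms]])

lemma vector_derivative2_ddir:
  fixes \<gamma> :: "real \<Rightarrow> real^2"
  assumes "open S" "smooth_in S \<gamma>" "s \<in> S"
  shows "vector_derivative (\<lambda>s. vector_derivative \<gamma> (at s)) (at s) = ddir 1 (ddir 1 \<gamma>) s"
proof (rule vector_derivative_at)
  show "((\<lambda>s. vector_derivative \<gamma> (at s)) has_vector_derivative ddir 1 (ddir 1 \<gamma>) s) (at s)"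
    by (rule has_vector_derivative_transform_within_open[OF has_vector_derivative_ddir[OF smooth_in_ddir[OF assms(2)] assms(3)] assms(1,3)])
      (simp add: vector_derivative_ddir[OF assms(2)])
qed

context defining_function
begin

lemma ddir2_scaleR:
  assumes "x \<in> N"
  shows "ddir (h *\<^sub>R a) (ddir (h *\<^sub>R a) \<rho>) x = h * h * ddir a (ddir a \<rho>) x"
proof -
  have "ddir (h *\<^sub>R a) (ddir (h *\<^sub>R a) \<rho>) x = h * ddir a (ddir (h *\<^sub>R a) \<rho>) x"
    using linear_scale[OF ddir_linear[OF smooth_in_ddir[OF smooth_rho] assms], of h a] by simp
  also have "ddir a (ddir (h *\<^sub>R a) \<rho>) x = ddir (h *\<^sub>R a) (ddir a \<rho>) x" by (rule ddir_commute[OF open_N smooth_rho assms])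
  also have "\<dots> = h * ddir a (ddir a \<rho>) x"
    using linear_scale[OF ddir_linear[OF smooth_in_ddir[OF smooth_rho] assms], of h a] by simp
  finally show ?thesis by simp
qed

text \<open>Every unit-speed boundary curve through \<open>x\<close> has velocity
  \<open>\<tau>\<close> or \<open>- \<tau>\<close>, and the second derivative of
  \<open>\<rho>\<close> is even in the velocity, so all curves yield the same number. The arclength
  parametrization supplies one such curve.\<close>

lemma boundary_curvature_eq:
  assumes x: "x \<in> N" "x \<in> frontier \<Omega>" and \<tau>: "norm \<tau> = 1" "gradient \<rho> x \<bullet> \<tau> = 0"
  shows "boundary_curvature \<Omega> x = ddir \<tau> (ddir \<tau> \<rho>) x / norm (gradient \<rho> x)"
proof -
  have key: "- (vector_derivative (\<lambda>s. vector_derivative \<gamma> (at s)) (at 0) \<bullet> outward_normal \<Omega> x)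
      = ddir \<tau> (ddir \<tau> \<rho>) x / norm (gradient \<rho> x)"
    if \<gamma>: "\<epsilon> > 0" "smooth_in {-\<epsilon><..<\<epsilon>} \<gamma>" "\<gamma> ` {-\<epsilon><..<\<epsilon>} \<subseteq> frontier \<Omega>" "\<gamma> 0 = x" "norm (ddir 1 \<gamma> 0) = 1" for \<gamma> and \<epsilon> :: real
  proof -
    have x': "\<gamma> 0 \<in> N" using x \<gamma>(4) by simp
    note sd = second_derivative_boundary_curve[OF \<gamma>(1-3) x', unfolded \<gamma>(4)]
    have "ddir 1 \<gamma> 0 = \<tau> \<or> ddir 1 \<gamma> 0 = - \<tau>"
      by (rule unit_orthogonal_cases[OF gradient_nz[OF x(1)] sd(1) \<tau>(2) \<gamma>(5) \<tau>(1)])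
    then have "ddir (ddir 1 \<gamma> 0) (ddir (ddir 1 \<gamma> 0) \<rho>) x = ddir \<tau> (ddir \<tau> \<rho>) x"
      using ddir2_scaleR[OF x(1), of "-1" \<tau>] by auto
    moreover have "vector_derivative (\<lambda>s. vector_derivative \<gamma> (at s)) (at 0) = ddir 1 (ddir 1 \<gamma>) 0"
      by (rule vector_derivative2_ddir[OF _ \<gamma>(2)]) (use \<gamma>(1) in auto)
    ultimately show ?thesis
      using sd(2) by (simp add: outward_normal_eq[OF x] inner_commute divide_inverse)
  qed
  show ?thesis unfolding boundary_curvature_def
  proof (rule the_equality)
    show "\<exists>\<epsilon>>0. \<exists>\<gamma>. smooth_on {-\<epsilon><..<\<epsilon>} \<gamma> \<and> \<gamma> ` {-\<epsilon><..<\<epsilon>} \<subseteq> frontier \<Omega> \<and> \<gamma> 0 = x \<and>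
        (\<forall>s\<in>{-\<epsilon><..<\<epsilon>}. norm (vector_derivative \<gamma> (at s)) = 1) \<and>
        ddir \<tau> (ddir \<tau> \<rho>) x / norm (gradient \<rho> x) = - (vector_derivative (\<lambda>s. vector_derivative \<gamma> (at s)) (at 0) \<bullet> outward_normal \<Omega> x)"
    proof (rule boundary_curve_exists[OF x])
      fix \<delta> :: real and c :: "real \<Rightarrow> real^2"
      assume c: "\<delta> > 0" "smooth_in {-\<delta><..<\<delta>} c" "c ` {-\<delta><..<\<delta>} \<subseteq> frontier \<Omega>" "c 0 = x"
        "\<And>s. s \<in> {-\<delta><..<\<delta>} \<Longrightarrow> 1 \<le> norm (ddir 1 c s)"
      show ?thesis
      proof (rule arclength_parametrization[OF c(1,2,5)])
        fix \<epsilon> :: real and \<gamma> :: "real \<Rightarrow> real^2"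
        assume \<gamma>: "\<epsilon> > 0" "smooth_in {-\<epsilon><..<\<epsilon>} \<gamma>" "\<gamma> ` {-\<epsilon><..<\<epsilon>} \<subseteq> c ` {-\<delta><..<\<delta>}" "\<gamma> 0 = c 0"
          "\<And>s. s \<in> {-\<epsilon><..<\<epsilon>} \<Longrightarrow> norm (ddir 1 \<gamma> s) = 1"
        have fr: "\<gamma> ` {-\<epsilon><..<\<epsilon>} \<subseteq> frontier \<Omega>" using \<gamma>(3) c(3) by (rule subset_trans)
        have g0: "\<gamma> 0 = x" using \<gamma>(4) c(4) by simp
        have "norm (ddir 1 \<gamma> 0) = 1" using \<gamma>(5)[of 0] \<gamma>(1) by simp
        note k = key[OF \<gamma>(1,2) fr g0 this]
        have "\<forall>s\<in>{-\<epsilon><..<\<epsilon>}. norm (vector_derivative \<gamma> (at s)) = 1"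
          using \<gamma>(5) vector_derivative_ddir[OF \<gamma>(2)] by simp
        moreover have "smooth_on {-\<epsilon><..<\<epsilon>} \<gamma>" by (rule smooth_in_imp_smooth_on[OF _ \<gamma>(2)]) simp
        ultimately show ?thesis using \<gamma>(1) fr g0 k[symmetric] by blast
      qed
    qed
    fix k assume "\<exists>\<epsilon>>0. \<exists>\<gamma>. smooth_on {-\<epsilon><..<\<epsilon>} \<gamma> \<and> \<gamma> ` {-\<epsilon><..<\<epsilon>} \<subseteq> frontier \<Omega> \<and> \<gamma> 0 = x \<and>
        (\<forall>s\<in>{-\<epsilon><..<\<epsilon>}. norm (vector_derivative \<gamma> (at s)) = 1) \<and>
        k = - (vector_derivative (\<lambda>s. vector_derivative \<gamma> (at s)) (at 0) \<bullet> outward_normal \<Omega> x)"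
    then obtain \<epsilon> \<gamma> where \<gamma>: "\<epsilon> > 0" "smooth_on {-\<epsilon><..<\<epsilon>} \<gamma>" "\<gamma> ` {-\<epsilon><..<\<epsilon>} \<subseteq> frontier \<Omega>" "\<gamma> 0 = x"
      "\<forall>s\<in>{-\<epsilon><..<\<epsilon>}. norm (vector_derivative \<gamma> (at s)) = 1"
      "k = - (vector_derivative (\<lambda>s. vector_derivative \<gamma> (at s)) (at 0) \<bullet> outward_normal \<Omega> x)" by auto
    have sm: "smooth_in {-\<epsilon><..<\<epsilon>} \<gamma>" by (rule smooth_on_openD[OF _ \<gamma>(2)]) simp
    have in0: "0 \<in> {-\<epsilon><..<\<epsilon>}" using \<gamma>(1) by simp
    have "norm (ddir 1 \<gamma> 0) = 1" using bspec[OF \<gamma>(5) in0] unfolding vector_derivative_ddir[OF sm in0] .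
    from key[OF \<gamma>(1) sm \<gamma>(3,4) this] show "k = ddir \<tau> (ddir \<tau> \<rho>) x / norm (gradient \<rho> x)" using \<gamma>(6) by simp
  qed
qed

end

text \<open>\<open>a\<close> extends the angle, as a function of the base point alone, off the
  boundary so that it has a full gradient. The last condition says that the curvature is at least
  \<open>k\<close>, multiplied by the norm of the gradient of \<open>\<rho>\<close>.\<close>

locale boundary_data = defining_function +
  fixes \<alpha> :: "(real^2) \<times> real \<Rightarrow> real" and a :: "real^2 \<Rightarrow> real" and k A :: real
  assumes smooth_a: "smooth_in N a"
    and angle: "x \<in> frontier \<Omega> \<Longrightarrow> x \<in> N \<Longrightarrow> \<alpha> (x, z) = a x"
    and a_bound: "x \<in> N \<Longrightarrow> \<bar>a x\<bar> \<le> A" and a_gradient_bound: "x \<in> N \<Longrightarrow> norm (gradient a x) \<le> A"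
    and k_pos: "k > 0"
    and curvature_bound: "x \<in> frontier \<Omega> \<Longrightarrow> x \<in> N \<Longrightarrow> norm \<tau> = 1 \<Longrightarrow> gradient \<rho> x \<bullet> \<tau> = 0 \<Longrightarrow>
      k * norm (gradient \<rho> x) \<le> ddir \<tau> (ddir \<tau> \<rho>) x"

lemma boundary_data_mono:
  assumes "boundary_data \<Omega> N \<rho> \<alpha> a k A" "0 < k'" "k' \<le> k" "A \<le> A'"
  shows "boundary_data \<Omega> N \<rho> \<alpha> a k' A'"
proof -
  interpret boundary_data \<Omega> N \<rho> \<alpha> a k A by fact
  show ?thesis
  proof
    show "\<bar>a x\<bar> \<le> A'" "norm (gradient a x) \<le> A'" if "x \<in> N" for x
      using a_bound[OF that] a_gradient_bound[OF that] assms(4) by auto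
    show "k' * norm (gradient \<rho> x) \<le> ddir \<tau> (ddir \<tau> \<rho>) x"
      if "x \<in> frontier \<Omega>" "x \<in> N" "norm \<tau> = 1" "gradient \<rho> x \<bullet> \<tau> = 0" for x \<tau>
      using curvature_bound[OF that] mult_right_mono[OF assms(3), of "norm (gradient \<rho> x)"] by simp
  qed (use smooth_a angle assms in auto)
qed

text \<open>The graphical hypothesis enters here: the right-hand side of the angle condition does
  not see the height, hence its time derivative is a homogeneous condition on the gradient of
  u_t.\<close>

lemma graphical_angle_constant:
  assumes "graphical_angle \<Omega> \<alpha>" "x \<in> frontier \<Omega>"
  shows "\<alpha> (x, z) = \<alpha> (x, 0)"
proof -
  have "((\<lambda>s. \<alpha> (x, s)) has_real_derivative 0) (at s)" for s
  proof -
    have "(x, s) \<in> cylinder \<Omega>" using assms(2) by (simp add: cylinder_def)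
    then have "((\<lambda>r. \<alpha> ((x, s) + r *\<^sub>R e_time)) has_real_derivative 0) (at 0)"
      using assms(1) unfolding graphical_angle_def by blast
    then have "((\<lambda>r. \<alpha> (x, s + r)) has_real_derivative 0) (at 0)" by (simp add: e_time_def)
    then show ?thesis using DERIV_shift[of "\<lambda>s. \<alpha> (x, s)" 0 0 s] by (simp add: add.commute)
  qed
  then show ?thesis using DERIV_isconst_all[of "\<lambda>s. \<alpha> (x, s)" z 0] by blast
qed

lemma continuous_on_gradient: "smooth_in N f \<Longrightarrow> continuous_on N (gradient f)"
  unfolding gradient_def[abs_def]
  by (intro continuous_on_vec_lambda smooth_in_continuous smooth_in_ddir)

text \<open>The curvature is defined only on the boundary. Its numerator, the second derivative of
  \<open>\<rho>\<close> along the rotated gradient, makes sense on a whole neighbourhood and is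
  continuous there, so a strict lower bound at \<open>x0\<close> persists nearby.\<close>

lemma local_boundary_data:
  assumes \<Omega>: "smooth_convex_domain \<Omega>" and curv: "\<forall>x\<in>frontier \<Omega>. 0 < boundary_curvature \<Omega> x"
    and \<alpha>: "smooth_on (cylinder \<Omega>) \<alpha>" "graphical_angle \<Omega> \<alpha>" and x0: "x0 \<in> frontier \<Omega>"
  obtains N \<rho> a k A where "x0 \<in> N" "boundary_data \<Omega> N \<rho> \<alpha> a k A"
proof -
  have cl: "closed \<Omega>" using \<Omega> by (simp add: smooth_convex_domain_def compact_imp_closed)
  have "\<exists>U \<rho>. local_defining_function \<Omega> x0 U \<rho>"
    using \<Omega> x0 unfolding smooth_convex_domain_def smooth_boundary_def by blast
  then obtain U \<rho> where "local_defining_function \<Omega> x0 U \<rho>" by blast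
  note U = local_defining_functionD[OF cl this]
  interpret U: defining_function \<Omega> U \<rho> by (rule U(1))
  have "(x0, 0) \<in> cylinder \<Omega>" using x0 by (simp add: cylinder_def)
  from smooth_onE[OF \<alpha>(1) this] obtain U2 g where U2: "open U2" "(x0, 0) \<in> U2" "smooth_in U2 g"
    "\<forall>y\<in>cylinder \<Omega> \<inter> U2. g y = \<alpha> y" by auto
  define N1 where "N1 = U \<inter> (\<lambda>x. (x, 0)) -` U2"
  have oN1: "open N1" unfolding N1_def
    by (intro open_Int U.open_N open_vimage[OF U2(1)] continuous_intros)
  have x01: "x0 \<in> N1" using U(2) U2(2) by (simp add: N1_def)
  define a where "a x = g (x, 0)" for x
  have sa: "smooth_in N1 a" unfolding a_def[abs_def]
    by (rule smooth_in_compose[OF oN1 U2(1) _ _ U2(3)])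
      (auto simp: N1_def intro!: smooth_in_bounded_linear oN1[unfolded N1_def] bounded_linear_Pair bounded_linear_ident bounded_linear_zero)
  have sr: "smooth_in N1 \<rho>" by (rule smooth_in_subset[OF U.smooth_rho]) (simp add: N1_def)
  have NU: "N1 \<subseteq> U" by (simp add: N1_def)
  define n where "n x = gradient \<rho> x" for x
  \<comment> \<open>The second derivative of \<open>\<rho>\<close> in the direction
    \<open>perp (n x)\<close>, in coordinates; the curvature is this divided by |n|^3.\<close>
  define Q where "Q x = ddir (axis 1 1) (ddir (axis 1 1) \<rho>) x * (n x $ 2) ^ 2
    - 2 * ddir (axis 1 1) (ddir (axis 2 1) \<rho>) x * (n x $ 1 * n x $ 2)
    + ddir (axis 2 1) (ddir (axis 2 1) \<rho>) x * (n x $ 1) ^ 2" for x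
  have Q: "ddir (perp (n x)) (ddir (perp (n x)) \<rho>) x = Q x" if x: "x \<in> N1" for x
  proof -
    have e: "ddir w (ddir b \<rho>) x = w $ 1 * ddir (axis 1 1) (ddir b \<rho>) x + w $ 2 * ddir (axis 2 1) (ddir b \<rho>) x" for w b
      using inner_gradient[OF smooth_in_ddir[OF sr] x, of b w] by (simp add: inner_2 gradient_def mult.commute)
    have c: "ddir w (ddir b \<rho>) x = ddir b (ddir w \<rho>) x" for w b by (rule ddir_commute[OF oN1 sr x])
    define w where "w = perp (n x)"
    have "ddir w (ddir w \<rho>) x = w $ 1 * ddir w (ddir (axis 1 1) \<rho>) x + w $ 2 * ddir w (ddir (axis 2 1) \<rho>) x"
      unfolding e[of w w] c[of "axis 1 1" w] c[of "axis 2 1" w] ..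
    then have "ddir w (ddir w \<rho>) x = w $ 1 * w $ 1 * ddir (axis 1 1) (ddir (axis 1 1) \<rho>) x
       + 2 * (w $ 1 * w $ 2) * ddir (axis 1 1) (ddir (axis 2 1) \<rho>) x + w $ 2 * w $ 2 * ddir (axis 2 1) (ddir (axis 2 1) \<rho>) x"
      unfolding e[of w "axis 1 1"] e[of w "axis 2 1"] c[of "axis 2 1" "axis 1 1"] by (simp add: algebra_simps)
    then show ?thesis by (simp add: w_def Q_def power2_eq_square algebra_simps)
  qed
  have nz: "n x \<noteq> 0" if "x \<in> N1" for x using U.gradient_nz that NU by (auto simp: n_def)
  have tan: "ddir \<tau> (ddir \<tau> \<rho>) x = Q x / norm (n x) ^ 2" if x: "x \<in> N1" and \<tau>: "norm \<tau> = 1" "n x \<bullet> \<tau> = 0" for x \<tau>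
  proof -
    obtain c where c: "\<tau> = c *\<^sub>R perp (n x)" by (rule orthogonal_imp_perp[OF nz[OF x] \<tau>(2)])
    have "\<bar>c\<bar> * norm (n x) = 1" using \<tau>(1) unfolding c by simp
    then have "(\<bar>c\<bar> * norm (n x)) ^ 2 = 1" by simp
    then have "c ^ 2 * norm (n x) ^ 2 = 1" by (simp add: power_mult_distrib)
    then have c2: "c * c * norm (n x) ^ 2 = 1" by (simp add: power2_eq_square[of c])
    have xU: "x \<in> U" using x NU by auto
    have "ddir \<tau> (ddir \<tau> \<rho>) x = c * c * Q x"
      unfolding c U.ddir2_scaleR[OF xU] Q[OF x] ..
    also have "\<dots> = (c * c * norm (n x) ^ 2) * Q x / norm (n x) ^ 2" using nz[OF x] by simp
    finally show ?thesis by (simp add: c2)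
  qed
  define \<tau> where "\<tau> = perp (n x0) /\<^sub>R norm (n x0)"
  have \<tau>: "norm \<tau> = 1" "n x0 \<bullet> \<tau> = 0" using nz[OF x01] by (auto simp: \<tau>_def)
  have x0U: "x0 \<in> U" using U(2) .
  have "0 < ddir \<tau> (ddir \<tau> \<rho>) x0 / norm (n x0)"
    using bspec[OF curv x0] U.boundary_curvature_eq[OF x0U x0 \<tau>(1) \<tau>(2)[unfolded n_def]] by (simp add: n_def)
  moreover have "Q x0 / norm (n x0) ^ 2 / norm (n x0) \<le> 0" if "Q x0 \<le> 0"
    by (intro divide_nonpos_nonneg that) auto
  ultimately have Q0: "Q x0 > 0" unfolding tan[OF x01 \<tau>] by linarith
  \<comment> \<open>Half the curvature at \<open>x0\<close>, which leaves the room needed for an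
    open condition.\<close>
  define k where "k = Q x0 / (2 * norm (n x0) ^ 3)"
  have k: "k > 0" "k * norm (n x0) ^ 3 < Q x0" using Q0 nz[OF x01] by (auto simp: k_def)
  define A where "A = max \<bar>a x0\<bar> (norm (gradient a x0)) + 1"
  have cn: "continuous_on N1 n" unfolding n_def[abs_def] by (rule continuous_on_gradient[OF sr])
  have cQ: "continuous_on N1 Q" unfolding Q_def[abs_def]
    by (intro continuous_intros cn smooth_in_continuous smooth_in_ddir sr)
  define N where "N = (N1 \<inter> (\<lambda>x. Q x - k * norm (n x) ^ 3) -` {0<..}) \<inter>
    (N1 \<inter> (\<lambda>x. A - \<bar>a x\<bar>) -` {0<..}) \<inter> (N1 \<inter> (\<lambda>x. A - norm (gradient a x)) -` {0<..})"
  have oN: "open N" unfolding N_def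
    by (intro open_Int continuous_open_preimage oN1 open_greaterThan continuous_on_diff continuous_on_mult
        continuous_on_power continuous_on_norm continuous_on_rabs continuous_on_const cn cQ
        smooth_in_continuous[OF sa] continuous_on_gradient[OF sa])
  have NN: "N \<subseteq> N1" by (auto simp: N_def)
  have "x0 \<in> N" using x01 k(2) by (auto simp: N_def A_def)
  moreover have "boundary_data \<Omega> N \<rho> \<alpha> a k A"
  proof
    show "closed \<Omega>" "open N" "k > 0" by fact+
    show "smooth_in N \<rho>" "smooth_in N a" using smooth_in_subset sr sa NN by blast+
    show "gradient \<rho> x \<noteq> 0" if "x \<in> N" for x using nz[of x] that NN by (auto simp: n_def)
    show "\<Omega> \<inter> N = {x \<in> N. \<rho> x \<le> 0}" using U.in_domain_iff NN NU by blast
    show "\<bar>a x\<bar> \<le> A" "norm (gradient a x) \<le> A" if "x \<in> N" for x using that by (auto simp: N_def)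
    show "\<alpha> (x, z) = a x" if x: "x \<in> frontier \<Omega>" "x \<in> N" for x z
    proof -
      have "(x, 0) \<in> cylinder \<Omega> \<inter> U2" using x NN by (auto simp: cylinder_def N1_def)
      then have "g (x, 0) = \<alpha> (x, 0)" using U2(4) by blast
      then show ?thesis using graphical_angle_constant[OF \<alpha>(2) x(1), of z] by (simp add: a_def)
    qed
    show "k * norm (gradient \<rho> x) \<le> ddir \<tau> (ddir \<tau> \<rho>) x"
      if x: "x \<in> frontier \<Omega>" "x \<in> N" and \<tau>: "norm \<tau> = 1" "gradient \<rho> x \<bullet> \<tau> = 0" for x \<tau>
    proof -
      have x1: "x \<in> N1" using x NN by auto
      have "k * norm (n x) ^ 3 \<le> Q x" using x by (auto simp: N_def)
      then have "k * norm (n x) * norm (n x) ^ 2 \<le> Q x" by (simp add: power3_eq_cube power2_eq_square mult.assoc)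
      then have "k * norm (n x) \<le> Q x / norm (n x) ^ 2" using nz[OF x1] by (simp add: pos_le_divide_eq)
      then show ?thesis using tan[OF x1 \<tau>(1)] \<tau>(2) by (simp add: n_def)
    qed
  qed
  ultimately show thesis by (rule that)
qed

text \<open>By compactness finitely many neighbourhoods cover the boundary; the smallest
  \<open>k\<close> and the largest \<open>A\<close> among them serve everywhere.\<close>

lemma uniform_boundary_data:
  assumes "smooth_convex_domain \<Omega>" and "\<forall>x\<in>frontier \<Omega>. 0 < boundary_curvature \<Omega> x"
    and "smooth_on (cylinder \<Omega>) \<alpha>" "graphical_angle \<Omega> \<alpha>"
  obtains k A where "k > 0" "A \<ge> 0" "\<And>x. x \<in> frontier \<Omega> \<Longrightarrow> \<exists>N \<rho> a. x \<in> N \<and> boundary_data \<Omega> N \<rho> \<alpha> a k A"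
proof -
  have comp: "compact (frontier \<Omega>)" using assms(1) by (simp add: smooth_convex_domain_def compact_frontier)
  define \<C> where "\<C> = {N. \<exists>\<rho> a k A. boundary_data \<Omega> N \<rho> \<alpha> a k A}"
  have "open N" if "N \<in> \<C>" for N
    using that by (auto simp: \<C>_def boundary_data_def defining_function_def)
  moreover have "frontier \<Omega> \<subseteq> \<Union>\<C>"
  proof
    fix x assume "x \<in> frontier \<Omega>"
    then obtain N \<rho> a k A where "x \<in> N" "boundary_data \<Omega> N \<rho> \<alpha> a k A" by (rule local_boundary_data[OF assms])
    then show "x \<in> \<Union>\<C>" unfolding \<C>_def by blast
  qed
  ultimately obtain \<D> where \<D>: "\<D> \<subseteq> \<C>" "finite \<D>" "frontier \<Omega> \<subseteq> \<Union>\<D>"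
    using comp by (metis compactE)
  have "\<forall>N\<in>\<D>. \<exists>q. \<exists>\<rho> a. boundary_data \<Omega> N \<rho> \<alpha> a (fst q) (snd q)" using \<D>(1) by (fastforce simp: \<C>_def)
  then obtain q where q: "\<forall>N\<in>\<D>. \<exists>\<rho> a. boundary_data \<Omega> N \<rho> \<alpha> a (fst (q N)) (snd (q N))" by metis
  \<comment> \<open>The inserted 1, and 0 below, keep both sets nonempty and make \<open>A\<close>
    nonnegative.\<close>
  define k where "k = Min (insert 1 ((\<lambda>N. fst (q N)) ` \<D>))"
  define A where "A = Max (insert 0 ((\<lambda>N. snd (q N)) ` \<D>))"
  have "fst (q N) > 0" if "N \<in> \<D>" for N using q that by (auto simp: boundary_data_def boundary_data_axioms_def)
  then have k: "k > 0" using \<D>(2) by (auto simp: k_def)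
  have A: "A \<ge> 0" using \<D>(2) by (auto simp: A_def)
  have "\<exists>N \<rho> a. x \<in> N \<and> boundary_data \<Omega> N \<rho> \<alpha> a k A" if x: "x \<in> frontier \<Omega>" for x
  proof -
    obtain N where N: "N \<in> \<D>" "x \<in> N" using \<D>(3) x by blast
    then obtain \<rho> a where b: "boundary_data \<Omega> N \<rho> \<alpha> a (fst (q N)) (snd (q N))" using q by blast
    have "k \<le> fst (q N)" "snd (q N) \<le> A" using \<D>(2) N(1) by (auto simp: k_def A_def)
    from boundary_data_mono[OF b k this] N(2) show ?thesis by blast
  qed
  with k A show thesis by (rule that)
qed

section \<open>Boundary estimates\<close>

lemma continuous_on_local_extension:
  assumes "\<And>x. x \<in> S \<Longrightarrow> \<exists>U g. open U \<and> x \<in> U \<and> isCont g x \<and> (\<forall>y\<in>S \<inter> U. g y = f y)"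
  shows "continuous_on S f"
proof (unfold continuous_on_eq_continuous_within, rule ballI)
  fix x assume x: "x \<in> S"
  from assms[OF x] obtain U g where U: "open U" "x \<in> U" "isCont g x" "\<forall>y\<in>S \<inter> U. g y = f y" by blast
  have "(g \<longlongrightarrow> g x) (at x within S)"
    using U(3) by (auto simp: continuous_at intro: tendsto_within_subset)
  moreover have "eventually (\<lambda>y. g y = f y) (at x within S)"
    using eventually_at_topological[of "\<lambda>y. g y = f y" x S] U by blast
  ultimately have "(f \<longlongrightarrow> g x) (at x within S)" by (rule Lim_transform_eventually)
  moreover have "g x = f x" using U x by auto
  ultimately show "continuous (at x within S) f" by (simp add: continuous_within)
qed

lemma smooth_on_continuous:
  assumes "smooth_on S f"
  shows "continuous_on S f"
proof (rule continuous_on_local_extension)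
  fix x assume x: "x \<in> S"
  obtain U g where U: "open U" "x \<in> U" "smooth_in U g" "\<forall>y\<in>S \<inter> U. g y = f y"
    using smooth_onE[OF assms x] .
  show "\<exists>U g. open U \<and> x \<in> U \<and> isCont g x \<and> (\<forall>y\<in>S \<inter> U. g y = f y)"
    by (intro exI[of _ U] exI[of _ g] conjI U(1,2,4) smooth_in_isCont[OF U(3,2)])
qed

text \<open>A point outside the convex domain is separated from it by a linear function
  \<open>a\<close>. Its minimum over the disk cannot be interior, since the projection is a local
  diffeomorphism and \<open>a\<close> would have to vanish; on the circle the surface lies on the
  cylinder.\<close>

lemma (in flow) image_in_domain:
  assumes "smooth_convex_domain \<Omega>" "p \<in> disk" "t \<in> I"
  shows "fst (F p t) \<in> \<Omega>"
proof (rule ccontr)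
  assume notin: "fst (F p t) \<notin> \<Omega>"
  have \<Omega>: "convex \<Omega>" "closed \<Omega>" "\<Omega> \<noteq> {}" using assms(1) interior_subset[of \<Omega>] by (auto simp: smooth_convex_domain_def compact_imp_closed)
  from separating_hyperplane_closed_point[OF \<Omega>(1,2) notin]
  obtain a b where ab: "a \<bullet> fst (F p t) < b" "\<forall>x\<in>\<Omega>. b < a \<bullet> x" by auto
  have "smooth_on disk (\<lambda>p. F p t)" using spacelike[OF assms(3)] by (simp add: spacelike_embedding_def)
  from smooth_on_continuous[OF this] have "continuous_on disk (\<lambda>p. a \<bullet> fst (F p t))" by (intro continuous_intros)
  from continuous_attains_inf[OF compact_cball _ this] assms(2)
  obtain p' where p': "p' \<in> disk" "\<forall>r\<in>disk. a \<bullet> fst (F p' t) \<le> a \<bullet> fst (F r t)" by auto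
  have lt: "a \<bullet> fst (F p' t) < b" using p'(2) assms(2) ab(1) by fastforce
  show False
  proof (cases "norm p' = 1")
    case True
    then have "fst (F p' t) \<in> frontier \<Omega>"
      using mcf assms(3) by (auto simp: mcf_neumann_def boundary_angle_condition_def cylinder_def mem_Times_iff)
    then have "fst (F p' t) \<in> \<Omega>" using \<Omega>(2) by (simp add: frontier_def)
    then show False using ab(2) lt by fastforce
  next
    case False
    then have int: "p' \<in> ball 0 1" using p'(1) by simp
    obtain V W X u where y: "(p', t) \<in> V" and gc: "graph_chart \<Omega> \<alpha> F\<^sub>0 T F V W X u"
      by (rule chart_exists[OF p'(1) assms(3)])
    interpret graph_chart \<Omega> \<alpha> F\<^sub>0 T F V W X u by (rule gc)
    obtain e where e: "e > 0" "\<And>p. dist p p' < e \<Longrightarrow> (p, t) \<in> V" by (rule space_nbhd[OF y]) blast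
    have "((\<lambda>p. (p, t)) has_derivative (\<lambda>d. (d, 0))) (at p')"
      by (intro has_derivative_Pair has_derivative_ident has_derivative_const)
    from has_derivative_compose[OF this smooth_inD[OF smooth_X y]]
    have D: "((\<lambda>p. a \<bullet> X (p, t)) has_derivative (\<lambda>d. a \<bullet> ddir (d, 0) X (p', t))) (at p')"
      by (rule has_derivative_inner_right)
    have eq: "fst (F r t) = X (r, t)" if "r \<in> ball p' e \<inter> ball 0 1" for r
      using F_graph[OF e(2)[of r], of] that assms(3) by (simp add: dist_commute)
    have mem: "p' \<in> ball p' e \<inter> ball 0 1" "open (ball p' e \<inter> ball 0 1)" using int e(1) by auto
    have "\<forall>r\<in>ball p' e \<inter> ball 0 1. a \<bullet> X (p', t) \<le> a \<bullet> X (r, t)"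
    proof
      fix r assume r: "r \<in> ball p' e \<inter> ball 0 1"
      then have "r \<in> disk" by auto
      then show "a \<bullet> X (p', t) \<le> a \<bullet> X (r, t)" using p'(2) eq[OF r] eq[OF mem(1)] by fastforce
    qed
    from differential_zero_maxmin[OF mem D disjI2[OF this]]
    have z: "(\<lambda>d. a \<bullet> ddir (d, 0) X (p', t)) = (\<lambda>d. 0)" .
    have "a = 0"
    proof (rule inner_zero_imp_vec)
      fix x
      obtain d where "x = ddir (d, 0) X (p', t)" using surjD[OF surj_immersion[OF y], of x] by blast
      then show "a \<bullet> x = 0" using fun_cong[OF z, of d] by simp
    qed
    then show False using ab \<Omega>(3) by fastforce
  qed
qed

lemma sphere_critical:
  fixes h :: "real^2 \<Rightarrow> real"
  assumes "norm p = 1" "(h has_derivative h') (at p)" "e > 0"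
    and max: "\<And>r. norm r = 1 \<Longrightarrow> dist r p < e \<Longrightarrow> h r \<le> h p"
  shows "h' (perp p) = 0"
proof -
  define c where "c s = cos s *\<^sub>R p + sin s *\<^sub>R perp p" for s :: real
  have c1: "norm (c s) = 1" for s
  proof -
    have "c s \<bullet> c s = cos s * cos s * (p \<bullet> p) + sin s * sin s * (p \<bullet> p)"
      by (simp add: c_def inner_add_left inner_add_right)
    also have "\<dots> = (cos s ^ 2 + sin s ^ 2) * (p \<bullet> p)" by (simp only: power2_eq_square distrib_right)
    finally show ?thesis using assms(1) by (simp add: norm_eq_sqrt_inner)
  qed
  have c0: "c 0 = p" by (simp add: c_def)
  have dc: "(c has_derivative (\<lambda>s. s *\<^sub>R perp p)) (at 0)"
    unfolding c_def[abs_def] by (auto intro!: derivative_eq_intros)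
  have "((\<lambda>s. h (c s)) has_derivative (\<lambda>s. h' (s *\<^sub>R perp p))) (at 0)"
    by (rule has_derivative_compose[OF dc]) (simp add: c0 assms(2))
  moreover have "h' (s *\<^sub>R perp p) = h' (perp p) * s" for s
    using linear_scale[OF has_derivative_linear[OF assms(2)], of s "perp p"] by simp
  ultimately have D: "((\<lambda>s. h (c s)) has_real_derivative h' (perp p)) (at 0)" by (simp add: has_field_derivative_def)
  have "(c \<longlongrightarrow> p) (at 0)" using has_derivative_continuous[OF dc] c0 by (simp add: continuous_at)
  then have "eventually (\<lambda>s. dist (c s) p < e) (at 0)" using assms(3) by (rule tendstoD)
  then obtain d where d: "d > 0" "\<And>s. s \<noteq> 0 \<Longrightarrow> dist s 0 < d \<Longrightarrow> dist (c s) p < e" by (auto simp: eventually_at)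
  have "\<forall>s. \<bar>0 - s\<bar> < d \<longrightarrow> h (c s) \<le> h (c 0)"
  proof (intro allI impI)
    fix s assume "\<bar>0 - s\<bar> < d"
    then show "h (c s) \<le> h (c 0)" using d(2)[of s] max[OF c1, of s] c0 by (cases "s = 0") auto
  qed
  from DERIV_local_max[OF D d(1) this] show ?thesis .
qed

text \<open>The algebra behind the boundary estimate. In an orthonormal frame \<open>N, \<tau>\<close> (outward normal and
  tangent), \<open>n\<close> and \<open>s\<close> are the components of \<open>Du\<close> and \<open>m\<close>, \<open>b\<close>, \<open>c\<close> those of \<open>D\<^sup>2u\<close>. As \<open>v\<close> grows, \<open>s b\<close>
  approaches \<open>-\<kappa>\<close>, which makes the normal derivative \<open>n m + s b\<close> of \<open>|Du|\<^sup>2 / 2\<close> negative.\<close>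

lemma boundary_algebra:
  fixes v n s m b c \<kappa> a a' \<phi> A k C :: real
  assumes v: "v > 0" and vn: "v * n = a" and vv: "v ^ 2 * (1 - n ^ 2 - s ^ 2) = 1"
    and tangential: "n * b + s * c = 0" and normal: "n * m + s * b \<ge> 0"
    and angle: "v * (b + s * \<kappa>) = a'"
    and \<phi>: "\<phi> = m + c + v ^ 2 * (n ^ 2 * m + 2 * n * s * b + s ^ 2 * c)"
    and A: "\<bar>a\<bar> \<le> A" "\<bar>a'\<bar> \<le> A" and k: "0 < k" "k \<le> \<kappa>" and C: "\<bar>\<phi>\<bar> \<le> C"
  shows "v \<le> 2 * (1 + A ^ 2) + 4 * A / k + 4 * A * C / k"
proof (rule ccontr)
  assume "\<not> ?thesis"
  then have big: "v > 2 * (1 + A ^ 2) + 4 * A / k + 4 * A * C / k" by simp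
  have nn: "0 \<le> A" "0 \<le> C" using A C by auto
  \<comment> \<open>All three summands of the bound are nonnegative, so \<open>v\<close> exceeds
    each of them. In turn they give s^2 \<ge> 1/2, then s b < - k/4, and the final
    contradiction.\<close>
  define P R where "P = 4 * A / k" and "R = 4 * A * C / k"
  have PR: "0 \<le> P" "0 \<le> R" "v > 2 * (1 + A ^ 2) + P + R" using big nn k by (auto simp: P_def R_def)
  have "v > 2 * (1 + A ^ 2)" using PR by argo
  moreover have "v > P" using PR zero_le_power2[of A] by (smt (verit))
  moreover have "v > R" using PR zero_le_power2[of A] by (smt (verit))
  ultimately have v1: "v > 2 * (1 + A ^ 2)" "v > 4 * A / k" "v > 4 * A * C / k" by (auto simp: P_def R_def)
  define t where "t = s * b"
  have vs: "v ^ 2 * s ^ 2 = v ^ 2 - 1 - a ^ 2"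
    using vv unfolding vn[symmetric] by (simp add: algebra_simps power_mult_distrib)
  have aA: "a ^ 2 \<le> A ^ 2" using A(1) by (metis abs_ge_zero power2_abs power_mono)
  have "v ^ 2 \<ge> v * (2 * (1 + A ^ 2))" using v1(1) v by (simp add: power2_eq_square)
  moreover have "v * (2 * (1 + A ^ 2)) \<ge> 1 * (2 * (1 + A ^ 2))"
  proof (rule mult_right_mono)
    show "1 \<le> v" using v1(1) zero_le_power2[of A] by (smt (verit))
  qed simp
  ultimately have "v ^ 2 \<ge> 2 * (1 + A ^ 2)" by simp
  moreover have "x * (1 / 2) \<le> y" if "2 * (1 + B) \<le> x" "y = x - 1 - z" "z \<le> B" for x y z B :: real
    using that by simp
  ultimately have "v ^ 2 * s ^ 2 \<ge> v ^ 2 * (1 / 2)" using vs aA by blast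
  then have s2: "s ^ 2 \<ge> 1 / 2" using v by simp
  have "s ^ 2 \<le> 1"
  proof -
    have "1 - n ^ 2 - s ^ 2 > 0" using vv v by (metis mult_pos_pos not_one_less_zero zero_less_mult_pos zero_less_one zero_less_power)
    then show ?thesis using zero_le_power2[of n] by (smt (verit))
  qed
  then have s1: "\<bar>s\<bar> \<le> 1" by (simp add: abs_square_le_1)
  define y w where "y = v * (s ^ 2 * \<kappa>)" and "w = v * k"
  \<comment> \<open>The tangential angle equation multiplied by \<open>s\<close>: the curvature term
    is of size v k / 2 at least, while the angle contributes at most \<open>A\<close>.\<close>
  have "v * t = s * a' - y"
    unfolding y_def using arg_cong[OF angle, of "\<lambda>x. s * x"] by (simp add: t_def power2_eq_square algebra_simps)
  moreover have "s * a' \<le> A"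
  proof -
    have "s * a' \<le> \<bar>s\<bar> * \<bar>a'\<bar>" by (metis abs_ge_self abs_mult)
    also have "\<dots> \<le> 1 * A" using s1 A(2) by (intro mult_mono) auto
    finally show ?thesis by simp
  qed
  moreover have "w / 2 \<le> y"
  proof -
    have "v * (1 / 2 * k) \<le> v * (s ^ 2 * \<kappa>)" using s2 k v by (intro mult_left_mono mult_mono) auto
    then show ?thesis by (simp add: w_def y_def)
  qed
  moreover have "A < w / 4" unfolding w_def using v1(2) k by (simp add: field_simps)
  ultimately have "v * t < - (w / 4)" by linarith
  also have "- (w / 4) = v * (- (k / 4))" by (simp add: w_def)
  finally have t: "t < - (k / 4)" using v by (simp only: mult_less_cancel_left_pos)
  \<comment> \<open>Multiplying \<open>tangential\<close> by \<open>s * n\<close> trades the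
    uncontrolled \<open>c\<close> for \<open>t\<close>.\<close>
  have sc: "s ^ 2 * c * n = - (n ^ 2 * t)"
  proof -
    have "s * n * (n * b + s * c) = 0" by (simp add: tangential)
    then show ?thesis by (simp add: t_def power2_eq_square algebra_simps)
  qed
  have a2: "v ^ 2 * n ^ 2 = a ^ 2" unfolding vn[symmetric] by (simp add: power_mult_distrib)
  have K: "v ^ 2 * (s ^ 2 * c * n) = - (a ^ 2 * t)" unfolding sc a2[symmetric] by simp
  \<comment> \<open>The factor \<open>s ^ 2 * n\<close> is chosen so that \<open>c\<close> occurs
    only in the combination eliminated above. Together with \<open>v * n = a\<close> this turns the
    equation for \<phi> into a relation between the normal derivative n m + t, n \<phi> and
    t.\<close>
  have "v ^ 2 * s ^ 2 * (n * \<phi>) = v ^ 2 * s ^ 2 * (n * m) + v ^ 2 * (s ^ 2 * c * n) + v ^ 2 * s ^ 2 * ((v ^ 2 * n ^ 2) * (n * m))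
     + 2 * (v ^ 2 * s ^ 2) * ((v ^ 2 * n ^ 2) * t) + v ^ 2 * s ^ 2 * (v ^ 2 * (s ^ 2 * c * n))"
    unfolding \<phi> t_def by (simp add: algebra_simps power2_eq_square)
  also have "\<dots> = v ^ 2 * s ^ 2 * ((1 + a ^ 2) * (n * m + t)) - v ^ 2 * s ^ 2 * t - a ^ 2 * t"
    unfolding K a2 by (simp add: algebra_simps)
  finally have id: "v ^ 2 * s ^ 2 * ((1 + a ^ 2) * (n * m + t)) = v ^ 2 * s ^ 2 * (n * \<phi> + t) + a ^ 2 * t"
    by (simp add: algebra_simps)
  have "0 \<le> v ^ 2 * s ^ 2 * ((1 + a ^ 2) * (n * m + t))" using normal by (simp add: t_def)
  moreover have "a ^ 2 * t \<le> 0" using t k by (intro mult_nonneg_nonpos) auto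
  ultimately have "0 \<le> v ^ 2 * s ^ 2 * (n * \<phi> + t)" using id by (smt (verit))
  moreover have "v ^ 2 * s ^ 2 > 0" using v s2 by (intro mult_pos_pos) auto
  ultimately have "0 \<le> n * \<phi> + t" by (simp add: zero_le_mult_iff)
  then have "v * (n * \<phi> + t) \<ge> 0" using v by simp
  then have "a * \<phi> \<ge> - (v * t)" unfolding vn[symmetric] by (simp add: algebra_simps)
  moreover have "a * \<phi> \<le> A * C"
  proof -
    have "a * \<phi> \<le> \<bar>a\<bar> * \<bar>\<phi>\<bar>" by (metis abs_ge_self abs_mult)
    also have "\<dots> \<le> A * C" using A(1) C by (intro mult_mono) auto
    finally show ?thesis .
  qed
  moreover have "v * t < v * (- (k / 4))" using t v by (simp only: mult_less_cancel_left_pos)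
  moreover have "A * C < v * (k / 4)" using v1(3) k by (simp add: field_simps)
  ultimately show False by simp
qed

section \<open>The angle condition at a boundary point\<close>

lemma orthonormal_decomposition:
  assumes "norm N = 1"
  shows "q = (q \<bullet> N) *\<^sub>R N + (q \<bullet> perp N) *\<^sub>R perp N"
proof -
  have "N $ 1 * N $ 1 + N $ 2 * N $ 2 = 1" using assms by (simp add: norm_eq_sqrt_inner inner_2)
  then have e: "x = x * (N $ 1 * N $ 1 + N $ 2 * N $ 2)" for x by simp
  have "q $ 1 = (q \<bullet> N) * N $ 1 + (q \<bullet> perp N) * perp N $ 1" "q $ 2 = (q \<bullet> N) * N $ 2 + (q \<bullet> perp N) * perp N $ 2"
    by (subst e, simp add: inner_2 algebra_simps)+
  then show ?thesis by (simp add: vec_eq_iff forall_2)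
qed

locale boundary_chart = graph_chart + boundary_data \<Omega> N \<rho> \<alpha> a k A for N \<rho> a k A +
  fixes p t
  assumes base: "(p, t) \<in> V" "norm p = 1" "t \<in> I" "X (p, t) \<in> N"
    and domain: "smooth_convex_domain \<Omega>"
begin

lemma p_disk: "p \<in> disk"
  using base(2) by simp

abbreviation "z \<equiv> G (p, t)"
abbreviation "x \<equiv> X (p, t)"
abbreviation "q \<equiv> slope p t"

lemma fst_z: "fst z = x"
  by (simp add: G_def)

lemma z_W: "z \<in> W"
  by (rule G_in[OF base(1)])

text \<open>The angle condition times the norm of the gradient of \<open>\<rho>\<close>, with the
  angle replaced by its extension \<open>a\<close>. In this form it is differentiable near
  \<open>z\<close>, although it is known to vanish only at points coming from the boundary
  circle.\<close>

definition angle_defect :: "(real^2) \<times> real \<Rightarrow> real" where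
  "angle_defect y = lorentz (grad u y) * (grad u y \<bullet> gradient \<rho> (fst y)) - a (fst y) * norm (gradient \<rho> (fst y))"

lemma on_boundary:
  assumes "(r, s) \<in> V" "norm r = 1" "s \<in> I" "X (r, s) \<in> N"
  shows "X (r, s) \<in> frontier \<Omega>" "\<rho> (X (r, s)) = 0" "angle_defect (G (r, s)) = 0"
proof -
  have r: "r \<in> disk" "r \<in> sphere 0 1" using assms(2) by auto
  have F: "F r s = (X (r, s), u (X (r, s), s))" by (rule F_graph[OF assms(1) r(1) assms(3)])
  have bc: "F r s \<in> cylinder \<Omega>" "mink (unit_normal (\<lambda>p. F p s) r) (cylinder_normal \<Omega> (F r s)) = \<alpha> (F r s)"
    using mcf assms(3) r(2) by (auto simp: mcf_neumann_def boundary_angle_condition_def)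
  show fr: "X (r, s) \<in> frontier \<Omega>" using bc(1) by (simp add: F cylinder_def)
  then show "\<rho> (X (r, s)) = 0" using rho_frontier_iff[OF assms(4)] by simp
  define n where "n = gradient \<rho> (X (r, s))"
  have n: "norm n > 0" using gradient_nz[OF assms(4)] by (simp add: n_def)
  have "lorentz (slope r s) * (slope r s \<bullet> n) / norm n = a (X (r, s))"
    using bc(2) angle[OF fr assms(4)]
    by (simp add: F unit_normal_eq[OF assms(1) r(1) assms(3)] cylinder_normal_def outward_normal_eq[OF assms(4) fr] mink_def n_def divide_inverse)
      (simp add: ac_simps)
  then have "lorentz (slope r s) * (slope r s \<bullet> n) = a (X (r, s)) * norm n" using n by (simp add: field_simps)
  then show "angle_defect (G (r, s)) = 0" by (simp add: angle_defect_def slope_def G_def n_def)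
qed

lemma sphere_nbhd:
  obtains e where "e > 0" "\<And>r. dist r p < e \<Longrightarrow> (r, t) \<in> V" "\<And>r. dist r p < e \<Longrightarrow> X (r, t) \<in> N"
proof -
  have o: "open (V \<inter> X -` N)" by (rule continuous_open_preimage[OF smooth_in_continuous[OF smooth_X] open_V open_N])
  have "open ((\<lambda>r. (r, t)) -` (V \<inter> X -` N))" by (rule open_vimage[OF o]) (intro continuous_intros)
  moreover have "p \<in> (\<lambda>r. (r, t)) -` (V \<inter> X -` N)" using base by simp
  ultimately obtain e where "e > 0" "ball p e \<subseteq> (\<lambda>r. (r, t)) -` (V \<inter> X -` N)" by (metis openE)
  then show thesis by (intro that[of e]) (auto simp: dist_commute subset_iff)
qed

lemma time_nbhd_N:
  obtains e where "e > 0" "\<And>s. dist s t < e \<Longrightarrow> (p, s) \<in> V" "\<And>s. dist s t < e \<Longrightarrow> X (p, s) \<in> N"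
proof -
  have o: "open (V \<inter> X -` N)" by (rule continuous_open_preimage[OF smooth_in_continuous[OF smooth_X] open_V open_N])
  have "open ((\<lambda>s. (p, s)) -` (V \<inter> X -` N))" by (rule open_vimage[OF o]) (intro continuous_intros)
  moreover have "t \<in> (\<lambda>s. (p, s)) -` (V \<inter> X -` N)" using base by simp
  ultimately obtain e where "e > 0" "ball t e \<subseteq> (\<lambda>s. (p, s)) -` (V \<inter> X -` N)" by (metis openE)
  then show thesis by (intro that[of e]) (auto simp: dist_commute subset_iff)
qed

lemma tangent_critical:
  assumes h: "(h has_derivative h') (at z)"
    and max: "\<And>r. norm r = 1 \<Longrightarrow> (r, t) \<in> V \<Longrightarrow> X (r, t) \<in> N \<Longrightarrow> h (G (r, t)) \<le> (h z :: real)"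
  shows "h' (ddir (perp p, 0) X (p, t), 0) = 0"
proof -
  obtain e where e: "e > 0" "\<And>r. dist r p < e \<Longrightarrow> (r, t) \<in> V" "\<And>r. dist r p < e \<Longrightarrow> X (r, t) \<in> N"
    by (rule sphere_nbhd) blast
  show ?thesis
    by (rule sphere_critical[OF base(2) has_derivative_pullback_space[OF base(1) h] e(1)]) (use max e in auto)
qed

lemma time_vanishing:
  assumes h: "(h has_derivative h') (at z)"
    and zero: "\<And>s. s \<in> I \<Longrightarrow> (p, s) \<in> V \<Longrightarrow> X (p, s) \<in> N \<Longrightarrow> h (G (p, s)) = (0 :: real)"
  shows "h' (ddir (0, 1) X (p, t), 1) = 0"
proof -
  obtain e where e: "e > 0" "\<And>s. dist s t < e \<Longrightarrow> (p, s) \<in> V" "\<And>s. dist s t < e \<Longrightarrow> X (p, s) \<in> N"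
    by (rule time_nbhd_N) blast
  have 1: "((\<lambda>s. h (G (p, s))) has_vector_derivative h' (ddir (0, 1) X (p, t), 1)) (at t within I)"
    by (rule has_derivative_pullback_time[OF base(1) h])
  have 2: "((\<lambda>s. h (G (p, s))) has_vector_derivative 0) (at t within I)"
    by (rule has_vector_derivative_transform_within[OF has_vector_derivative_const e(1) base(3)]) (use zero e in auto)
  from vector_derivative_unique_within[OF nontrivial_time[OF base(3)] 1 2] show ?thesis .
qed

definition j where "j = ddir (perp p, 0) X (p, t)"
definition n where "n = gradient \<rho> x"

lemma n_nz: "n \<noteq> 0"
  using gradient_nz[OF base(4)] by (simp add: n_def)

lemma j_nz: "j \<noteq> 0"
proof
  assume "j = 0"
  then have "perp p = 0" unfolding j_def by (rule immersed[OF base(1)])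
  then have "norm (perp p) = 0" by simp
  then show False using base(2) by simp
qed

lemma has_derivative_rho_fst: "((\<lambda>y. \<rho> (fst y)) has_derivative (\<lambda>w. n \<bullet> fst w)) (at z)"
proof -
  have "(fst has_derivative fst) (at z)" by (intro has_derivative_fst[OF has_derivative_ident, simplified])
  moreover have "(\<rho> has_derivative (\<lambda>w. ddir w \<rho> x)) (at (fst z))" unfolding fst_z by (rule smooth_inD[OF smooth_rho base(4)])
  ultimately have "((\<lambda>y. \<rho> (fst y)) has_derivative (\<lambda>w. ddir (fst w) \<rho> x)) (at z)" by (rule has_derivative_compose)
  then show ?thesis by (simp add: n_def inner_gradient[OF smooth_rho base(4)])
qed

lemma n_j: "n \<bullet> j = 0"
proof -
  have "\<rho> (X (r, t)) = 0" if "norm r = 1" "(r, t) \<in> V" "X (r, t) \<in> N" for r using on_boundary(2) that base(3) by blast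
  then show ?thesis using tangent_critical[OF has_derivative_rho_fst] base unfolding j_def by (simp add: G_def)
qed

lemma n_time: "n \<bullet> ddir (0, 1) X (p, t) = 0"
  using time_vanishing[OF has_derivative_rho_fst] on_boundary(2)[OF _ base(2)] by (simp add: G_def)

definition angle_defect' :: "(real^2) \<times> real \<Rightarrow> real" where
  "angle_defect' w = lorentz q ^ 3 * (q \<bullet> grad (ddir w u) z) * (q \<bullet> n)
     + lorentz q * (grad (ddir w u) z \<bullet> n + q \<bullet> gradient (ddir (fst w) \<rho>) x)
     - (gradient a x \<bullet> fst w * norm n + a x * (n \<bullet> gradient (ddir (fst w) \<rho>) x / norm n))"

lemma has_derivative_angle_defect: "(angle_defect has_derivative angle_defect') (at z)"
proof -
  have Dq: "(grad u has_derivative (\<lambda>w. grad (ddir w u) z)) (at z)" by (rule has_derivative_grad[OF open_W smooth_u z_W])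
  have qq: "grad u z \<bullet> grad u z < 1" using slope_less_1[OF base(1) p_disk base(3)] by (simp add: slope_def)
  note Dl = has_derivative_lorentz[OF Dq qq]
  have fst: "(fst has_derivative fst) (at z)" by (intro has_derivative_fst[OF has_derivative_ident, simplified])
  have Dn: "((\<lambda>y. gradient \<rho> (fst y)) has_derivative (\<lambda>w. gradient (ddir (fst w) \<rho>) x)) (at z)"
    by (rule has_derivative_compose[OF fst]) (unfold fst_z, rule has_derivative_gradient[OF open_N smooth_rho base(4)])
  have Da: "((\<lambda>y. a (fst y)) has_derivative (\<lambda>w. gradient a x \<bullet> fst w)) (at z)"
    unfolding inner_gradient[OF smooth_a base(4)]
    by (rule has_derivative_compose[OF fst]) (unfold fst_z, rule smooth_inD[OF smooth_a base(4)])
  have Dnorm: "((\<lambda>y. norm (gradient \<rho> (fst y))) has_derivative (\<lambda>w. n \<bullet> gradient (ddir (fst w) \<rho>) x / norm n)) (at z)"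
  proof -
    have "(norm has_derivative (\<lambda>h. h \<bullet> sgn n)) (at (gradient \<rho> (fst z)))"
      using has_derivative_norm[OF n_nz] by (simp add: fst_z n_def)
    from has_derivative_compose[OF Dn this] show ?thesis
      by (rule has_derivative_eq_rhs) (simp add: fun_eq_iff sgn_div_norm inner_commute divide_inverse mult.commute)
  qed
  have "(angle_defect has_derivative (\<lambda>w.
      lorentz (grad u z) * (grad u z \<bullet> gradient (ddir (fst w) \<rho>) x + grad (ddir w u) z \<bullet> gradient \<rho> (fst z))
      + (lorentz (grad u z) ^ 3 * (grad u z \<bullet> grad (ddir w u) z)) * (grad u z \<bullet> gradient \<rho> (fst z))
      - (a (fst z) * (n \<bullet> gradient (ddir (fst w) \<rho>) x / norm n) + (gradient a x \<bullet> fst w) * norm (gradient \<rho> (fst z))))) (at z)"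
    unfolding angle_defect_def[abs_def]
    by (intro has_derivative_diff has_derivative_mult has_derivative_inner Dl Dq Dn Da Dnorm)
  then show ?thesis
    by (rule has_derivative_eq_rhs) (simp add: fun_eq_iff angle_defect'_def fst_z n_def slope_def algebra_simps)
qed

lemma linear_angle_defect': "linear angle_defect'"
  by (rule has_derivative_linear[OF has_derivative_angle_defect])

lemma angle_defect'_j: "angle_defect' (j, 0) = 0"
proof -
  have "angle_defect (G (r, t)) = 0" if "norm r = 1" "(r, t) \<in> V" "X (r, t) \<in> N" for r using on_boundary(3) that base(3) by blast
  then show ?thesis using tangent_critical[OF has_derivative_angle_defect] base unfolding j_def by simp
qed

text \<open>A boundary point slides along the boundary with velocity \<open>xt\<close>, so at first
  the condition is differentiated along \<open>(xt, 1)\<close>. Both \<open>xt\<close> and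
  \<open>j\<close> are tangent to the boundary, and the derivative along \<open>j\<close> is already
  zero, so the pure time derivative remains.\<close>

lemma angle_defect'_time: "angle_defect' (0, 1) = 0"
proof -
  define xt where "xt = ddir (0, 1) X (p, t)"
  obtain c where c: "xt = c *\<^sub>R perp n" by (rule orthogonal_imp_perp[OF n_nz n_time[folded xt_def]])
  obtain d where d: "j = d *\<^sub>R perp n" by (rule orthogonal_imp_perp[OF n_nz n_j])
  have "d \<noteq> 0" using j_nz d by auto
  then have "xt = (c / d) *\<^sub>R j" unfolding c d by simp
  then have "angle_defect' (xt, 0) = (c / d) * angle_defect' (j, 0)"
    using linear_scale[OF linear_angle_defect', of "c / d" "(j, 0)"] by simp
  moreover have "angle_defect' (xt, 1) = 0"
    unfolding xt_def by (rule time_vanishing[OF has_derivative_angle_defect]) (use on_boundary(3) base in blast)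
  moreover have "angle_defect' (xt, 1) = angle_defect' (xt, 0) + angle_defect' (0, 1)"
    using linear_add[OF linear_angle_defect', of "(xt, 0)" "(0, 1)"] by simp
  ultimately show ?thesis by (simp add: angle_defect'_j)
qed

lemma lorentz_q: "lorentz q > 0" "lorentz q ^ 2 * (1 - q \<bullet> q) = 1"
  using slope_less_1[OF base(1) p_disk base(3)] lorentz_pos lorentz_square by auto

text \<open>Differentiating the angle condition in time gives an oblique condition on \<open>D u\<^sub>t\<close>; together with
  criticality along the boundary it forces \<open>D u\<^sub>t = 0\<close> at a boundary maximum.\<close>

lemma time_derivative_critical:
  assumes max: "\<And>r. r \<in> disk \<Longrightarrow> (r, t) \<in> V \<Longrightarrow> ddir (0, \<sigma>) u (G (r, t)) \<le> ddir (0, \<sigma>) u z" and \<sigma>: "\<sigma> \<noteq> 0"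
  shows "grad (ddir (0, \<sigma>) u) z = 0"
proof -
  define Q where "Q = grad (ddir (0, 1) u) z"
  have g: "grad (ddir (0, \<sigma>) u) z = \<sigma> *\<^sub>R Q"
  proof -
    have "ddir (axis i 1, 0) (ddir (0, \<sigma>) u) z = \<sigma> * ddir (axis i 1, 0) (ddir (0, 1) u) z" for i
      unfolding ddir_commute[OF open_W smooth_u z_W, of "(axis i 1, 0)"]
      using linear_scale[OF ddir_linear[OF smooth_in_ddir[OF smooth_u] z_W], of \<sigma> "(0, 1)" "(axis i 1, 0)"] by simp
    then show ?thesis by (simp add: Q_def grad_def vec_eq_iff)
  qed
  have "ddir (j, 0) (ddir (0, \<sigma>) u) z = 0"
    using tangent_critical[OF smooth_inD[OF smooth_in_ddir[OF smooth_u] z_W], of "(0, \<sigma>)"] max by (simp add: j_def)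
  then have Qj: "j \<bullet> Q = 0" using \<sigma> inner_grad[OF smooth_in_ddir[OF smooth_u] z_W, of "(0, \<sigma>)" j] by (simp add: g inner_commute)
  obtain c where c: "Q = c *\<^sub>R perp j" by (rule orthogonal_imp_perp[OF j_nz Qj])
  have "j \<bullet> n = 0" using n_j by (simp add: inner_commute)
  then obtain d where d: "n = d *\<^sub>R perp j" by (rule orthogonal_imp_perp[OF j_nz])
  have "d \<noteq> 0" using n_nz d by auto
  \<comment> \<open>Both \<open>Q\<close> and \<open>n\<close> are orthogonal to \<open>j\<close>,
    hence parallel in the plane.\<close>
  then have Qn: "Q = (c / d) *\<^sub>R n" unfolding c d by simp
  have "gradient (ddir 0 \<rho>) x = 0"
  proof -
    have "ddir (axis i 1) (ddir 0 \<rho>) x = 0" for i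
      unfolding ddir_commute[OF open_N smooth_rho base(4), of "axis i 1"]
      by (rule linear_0[OF ddir_linear[OF smooth_in_ddir[OF smooth_rho] base(4)]])
    then show ?thesis by (simp add: gradient_def vec_eq_iff)
  qed
  then have "lorentz q ^ 3 * (q \<bullet> Q) * (q \<bullet> n) + lorentz q * (Q \<bullet> n) = 0"
    using angle_defect'_time by (simp add: angle_defect'_def Q_def)
  then have "(c / d) * (lorentz q ^ 3 * (q \<bullet> n) ^ 2 + lorentz q * (n \<bullet> n)) = 0"
    unfolding Qn by (simp add: algebra_simps power2_eq_square)
  \<comment> \<open>Obliqueness: the coefficient of the normal derivative of u_t is strictly
    positive.\<close>
  moreover have "lorentz q ^ 3 * (q \<bullet> n) ^ 2 + lorentz q * (n \<bullet> n) > 0"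
    using lorentz_q(1) n_nz by (intro add_nonneg_pos mult_nonneg_nonneg mult_pos_pos) auto
  ultimately have "c / d = 0" by simp
  then show ?thesis by (simp add: g Qn)
qed

text \<open>The radial segment is mapped into the domain, where \<open>\<rho> \<le> 0\<close>, which
  gives the weak inequality. Equality would make the image of \<open>- p\<close> a multiple of
  \<open>j\<close>, contrary to the immersion property.\<close>

lemma inward_derivative: "n \<bullet> ddir (- p, 0) X (p, t) < 0"
proof -
  define m where "m = ddir (- p, 0) X (p, t)"
  obtain e where e: "e > 0" "\<And>r. dist r p < e \<Longrightarrow> (r, t) \<in> V" "\<And>r. dist r p < e \<Longrightarrow> X (r, t) \<in> N"
    by (rule sphere_nbhd) blast
  have D: "((\<lambda>s. \<rho> (X (p + s *\<^sub>R (- p), t))) has_real_derivative n \<bullet> m) (at 0 within {0..1})"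
  proof -
    have S: "p + s *\<^sub>R (- p) \<in> disk" if "s \<in> {0..1}" for s
    proof -
      have "p + s *\<^sub>R (- p) = (1 - s) *\<^sub>R p" by (simp add: algebra_simps)
      then show ?thesis using that base(2) by simp
    qed
    from ray_derivative[OF base(1) has_derivative_rho_fst S] show ?thesis
      by (simp add: G_def m_def has_real_derivative_iff_has_vector_derivative)
  qed
  have "n \<bullet> m \<le> 0"
  proof (rule ccontr)
    assume "\<not> ?thesis"
    then have "0 < n \<bullet> m" by simp
    from has_real_derivative_pos_inc_right[OF D this] obtain d where
      d: "d > 0" "\<And>s. 0 < s \<Longrightarrow> s \<in> {0..1} \<Longrightarrow> s < d \<Longrightarrow> \<rho> (X (p, t)) < \<rho> (X (p + s *\<^sub>R (- p), t))" by auto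
    define s where "s = Min {1, d, e} / 2"
    have s: "0 < s" "s < 1" "s < d" "s < e" using d(1) e(1) by (auto simp: s_def min_def)
    define r where "r = p + s *\<^sub>R (- p)"
    have r: "dist r p < e" using s base(2) by (simp add: r_def dist_norm)
    have "r = (1 - s) *\<^sub>R p" by (simp add: r_def algebra_simps)
    then have "r \<in> disk" using s base(2) by simp
    from image_in_domain[OF domain this base(3)] have "X (r, t) \<in> \<Omega>"
      using F_graph[OF e(2)[OF r] \<open>r \<in> disk\<close> base(3)] by simp
    then have "\<rho> (X (r, t)) \<le> 0" using in_domain_iff[OF e(3)[OF r]] by simp
    then show False using d(2)[of s] s on_boundary(2)[OF base] by (simp add: r_def)
  qed
  moreover have "n \<bullet> m \<noteq> 0"
  proof
    assume "n \<bullet> m = 0"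
    then obtain c where c: "m = c *\<^sub>R perp n" by (rule orthogonal_imp_perp[OF n_nz])
    obtain d where d: "j = d *\<^sub>R perp n" by (rule orthogonal_imp_perp[OF n_nz n_j])
    have "ddir ((- p, 0) + (- (c / d)) *\<^sub>R (perp p, 0)) X (p, t) = m + (- (c / d)) *\<^sub>R j"
      unfolding linear_add[OF linear_X[OF base(1)]] linear_scale[OF linear_X[OF base(1)]] m_def j_def ..
    moreover have "m + (- (c / d)) *\<^sub>R j = 0" using j_nz unfolding c d by auto
    ultimately have "ddir (- p - (c / d) *\<^sub>R perp p, 0) X (p, t) = 0" by simp
    then have "- p - (c / d) *\<^sub>R perp p = 0" by (rule immersed[OF base(1)])
    then have "(- p - (c / d) *\<^sub>R perp p) \<bullet> p = 0" by simp
    then have "p \<bullet> p = 0" by (simp add: inner_diff_left)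
    then show False using base(2) by simp
  qed
  ultimately show ?thesis by (simp add: m_def)
qed

text \<open>All hypotheses of \<open>boundary_algebra\<close> are read off at \<open>z\<close> in
  the frame \<open>N'\<close>, \<open>\<tau>\<close>: criticality along the circle, the one-sided
  derivative inward, the angle condition with its tangential derivative, and the flow equation with
  u_t in the role of \<phi>.\<close>

lemma boundary_gradient_bound:
  assumes max: "\<And>r. r \<in> disk \<Longrightarrow> (r, t) \<in> V \<Longrightarrow> slope r t \<bullet> slope r t \<le> q \<bullet> q"
    and C: "\<bar>ddir (0, 1) u z\<bar> \<le> C"
  shows "lorentz q \<le> 2 * (1 + A ^ 2) + 4 * A / k + 4 * A * C / k"
proof -
  define v where "v = lorentz q"
  define D where "D b c = grad (ddir (b, 0) u) z \<bullet> c" for b c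
  have Dsym: "D b c = D c b" for b c unfolding D_def by (rule grad_ddir_symmetric[OF open_W smooth_u z_W])
  have Dr: "D b (c + d) = D b c + D b d" "D b (r *\<^sub>R c) = r * D b c" for b c d r by (simp_all add: D_def inner_add_right)
  have Dl: "D (c + d) b = D c b + D d b" "D (r *\<^sub>R c) b = r * D c b" for b c d r unfolding Dsym[of _ b] by (simp_all add: Dr)
  have Ddd: "ddir (b, 0) (ddir (c, 0) u) z = D b c" for b c
    using inner_grad[OF smooth_in_ddir[OF smooth_u] z_W, of "(c, 0)" b] Dsym[of b c] by (simp add: D_def)
  have qg: "q = grad u z" by (simp add: slope_def)
  define h where "h y = grad u y \<bullet> grad u y" for y
  have hq: "h (G (r, t)) = slope r t \<bullet> slope r t" for r by (simp add: h_def slope_def)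
  have Dq: "(grad u has_derivative (\<lambda>w. grad (ddir w u) z)) (at z)" by (rule has_derivative_grad[OF open_W smooth_u z_W])
  have Dh: "(h has_derivative (\<lambda>w. 2 * (q \<bullet> grad (ddir w u) z))) (at z)"
    unfolding h_def[abs_def] by (rule has_derivative_eq_rhs[OF has_derivative_inner[OF Dq Dq]]) (simp add: fun_eq_iff qg inner_commute)
  have "2 * (q \<bullet> grad (ddir (j, 0) u) z) = 0"
    unfolding j_def by (rule tangent_critical[OF Dh]) (use max hq in auto)
  then have Djq: "D j q = 0" by (simp add: D_def inner_commute)
  define N' where "N' = n /\<^sub>R norm n"
  define \<tau> where "\<tau> = perp N'"
  have N1: "norm N' = 1" using n_nz by (simp add: N'_def)
  have \<tau>1: "norm \<tau> = 1" using N1 by (simp add: \<tau>_def)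
  have nN: "n = norm n *\<^sub>R N'" using n_nz by (simp add: N'_def)
  have pn: "perp n = norm n *\<^sub>R \<tau>" unfolding \<tau>_def by (subst nN) (simp add: vec_eq_iff forall_2)
  obtain c0 where "j = c0 *\<^sub>R perp n" by (rule orthogonal_imp_perp[OF n_nz n_j])
  then obtain cj where cj: "j = cj *\<^sub>R \<tau>" unfolding pn by auto
  have cj0: "cj \<noteq> 0" using j_nz cj by auto
  define m where "m = ddir (- p, 0) X (p, t)"
  define s nn where "s = q \<bullet> \<tau>" and "nn = q \<bullet> N'"
  have qd: "q = nn *\<^sub>R N' + s *\<^sub>R \<tau>" unfolding nn_def s_def \<tau>_def by (rule orthonormal_decomposition[OF N1])
  have Dtq: "D \<tau> q = 0" using Djq cj0 unfolding cj Dl(2) by simp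
  have DNq: "D N' q \<ge> 0"
  proof -
    have "2 * (q \<bullet> grad (ddir (ddir (0 - p, 0) X (p, t), 0) u) z) \<le> 0"
      by (rule first_variation[OF base(1) p_disk Dh]) (use max hq in auto)
    then have "D m q \<le> 0" by (simp add: D_def m_def inner_commute)
    \<comment> \<open>The inward vector \<open>m\<close> need not be normal, but its tangential part
      is harmless because \<open>D \<tau> q = 0\<close>.\<close>
    moreover have "m = (m \<bullet> N') *\<^sub>R N' + (m \<bullet> \<tau>) *\<^sub>R \<tau>" unfolding \<tau>_def by (rule orthonormal_decomposition[OF N1])
    then have "D m q = (m \<bullet> N') * D N' q + (m \<bullet> \<tau>) * D \<tau> q" using Dl by metis
    ultimately have le: "(m \<bullet> N') * D N' q \<le> 0" by (simp add: Dtq)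
    have "norm n * (m \<bullet> N') < 0" using inward_derivative unfolding m_def[symmetric] by (subst (asm) nN) (simp add: inner_commute)
    then have "m \<bullet> N' < 0" by (simp add: mult_less_0_iff)
    then show ?thesis using le by (simp add: mult_le_0_iff)
  qed
  define M b c where "M = D N' N'" and "b = D N' \<tau>" and "c = D \<tau> \<tau>"
  have tangential: "nn * b + s * c = 0" using Dtq unfolding b_def c_def by (subst (asm) qd) (simp add: Dr Dsym[of \<tau> N'])
  have normal: "nn * M + s * b \<ge> 0" using DNq unfolding b_def M_def by (subst (asm) qd) (simp add: Dr)
  have v: "v > 0" "v ^ 2 * (1 - q \<bullet> q) = 1" using lorentz_q by (auto simp: v_def)
  have NN: "N' \<bullet> N' = 1" "\<tau> \<bullet> \<tau> = 1" "N' \<bullet> \<tau> = 0" "\<tau> \<bullet> N' = 0" using N1 by (auto simp: \<tau>_def dot_square_norm)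
  have "q \<bullet> q = nn ^ 2 + s ^ 2" by (subst (1 2) qd) (simp add: inner_add_left inner_add_right NN power2_eq_square)
  then have vv: "v ^ 2 * (1 - nn ^ 2 - s ^ 2) = 1" using v(2) by (simp add: algebra_simps)
  have ang0: "v * (q \<bullet> n) = a x * norm n"
    using on_boundary(3)[OF base] by (simp add: angle_defect_def qg[symmetric] fst_z v_def n_def)
  then have "norm n * (v * nn) = norm n * a x" unfolding nn_def by (subst (asm) nN) (simp add: ac_simps)
  then have vn: "v * nn = a x" using n_nz by simp
  define w where "w = gradient (ddir \<tau> \<rho>) x"
  define \<kappa> where "\<kappa> = (\<tau> \<bullet> w) / norm n"
  have fr: "x \<in> frontier \<Omega>" by (rule on_boundary(1)[OF base])
  have "n \<bullet> \<tau> = 0" by (subst nN) (simp add: NN)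
  then have "k * norm n \<le> ddir \<tau> (ddir \<tau> \<rho>) x" using curvature_bound[OF fr base(4) \<tau>1] by (simp add: n_def)
  also have "\<dots> = \<tau> \<bullet> w" unfolding w_def by (simp add: inner_commute[of \<tau>] inner_gradient[OF smooth_in_ddir[OF smooth_rho] base(4)])
  finally have \<kappa>: "k \<le> \<kappa>" using n_nz by (simp add: \<kappa>_def field_simps)
  have "angle_defect' (\<tau>, 0) = 0"
  proof -
    have "cj * angle_defect' (\<tau>, 0) = 0"
      using angle_defect'_j linear_scale[OF linear_angle_defect', of cj "(\<tau>, 0)"] by (simp add: cj)
    then show ?thesis using cj0 by simp
  qed
  \<comment> \<open>The derivative of \<open>lorentz\<close> drops out because |Du|^2 is stationary
    along the boundary.\<close>
  then have "v * (D \<tau> n + q \<bullet> w) = gradient a x \<bullet> \<tau> * norm n + a x * (n \<bullet> w / norm n)"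
    using Dtq by (simp add: angle_defect'_def v_def[symmetric] w_def D_def inner_commute)
  moreover have "D \<tau> n = norm n * b" unfolding b_def by (subst nN) (simp add: Dr Dsym[of \<tau> N'])
  moreover have "q \<bullet> w = nn * (N' \<bullet> w) + s * (norm n * \<kappa>)" using n_nz by (subst qd) (simp add: inner_add_left \<kappa>_def)
  moreover have "n \<bullet> w / norm n = N' \<bullet> w" using n_nz by (subst nN) simp
  \<comment> \<open>As \<open>v * nn = a x\<close>, the change in length of the gradient of
    \<open>\<rho>\<close> cancels on both sides; only the rotation of the normal, that is the
    curvature, is left.\<close>
  ultimately have "v * (norm n * b + nn * (N' \<bullet> w) + s * (norm n * \<kappa>)) = gradient a x \<bullet> \<tau> * norm n + (v * nn) * (N' \<bullet> w)"
    by (simp add: vn add.assoc)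
  then have "norm n * (v * (b + s * \<kappa>)) = norm n * (gradient a x \<bullet> \<tau>)" by (simp add: algebra_simps)
  then have angle': "v * (b + s * \<kappa>) = gradient a x \<bullet> \<tau>" using n_nz by simp
  have a': "\<bar>gradient a x \<bullet> \<tau>\<bar> \<le> A"
    using Cauchy_Schwarz_ineq2[of "gradient a x" \<tau>] a_gradient_bound[OF base(4)] \<tau>1 by simp
  have trace: "D (axis 1 1) (axis 1 1) + D (axis 2 1) (axis 2 1) = M + c"
  proof -
    define y1 y2 where "y1 = N' $ 1" and "y2 = N' $ 2"
    have y: "y1 * y1 + y2 * y2 = 1" using NN(1) by (simp add: inner_2 y1_def y2_def)
    have N'e: "N' = y1 *\<^sub>R axis 1 1 + y2 *\<^sub>R axis 2 1" and \<tau>e: "\<tau> = (- y2) *\<^sub>R axis 1 1 + y1 *\<^sub>R axis 2 1"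
      by (simp_all add: vec_eq_iff forall_2 axis_def y1_def y2_def \<tau>_def)
    \<comment> \<open>The trace of the Hessian does not depend on the orthonormal frame.\<close>
    have "M + c = (y1 * y1 + y2 * y2) * (D (axis 1 1) (axis 1 1) + D (axis 2 1) (axis 2 1))"
      unfolding M_def c_def N'e \<tau>e Dl Dr by (simp add: algebra_simps)
    then show ?thesis by (simp add: y)
  qed
  have "D q q = nn ^ 2 * M + 2 * nn * s * b + s ^ 2 * c"
    unfolding M_def b_def c_def by (subst (1 2) qd) (simp add: Dl Dr Dsym[of \<tau> N'] power2_eq_square algebra_simps)
  then have \<phi>: "ddir (0, 1) u z = M + c + v ^ 2 * (nn ^ 2 * M + 2 * nn * s * b + s ^ 2 * c)"
    unfolding flow_equation[OF base(1) p_disk base(3)] second_trace_def Ddd qg[symmetric] v_def[symmetric] trace by simp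
  have "v \<le> 2 * (1 + A ^ 2) + 4 * A / k + 4 * A * C / k"
    by (rule boundary_algebra[OF v(1) vn vv tangential normal angle' \<phi> a_bound[OF base(4)] a' k_pos \<kappa> C])
  then show ?thesis by (simp add: v_def)
qed

end

section \<open>Global estimates\<close>

context flow
begin

definition tilt :: "real^2 \<Rightarrow> real \<Rightarrow> real" where
  "tilt p t = gradient_function (\<lambda>p. F p t) p"

text \<open>In a graphical chart these are \<open>|Du|\<^sup>2\<close> and \<open>u\<^sub>t\<close>.\<close>

definition steepness :: "real^2 \<Rightarrow> real \<Rightarrow> real" where
  "steepness p t = 1 - 1 / tilt p t ^ 2"

definition speed :: "real^2 \<Rightarrow> real \<Rightarrow> real" where
  "speed p t = mean_curvature (\<lambda>p. F p t) p / tilt p t"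

end

context graph_chart
begin

lemma tilt_eq: "(p, t) \<in> V \<Longrightarrow> p \<in> disk \<Longrightarrow> t \<in> I \<Longrightarrow> tilt p t = lorentz (slope p t)"
  unfolding tilt_def by (rule gradient_function_eq)

lemma steepness_eq:
  assumes "(p, t) \<in> V" "p \<in> disk" "t \<in> I"
  shows "steepness p t = slope p t \<bullet> slope p t"
proof -
  have lt: "slope p t \<bullet> slope p t < 1" by (rule slope_less_1[OF assms])
  have "1 / lorentz (slope p t) ^ 2 = 1 - slope p t \<bullet> slope p t"
    using lorentz_square[OF lt] lorentz_pos[OF lt] by (simp add: field_simps)
  then show ?thesis by (simp add: steepness_def tilt_eq[OF assms])
qed

lemma speed_eq_trace:
  assumes "(p, t) \<in> V" "p \<in> disk" "t \<in> I"
  shows "speed p t = second_trace u (G (p, t))"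
  using lorentz_pos[OF slope_less_1[OF assms]]
  by (simp add: speed_def mean_curvature_graph[OF assms] tilt_eq[OF assms])

lemma speed_eq: "(p, t) \<in> V \<Longrightarrow> p \<in> disk \<Longrightarrow> t \<in> I \<Longrightarrow> speed p t = ddir (0, 1) u (G (p, t))"
  using speed_eq_trace flow_equation by simp

text \<open>At a critical spatial maximum the time derivative of \<open>ddir e u\<close> is
  nonpositive, so subtracting \<open>\<epsilon> * t\<close> makes it strictly negative and a
  slightly earlier time has a larger value. No space-time maximum can occur there.\<close>

lemma time_contradiction:
  assumes y: "(p, t) \<in> V" "p \<in> disk" "t \<in> I" "t > 0" and crit: "grad (ddir e u) (G (p, t)) = 0"
    and max: "\<And>p'. p' \<in> disk \<Longrightarrow> (p', t) \<in> V \<Longrightarrow> ddir e u (G (p', t)) \<le> ddir e u (G (p, t))" and \<epsilon>: "\<epsilon> > 0"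
  obtains s where "0 \<le> s" "s < t" "(p, s) \<in> V" "ddir e u (G (p, t)) - \<epsilon> * t < ddir e u (G (p, s)) - \<epsilon> * s"
proof -
  note L = linearized_maximum[OF y(1-3) crit max]
  have D: "((\<lambda>s. ddir e u (G (p, s)) - \<epsilon> * s) has_real_derivative (ddir (0, 1) (ddir e u) (G (p, t)) - \<epsilon>)) (at t)"
    by (rule DERIV_diff[OF L(2) DERIV_cmult_Id])
  have "ddir (0, 1) (ddir e u) (G (p, t)) - \<epsilon> < 0" using L(1) \<epsilon> by simp
  from DERIV_neg_dec_left[OF D this] obtain d where d: "d > 0"
    "\<And>h. 0 < h \<Longrightarrow> h < d \<Longrightarrow> ddir e u (G (p, t)) - \<epsilon> * t < ddir e u (G (p, t - h)) - \<epsilon> * (t - h)" by auto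
  obtain r where r: "r > 0" "\<And>s. dist s t < r \<Longrightarrow> (p, s) \<in> V" by (rule time_nbhd[OF y(1)]) blast
  define h where "h = Min {d, r, t} / 2"
  have h: "0 < h" "h < d" "h < r" "h < t" using d(1) r(1) y(4) by (auto simp: h_def min_def)
  show thesis
    by (rule that[of "t - h"]) (use h d(2)[OF h(1,2)] in \<open>auto intro!: r(2) simp: dist_real_def\<close>)
qed

lemma continuous_slope: "y \<in> V \<Longrightarrow> isCont (\<lambda>y. grad u (G y)) y"
  using has_derivative_continuous[OF has_derivative_pullback[OF _ has_derivative_grad[OF open_W smooth_u G_in]]] by blast

lemma continuous_time_derivative: "y \<in> V \<Longrightarrow> isCont (\<lambda>y. ddir (0, 1) u (G y)) y"
  using has_derivative_continuous[OF has_derivative_pullback[OF _ smooth_inD[OF smooth_in_ddir[OF smooth_u] G_in]]] by blast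

end

context flow
begin

lemma continuous_speed: "continuous_on (disk \<times> I) (\<lambda>(p, t). speed p t)"
proof (rule continuous_on_local_extension)
  fix y :: "(real^2) \<times> real" assume "y \<in> disk \<times> I"
  then obtain p t where y: "y = (p, t)" "p \<in> disk" "t \<in> I" by auto
  obtain V W X u where V: "(p, t) \<in> V" and gc: "graph_chart \<Omega> \<alpha> F\<^sub>0 T F V W X u" by (rule chart_exists[OF y(2,3)])
  interpret graph_chart \<Omega> \<alpha> F\<^sub>0 T F V W X u by (rule gc)
  show "\<exists>U g. open U \<and> y \<in> U \<and> isCont g y \<and> (\<forall>z\<in>disk \<times> I \<inter> U. g z = (case z of (p, t) \<Rightarrow> speed p t))"
    by (intro exI[of _ V] exI[of _ "\<lambda>y. ddir (0, 1) u (G y)"] conjI)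
      (use open_V V y(1) continuous_time_derivative speed_eq in auto)
qed

lemma continuous_steepness: "continuous_on (disk \<times> I) (\<lambda>(p, t). steepness p t)"
proof (rule continuous_on_local_extension)
  fix y :: "(real^2) \<times> real" assume "y \<in> disk \<times> I"
  then obtain p t where y: "y = (p, t)" "p \<in> disk" "t \<in> I" by auto
  obtain V W X u where V: "(p, t) \<in> V" and gc: "graph_chart \<Omega> \<alpha> F\<^sub>0 T F V W X u" by (rule chart_exists[OF y(2,3)])
  interpret graph_chart \<Omega> \<alpha> F\<^sub>0 T F V W X u by (rule gc)
  show "\<exists>U g. open U \<and> y \<in> U \<and> isCont g y \<and> (\<forall>z\<in>disk \<times> I \<inter> U. g z = (case z of (p, t) \<Rightarrow> steepness p t))"
    by (intro exI[of _ V] exI[of _ "\<lambda>y. grad u (G y) \<bullet> grad u (G y)"] conjI)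
      (use open_V V y(1) continuous_slope steepness_eq in \<open>auto simp: slope_def intro!: continuous_intros\<close>)
qed

lemma tilt_pos: "p \<in> disk \<Longrightarrow> t \<in> I \<Longrightarrow> tilt p t > 0"
proof -
  assume y: "p \<in> disk" "t \<in> I"
  obtain V W X u where V: "(p, t) \<in> V" and gc: "graph_chart \<Omega> \<alpha> F\<^sub>0 T F V W X u" by (rule chart_exists[OF y])
  interpret graph_chart \<Omega> \<alpha> F\<^sub>0 T F V W X u by (rule gc)
  show ?thesis using lorentz_pos[OF slope_less_1[OF V y]] tilt_eq[OF V y] by simp
qed

text \<open>The maximum principle is run on the squared slope, while the claim concerns
  \<open>v\<close>; the two are monotone functions of each other.\<close>

lemma tilt_le_iff:
  assumes "p \<in> disk" "t \<in> I" "C > 0"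
  shows "tilt p t \<le> C \<longleftrightarrow> steepness p t \<le> 1 - 1 / C ^ 2"
proof -
  have "steepness p t \<le> 1 - 1 / C ^ 2 \<longleftrightarrow> 1 / C ^ 2 \<le> 1 / tilt p t ^ 2" by (auto simp: steepness_def)
  also have "\<dots> \<longleftrightarrow> tilt p t ^ 2 \<le> C ^ 2" using tilt_pos[OF assms(1,2)] assms(3) by (simp add: field_simps)
  also have "\<dots> \<longleftrightarrow> tilt p t \<le> C" using tilt_pos[OF assms(1,2)] assms(3) by (simp add: power2_le_iff_abs_le)
  finally show ?thesis by simp
qed

lemma space_time_maximum:
  fixes f :: "real^2 \<Rightarrow> real \<Rightarrow> real"
  assumes "continuous_on (disk \<times> I) (\<lambda>(p, t). f p t)" "t1 \<in> I"
  obtains p0 t0 where "p0 \<in> disk" "0 \<le> t0" "t0 \<le> t1" "t0 \<in> I"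
    "\<And>p t. p \<in> disk \<Longrightarrow> 0 \<le> t \<Longrightarrow> t \<le> t1 \<Longrightarrow> f p t - \<epsilon> * t \<le> f p0 t0 - \<epsilon> * (t0 :: real)"
proof -
  have t1: "0 \<le> t1" using assms(2) by (simp add: time_interval_def)
  have sub: "disk \<times> {0..t1} \<subseteq> disk \<times> I" using time_interval_prefix[OF assms(2)] by auto
  have "continuous_on (disk \<times> {0..t1}) (\<lambda>y. (\<lambda>(p, t). f p t) y - \<epsilon> * snd y)"
    by (intro continuous_intros continuous_on_subset[OF assms(1) sub])
  moreover have "compact ((disk :: (real^2) set) \<times> {0..t1})" by (intro compact_Times compact_cball compact_Icc)
  moreover have "(0, 0) \<in> (disk :: (real^2) set) \<times> {0..t1}" using t1 by simp
  ultimately have "\<exists>y\<in>disk \<times> {0..t1}. \<forall>z\<in>disk \<times> {0..t1}. (\<lambda>(p, t). f p t) z - \<epsilon> * snd z \<le> (\<lambda>(p, t). f p t) y - \<epsilon> * snd y"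
    by (intro continuous_attains_sup) auto
  then obtain p0 t0 where "p0 \<in> disk" "t0 \<in> {0..t1}"
    "\<forall>z\<in>disk \<times> {0..t1}. (\<lambda>(p, t). f p t) z - \<epsilon> * snd z \<le> f p0 t0 - \<epsilon> * t0" by auto
  then show thesis using time_interval_prefix[OF assms(2)] by (intro that[of p0 t0]) auto
qed

end

locale bounded_flow = flow +
  fixes k A :: real
  assumes domain: "smooth_convex_domain \<Omega>" and k_pos: "k > 0" and A_nonneg: "A \<ge> 0"
    and boundary_charts: "x \<in> frontier \<Omega> \<Longrightarrow> \<exists>N \<rho> a. x \<in> N \<and> boundary_data \<Omega> N \<rho> \<alpha> a k A"
begin

lemma boundary_chart_exists:
  assumes gc: "graph_chart \<Omega> \<alpha> F\<^sub>0 T F V W X u" and y: "(p, t) \<in> V" "norm p = 1" "t \<in> I"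
  obtains N \<rho> a where "boundary_chart \<Omega> \<alpha> F\<^sub>0 T F V W X u N \<rho> a k A p t"
proof -
  interpret graph_chart \<Omega> \<alpha> F\<^sub>0 T F V W X u by (rule gc)
  have p: "p \<in> disk" "p \<in> sphere 0 1" using y(2) by auto
  have "F p t \<in> cylinder \<Omega>" using mcf y(3) p(2) by (auto simp: mcf_neumann_def boundary_angle_condition_def)
  then have "X (p, t) \<in> frontier \<Omega>" by (simp add: F_graph[OF y(1) p(1) y(3)] cylinder_def)
  from boundary_charts[OF this] obtain N \<rho> a where N: "X (p, t) \<in> N" "boundary_data \<Omega> N \<rho> \<alpha> a k A" by blast
  interpret boundary_data \<Omega> N \<rho> \<alpha> a k A by (rule N(2))
  have "boundary_chart \<Omega> \<alpha> F\<^sub>0 T F V W X u N \<rho> a k A p t"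
    by unfold_locales (use y N(1) domain in auto)
  then show thesis by (rule that)
qed

text \<open>The number \<sigma> u_t is the derivative of \<open>u\<close> in the fixed direction
  \<open>(0, \<sigma>)\<close>, so the signs 1 and -1 give the upper and the lower bound by one
  argument.\<close>

lemma signed_speed_bound:
  assumes init: "\<And>p. p \<in> disk \<Longrightarrow> \<sigma> * speed p 0 \<le> C" and \<sigma>: "\<sigma> \<noteq> 0" and t1: "t1 \<in> I" "p1 \<in> disk"
  shows "\<sigma> * speed p1 t1 \<le> C"
proof (rule field_le_epsilon)
  fix e :: real assume e: "e > 0"
  have t1': "0 \<le> t1" using t1(1) by (simp add: time_interval_def)
  \<comment> \<open>The perturbation costs at most \<open>e\<close> up to time \<open>t1\<close>;
    the added 1 covers \<open>t1 = 0\<close>.\<close>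
  define \<epsilon> where "\<epsilon> = e / (t1 + 1)"
  have \<epsilon>: "\<epsilon> > 0" "\<epsilon> * t1 \<le> e" using e t1' by (auto simp: \<epsilon>_def field_simps)
  have cont: "continuous_on (disk \<times> I) (\<lambda>(p, t). \<sigma> * speed p t)"
    using continuous_on_mult[OF continuous_on_const continuous_speed, of \<sigma>] by (simp add: split_def)
  obtain p0 t0 where y0: "p0 \<in> disk" "0 \<le> t0" "t0 \<le> t1" "t0 \<in> I"
    and max: "\<And>p t. p \<in> disk \<Longrightarrow> 0 \<le> t \<Longrightarrow> t \<le> t1 \<Longrightarrow> \<sigma> * speed p t - \<epsilon> * t \<le> \<sigma> * speed p0 t0 - \<epsilon> * t0"
    by (rule space_time_maximum[OF cont t1(1), of \<epsilon>]) blast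
  have "t0 = 0"
  proof (rule ccontr)
    assume "t0 \<noteq> 0"
    then have t0: "t0 > 0" using y0(2) by simp
    obtain V W X u where V: "(p0, t0) \<in> V" and gc: "graph_chart \<Omega> \<alpha> F\<^sub>0 T F V W X u" by (rule chart_exists[OF y0(1,4)])
    interpret graph_chart \<Omega> \<alpha> F\<^sub>0 T F V W X u by (rule gc)
    have eq: "ddir (0, \<sigma>) u (G (p, t)) = \<sigma> * speed p t" if "(p, t) \<in> V" "p \<in> disk" "t \<in> I" for p t
      using linear_scale[OF ddir_linear[OF smooth_u G_in[OF that(1)]], of \<sigma> "(0, 1)"] speed_eq[OF that] by simp
    have smax: "ddir (0, \<sigma>) u (G (p, t0)) \<le> ddir (0, \<sigma>) u (G (p0, t0))" if "p \<in> disk" "(p, t0) \<in> V" for p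
      using max[OF that(1) y0(2,3)] eq[OF that(2,1) y0(4)] eq[OF V y0(1,4)] by simp
    have crit: "grad (ddir (0, \<sigma>) u) (G (p0, t0)) = 0"
    proof (cases "norm p0 = 1")
      case True
      obtain N \<rho> a where "boundary_chart \<Omega> \<alpha> F\<^sub>0 T F V W X u N \<rho> a k A p0 t0"
        by (rule boundary_chart_exists[OF gc V True y0(4)])
      then interpret b: boundary_chart \<Omega> \<alpha> F\<^sub>0 T F V W X u N \<rho> a k A p0 t0 .
      show ?thesis by (rule b.time_derivative_critical[OF smax \<sigma>])
    next
      case False
      then have "p0 \<in> ball 0 1" using y0(1) by simp
      then show ?thesis by (rule interior_critical[OF V _ smooth_in_ddir[OF smooth_u] smax])
    qed
    obtain s where s: "0 \<le> s" "s < t0" "(p0, s) \<in> V"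
      "ddir (0, \<sigma>) u (G (p0, t0)) - \<epsilon> * t0 < ddir (0, \<sigma>) u (G (p0, s)) - \<epsilon> * s"
      by (rule time_contradiction[OF V y0(1,4) t0 crit smax \<epsilon>(1)])
    have "s \<in> I" by (rule time_interval_prefix[OF y0(4) s(1)]) (use s(2) in simp)
    then show False using s max[OF y0(1) s(1)] y0(3) eq[OF V y0(1,4)] eq[OF s(3) y0(1)] by auto
  qed
  then have "\<sigma> * speed p1 t1 - \<epsilon> * t1 \<le> C" using max[OF t1(2) t1' order_refl] init[OF y0(1)] by simp
  then show "\<sigma> * speed p1 t1 \<le> C + e" using \<epsilon>(2) by simp
qed

lemma speed_bound:
  assumes "\<And>p. p \<in> disk \<Longrightarrow> \<bar>speed p 0\<bar> \<le> C" "t \<in> I" "p \<in> disk"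
  shows "\<bar>speed p t\<bar> \<le> C"
proof -
  have "1 * speed p t \<le> C" by (rule signed_speed_bound[OF _ _ assms(2,3)]) (use assms(1) in \<open>auto simp: abs_le_iff\<close>)
  moreover have "- 1 * speed p t \<le> C" by (rule signed_speed_bound[OF _ _ assms(2,3)]) (use assms(1) in \<open>auto simp: abs_le_iff\<close>)
  ultimately show ?thesis by simp
qed

text \<open>A maximum of |Du|^2 - \<epsilon> t is controlled by \<open>C1\<close> at time 0 and by
  the boundary estimate on the circle, and at later times it cannot be interior. Since \<epsilon> is
  arbitrary, the bound passes to every point.\<close>

lemma tilt_bound:
  assumes speed0: "\<And>p. p \<in> disk \<Longrightarrow> \<bar>speed p 0\<bar> \<le> C0" and tilt0: "\<And>p. p \<in> disk \<Longrightarrow> tilt p 0 \<le> C1"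
    and t1: "t1 \<in> I" "p1 \<in> disk"
  shows "tilt p1 t1 \<le> max C1 (2 * (1 + A ^ 2) + 4 * A / k + 4 * A * C0 / k)"
proof -
  define C2 where "C2 = 2 * (1 + A ^ 2) + 4 * A / k + 4 * A * C0 / k"
  define C where "C = max C1 C2"
  have C: "C1 \<le> C" "C2 \<le> C" by (auto simp: C_def)
  have Cpos: "C > 0" using tilt_pos[OF _ zero_in_I, of 0] tilt0[of 0] C(1) by simp
  have t1': "0 \<le> t1" using t1(1) by (simp add: time_interval_def)
  have "steepness p1 t1 \<le> 1 - 1 / C ^ 2"
  proof (rule field_le_epsilon)
    fix e :: real assume e: "e > 0"
    define \<epsilon> where "\<epsilon> = e / (t1 + 1)"
    have \<epsilon>: "\<epsilon> > 0" "\<epsilon> * t1 \<le> e" using e t1' by (auto simp: \<epsilon>_def field_simps)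
    obtain p0 t0 where y0: "p0 \<in> disk" "0 \<le> t0" "t0 \<le> t1" "t0 \<in> I"
      and max: "\<And>p t. p \<in> disk \<Longrightarrow> 0 \<le> t \<Longrightarrow> t \<le> t1 \<Longrightarrow> steepness p t - \<epsilon> * t \<le> steepness p0 t0 - \<epsilon> * t0"
      by (rule space_time_maximum[OF continuous_steepness t1(1), of \<epsilon>]) blast
    have "tilt p0 t0 \<le> C"
    proof (cases "t0 = 0")
      case True
      then show ?thesis using tilt0[OF y0(1)] C(1) by simp
    next
      case False
      then have t0: "t0 > 0" using y0(2) by simp
      obtain V W X u where V: "(p0, t0) \<in> V" and gc: "graph_chart \<Omega> \<alpha> F\<^sub>0 T F V W X u" by (rule chart_exists[OF y0(1,4)])
      interpret graph_chart \<Omega> \<alpha> F\<^sub>0 T F V W X u by (rule gc)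
      have smax: "slope p t0 \<bullet> slope p t0 \<le> slope p0 t0 \<bullet> slope p0 t0" if "p \<in> disk" "(p, t0) \<in> V" for p
        using max[OF that(1) y0(2,3)] steepness_eq[OF that(2,1) y0(4)] steepness_eq[OF V y0(1,4)] by simp
      show ?thesis
      proof (cases "norm p0 = 1")
        case True
        obtain N \<rho> a where "boundary_chart \<Omega> \<alpha> F\<^sub>0 T F V W X u N \<rho> a k A p0 t0"
          by (rule boundary_chart_exists[OF gc V True y0(4)])
        then interpret b: boundary_chart \<Omega> \<alpha> F\<^sub>0 T F V W X u N \<rho> a k A p0 t0 .
        have "\<bar>ddir (0, 1) u (G (p0, t0))\<bar> \<le> C0"
          using speed_bound[OF speed0 y0(4,1)] speed_eq[OF V y0(1,4)] by simp
        from b.boundary_gradient_bound[OF smax this] show ?thesis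
          using C(2) by (simp add: tilt_eq[OF V y0(1,4)] C2_def)
      next
        case False
        then have int: "p0 \<in> ball 0 1" using y0(1) by simp
        \<comment> \<open>Freezing \<open>q\<close> replaces the quadratic quantity by a linear one:
          q . Du is at most half of |Du|^2 + |q|^2, with equality at the maximum point, so it is
          maximal there too.\<close>
        define q where "q = slope p0 t0"
        have eq: "ddir (q, 0) u (G (p, t)) = slope p t \<bullet> q" if "(p, t) \<in> V" for p t
          using inner_grad[OF smooth_u G_in[OF that]] by (simp add: slope_def)
        have young: "2 * (b \<bullet> c) \<le> b \<bullet> b + c \<bullet> c" for b c :: "real^2"
          using inner_ge_zero[of "b - c"] by (simp add: inner_diff_left inner_diff_right inner_commute)
        have dmax: "ddir (q, 0) u (G (p, t0)) \<le> ddir (q, 0) u (G (p0, t0))" if "p \<in> disk" "(p, t0) \<in> V" for p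
          using young[of "slope p t0" q] smax[OF that] unfolding eq[OF that(2)] eq[OF V] unfolding q_def by linarith
        have crit: "grad (ddir (q, 0) u) (G (p0, t0)) = 0"
          by (rule interior_critical[OF V int smooth_in_ddir[OF smooth_u] dmax])
        \<comment> \<open>The same inequality, applied at the earlier time, doubles the linear
          estimate, so half the perturbation matches \<epsilon> for |Du|^2.\<close>
        have half: "\<epsilon> / 2 > 0" using \<epsilon>(1) by simp
        obtain s where s: "0 \<le> s" "s < t0" "(p0, s) \<in> V"
          "ddir (q, 0) u (G (p0, t0)) - \<epsilon> / 2 * t0 < ddir (q, 0) u (G (p0, s)) - \<epsilon> / 2 * s"
          by (rule time_contradiction[OF V y0(1,4) t0 crit dmax half])
        have sI: "s \<in> I" by (rule time_interval_prefix[OF y0(4) s(1)]) (use s(2) in simp)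
        have "steepness p0 s - \<epsilon> * s \<le> steepness p0 t0 - \<epsilon> * t0" using max[OF y0(1) s(1)] s(2) y0(3) by simp
        then have "slope p0 s \<bullet> slope p0 s - \<epsilon> * s \<le> q \<bullet> q - \<epsilon> * t0"
          by (simp add: steepness_eq[OF s(3) y0(1) sI] steepness_eq[OF V y0(1,4)] q_def)
        moreover have "q \<bullet> q - \<epsilon> * t0 / 2 < slope p0 s \<bullet> q - \<epsilon> * s / 2" using s(4) unfolding eq[OF V] eq[OF s(3)] by (simp add: q_def)
        ultimately have False using young[of "slope p0 s" q] by linarith
        then show ?thesis ..
      qed
    qed
    then have "steepness p0 t0 \<le> 1 - 1 / C ^ 2" using tilt_le_iff[OF y0(1,4) Cpos] by simp
    moreover have "\<epsilon> * t0 \<ge> 0" using \<epsilon>(1) y0(2) by simp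
    ultimately show "steepness p1 t1 \<le> 1 - 1 / C ^ 2 + e"
      using max[OF t1(2) t1' order_refl] \<epsilon>(2) by linarith
  qed
  then show ?thesis using tilt_le_iff[OF t1(2,1) Cpos] by (simp add: C_def C2_def)
qed

end

section \<open>Dependence on the initial surface only\<close>

lemma ddir_diff:
  assumes "smooth_in W f" "smooth_in W' g" "z \<in> W" "z \<in> W'"
  shows "ddir w (\<lambda>z. f z - g z) z = ddir w f z - ddir w g z"
  by (rule ddir_eqI[OF has_derivative_diff[OF smooth_inD[OF assms(1,3)] smooth_inD[OF assms(2,4)]]])

text \<open>The images of parameter directions fill the plane, so vanishing along the surface forces
  all spatial derivatives to vanish, also over the edge of the disk.\<close>

lemma (in graph_chart) vanishing_derivative:
  assumes S: "open S" and z: "smooth_in W' f" "\<And>r. r \<in> disk \<inter> S \<Longrightarrow> (r, t) \<in> V \<and> G (r, t) \<in> W' \<and> f (G (r, t)) = (0 :: real)"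
    and r: "r \<in> disk \<inter> S"
  shows "ddir (a, 0) f (G (r, t)) = 0"
proof -
  have V: "(r, t) \<in> V" "G (r, t) \<in> W'" "r \<in> disk" "r \<in> S" using z(2)[OF r] r by auto
  have D: "((\<lambda>r. f (G (r, t))) has_derivative (\<lambda>d. ddir (ddir (d, 0) X (r, t), 0) f (G (r, t)))) (at r within disk)"
    by (rule has_derivative_pullback_space[OF V(1) smooth_inD[OF z(1) V(2)]])
  obtain d where d: "a = ddir (d, 0) X (r, t)" using surjD[OF surj_immersion[OF V(1)], of a] by blast
  show ?thesis unfolding d
    by (rule derivative_zero_on_convex[OF convex_disk V(3) D S V(4)]) (use z(2) in blast)
qed

text \<open>The two flows may parametrize the same surface differently. Passing to the second
  parameter \<open>h r\<close> over the same point, the two local graph functions coincide on the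
  projected surface at time 0, hence so do their first and second spatial derivatives there, and
  these determine both quantities.\<close>

lemma initial_data_agree:
  assumes f1: "flow \<Omega> \<alpha> F1 T1 F" and f2: "flow \<Omega> \<alpha> F2 T2 F'" and im: "F1 ` disk = F2 ` disk" and p: "p \<in> disk"
  obtains p' where "p' \<in> disk" "flow.tilt F p 0 = flow.tilt F' p' 0" "flow.speed F p 0 = flow.speed F' p' 0"
proof -
  interpret A: flow \<Omega> \<alpha> F1 T1 F by (rule f1)
  interpret B: flow \<Omega> \<alpha> F2 T2 F' by (rule f2)
  have F0: "F r 0 = F1 r" "F' r 0 = F2 r" if "r \<in> disk" for r using A.mcf B.mcf that by (auto simp: mcf_neumann_def)
  have im': "F r 0 \<in> (\<lambda>r. F' r 0) ` disk" if "r \<in> disk" for r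
  proof -
    have "F r 0 \<in> F2 ` disk" using im that F0(1) by auto
    then show ?thesis using F0(2) by force
  qed
  define h where "h r = inv_into disk (\<lambda>r. F' r 0) (F r 0)" for r
  have h: "h r \<in> disk" "F' (h r) 0 = F r 0" if "r \<in> disk" for r
    unfolding h_def using inv_into_into[OF im'[OF that]] f_inv_into_f[OF im'[OF that]] by auto
  have contF: "continuous_on disk (\<lambda>r. F r 0)" "continuous_on disk (\<lambda>r. F' r 0)"
    using A.spacelike[OF A.zero_in_I] B.spacelike[OF B.zero_in_I] by (auto simp: spacelike_embedding_def intro: smooth_on_continuous)
  have inj: "inj_on (\<lambda>r. F' r 0) disk" using B.spacelike[OF B.zero_in_I] by (simp add: spacelike_embedding_def)
  have "continuous_on ((\<lambda>r. F' r 0) ` disk) (inv_into disk (\<lambda>r. F' r 0))"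
    by (rule continuous_on_inv[OF contF(2) compact_cball]) (use inv_into_f_f[OF inj] in auto)
  then have conth: "continuous_on disk h" unfolding h_def[abs_def]
    by (rule continuous_on_compose2[OF _ contF(1)]) (use im' in auto)
  obtain V W X u where V: "(p, 0) \<in> V" and gc1: "graph_chart \<Omega> \<alpha> F1 T1 F V W X u" by (rule A.chart_exists[OF p A.zero_in_I])
  obtain V' W' X' u' where V': "(h p, 0) \<in> V'" and gc2: "graph_chart \<Omega> \<alpha> F2 T2 F' V' W' X' u'"
    by (rule B.chart_exists[OF h(1)[OF p] B.zero_in_I])
  interpret a: graph_chart \<Omega> \<alpha> F1 T1 F V W X u by (rule gc1)
  interpret b: graph_chart \<Omega> \<alpha> F2 T2 F' V' W' X' u' by (rule gc2)
  have "open ((\<lambda>r. (r, 0 :: real)) -` V')" by (rule open_vimage[OF b.open_V]) (intro continuous_intros)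
  with conth obtain S' where S': "open S'" "S' \<inter> disk = h -` ((\<lambda>r. (r, 0)) -` V') \<inter> disk"
    unfolding continuous_on_open_invariant by blast
  have S'_iff: "r \<in> S' \<longleftrightarrow> (h r, 0) \<in> V'" if "r \<in> disk" for r
    using S'(2) that by (simp add: set_eq_iff) blast
  \<comment> \<open>Continuity of \<open>h\<close> gives a neighbourhood of \<open>p\<close> on
    which both charts can be used at once.\<close>
  define S where "S = S' \<inter> (\<lambda>r. (r, 0)) -` V"
  have oS: "open S" unfolding S_def
    by (intro open_Int S'(1) open_vimage[OF a.open_V] continuous_intros)
  have S: "(r, 0) \<in> V" "(h r, 0) \<in> V'" "r \<in> disk" if "r \<in> disk \<inter> S" for r
    using that S'_iff by (auto simp: S_def)
  have pS: "p \<in> disk \<inter> S" using p V V' S'_iff[OF p] by (auto simp: S_def)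
  have G: "a.G (r, 0) = b.G (h r, 0)" "u (a.G (r, 0)) = u' (a.G (r, 0))" "a.G (r, 0) \<in> W" "a.G (r, 0) \<in> W'" if r: "r \<in> disk \<inter> S" for r
  proof -
    have e: "(X (r, 0), u (X (r, 0), 0)) = (X' (h r, 0), u' (X' (h r, 0), 0))"
      unfolding a.F_graph[OF S(1)[OF r] S(3)[OF r] A.zero_in_I, symmetric]
        b.F_graph[OF S(2)[OF r] h(1)[OF S(3)[OF r]] B.zero_in_I, symmetric]
      by (rule h(2)[OF S(3)[OF r], symmetric])
    then have e': "X (r, 0) = X' (h r, 0)" "u (X (r, 0), 0) = u' (X' (h r, 0), 0)" by auto
    then show 1: "a.G (r, 0) = b.G (h r, 0)" by (simp add: a.G_def b.G_def)
    show "u (a.G (r, 0)) = u' (a.G (r, 0))" using e'(2) unfolding e'(1)[symmetric] by (simp add: a.G_def)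
    show "a.G (r, 0) \<in> W" by (rule a.G_in[OF S(1)[OF r]])
    show "a.G (r, 0) \<in> W'" unfolding 1 by (rule b.G_in[OF S(2)[OF r]])
  qed
  define Z where "Z = W \<inter> W'"
  have Z: "open Z" "Z \<subseteq> W" "Z \<subseteq> W'" using a.open_W b.open_W by (auto simp: Z_def)
  have su: "smooth_in Z u" "smooth_in Z u'" using smooth_in_subset a.smooth_u b.smooth_u Z by blast+
  have GZ: "a.G (r, 0) \<in> Z" if "r \<in> disk \<inter> S" for r using G(3,4)[OF that] by (simp add: Z_def)
  have first: "ddir (c, 0) u (a.G (r, 0)) = ddir (c, 0) u' (a.G (r, 0))" if r: "r \<in> disk \<inter> S" for c r
  proof -
    have "ddir (c, 0) (\<lambda>z. u z - u' z) (a.G (r, 0)) = 0"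
      by (rule a.vanishing_derivative[OF oS smooth_in_diff[OF Z(1) su] _ r]) (use S GZ G(2) in auto)
    then show ?thesis using ddir_diff[OF su GZ[OF r] GZ[OF r]] by simp
  qed
  define z where "z = a.G (p, 0)"
  have second: "ddir (d, 0) (ddir (c, 0) u) z = ddir (d, 0) (ddir (c, 0) u') z" for c d
  proof -
    have "ddir (d, 0) (\<lambda>z. ddir (c, 0) u z - ddir (c, 0) u' z) (a.G (p, 0)) = 0"
      by (rule a.vanishing_derivative[OF oS smooth_in_diff[OF Z(1) smooth_in_ddir[OF su(1)] smooth_in_ddir[OF su(2)]] _ pS])
        (use S GZ first in auto)
    then show ?thesis using ddir_diff[OF smooth_in_ddir[OF su(1)] smooth_in_ddir[OF su(2)] GZ[OF pS] GZ[OF pS]] by (simp add: z_def)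
  qed
  have grad: "grad u z = grad u' z" using first[OF pS] by (simp add: grad_def z_def)
  have tr: "second_trace u z = second_trace u' z" by (simp add: second_trace_def second grad)
  have z': "b.G (h p, 0) = z" using G(1)[OF pS] by (simp add: z_def)
  show thesis
  proof (rule that[OF h(1)[OF p]])
    show "A.tilt p 0 = B.tilt (h p) 0"
      using a.tilt_eq[OF V p A.zero_in_I] b.tilt_eq[OF V' h(1)[OF p] B.zero_in_I] grad
      by (simp add: a.slope_def b.slope_def z' z_def[symmetric])
    \<comment> \<open>The speed is read as \<open>second_trace\<close> and not as u_t, since the
      agreement at time 0 concerns spatial derivatives only.\<close>
    show "A.speed p 0 = B.speed (h p) 0"
      using a.speed_eq_trace[OF V p A.zero_in_I] b.speed_eq_trace[OF V' h(1)[OF p] B.zero_in_I] tr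
      by (simp add: z' z_def[symmetric])
  qed
qed

lemma (in flow) initial_bounds:
  obtains C0 C1 where "\<And>p. p \<in> disk \<Longrightarrow> \<bar>speed p 0\<bar> \<le> C0" "\<And>p. p \<in> disk \<Longrightarrow> tilt p 0 \<le> C1"
proof -
  have sub: "(\<lambda>p. (p, 0)) ` disk \<subseteq> disk \<times> I" using zero_in_I by auto
  have sl: "continuous_on disk (\<lambda>p. (p, 0 :: real))" by (intro continuous_intros)
  have c: "continuous_on disk (\<lambda>p. speed p 0)" "continuous_on disk (\<lambda>p. steepness p 0)"
    using continuous_on_compose2[OF continuous_speed sl sub] continuous_on_compose2[OF continuous_steepness sl sub] by simp_all
  \<comment> \<open>The tilt is recovered from the steepness, whose continuity is already
    known.\<close>
  have ct: "continuous_on disk (\<lambda>p. 1 / sqrt (1 - steepness p 0))"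
  proof (intro continuous_intros c(2) ballI)
    fix p :: "real^2" assume "p \<in> disk"
    then show "sqrt (1 - steepness p 0) \<noteq> 0" using tilt_pos[OF _ zero_in_I, of p] by (simp add: steepness_def)
  qed
  have t: "1 / sqrt (1 - steepness p 0) = tilt p 0" if "p \<in> disk" for p
    using tilt_pos[OF that zero_in_I] by (simp add: steepness_def real_sqrt_divide)
  have bnd: "\<exists>C. \<forall>p\<in>disk. \<bar>g p\<bar> \<le> C" if "continuous_on disk g" for g :: "real^2 \<Rightarrow> real"
    using compact_imp_bounded[OF compact_continuous_image[OF that compact_cball]] unfolding bounded_iff by auto
  obtain C0 where "\<forall>p\<in>disk. \<bar>speed p 0\<bar> \<le> C0" using bnd[OF c(1)] by blast
  moreover obtain C1 where "\<forall>p\<in>disk. \<bar>1 / sqrt (1 - steepness p 0)\<bar> \<le> C1" using bnd[OF ct] by blast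
  then have "\<forall>p\<in>disk. tilt p 0 \<le> C1" using t by (metis abs_le_D1)
  ultimately show thesis by (intro that[of C0 C1]) auto
qed

theorem proposition6:
  fixes \<Omega> :: "(real^2) set"
    and \<alpha> :: "(real^2) \<times> real \<Rightarrow> real"
    and M\<^sub>0 :: "((real^2) \<times> real) set"
  assumes "smooth_convex_domain \<Omega>"
    and "\<forall>x\<in>frontier \<Omega>. 0 < boundary_curvature \<Omega> x"
    and "smooth_on (cylinder \<Omega>) \<alpha>"
    and "graphical_angle \<Omega> \<alpha>"
  shows "\<exists>C. \<forall>F\<^sub>0 T F.
           compatible_initial_embedding \<Omega> \<alpha> F\<^sub>0 \<longrightarrow> F\<^sub>0 ` disk = M\<^sub>0 \<longrightarrow>
           mcf_neumann \<Omega> \<alpha> F\<^sub>0 T F \<longrightarrow>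
           (\<forall>t\<in>time_interval T. \<forall>p\<in>disk. gradient_function (\<lambda>p. F p t) p \<le> C)"
\<comment> \<open>The constant must precede the quantified flows, so its initial bounds are taken
  from one reference flow starting from the given surface; if there is none, nothing has to be
  shown.\<close>
proof (cases "\<exists>F\<^sub>0 T F. F\<^sub>0 ` disk = M\<^sub>0 \<and> mcf_neumann \<Omega> \<alpha> F\<^sub>0 T F")
  case False
  then show ?thesis by blast
next
  case True
  then obtain F\<^sub>1 T\<^sub>1 F' where F': "F\<^sub>1 ` disk = M\<^sub>0" "mcf_neumann \<Omega> \<alpha> F\<^sub>1 T\<^sub>1 F'" by blast
  have f2: "flow \<Omega> \<alpha> F\<^sub>1 T\<^sub>1 F'" by (rule flow.intro[OF F'(2)])
  interpret B: flow \<Omega> \<alpha> F\<^sub>1 T\<^sub>1 F' by (rule f2)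
  obtain C0 C1 where C: "\<And>p. p \<in> disk \<Longrightarrow> \<bar>B.speed p 0\<bar> \<le> C0" "\<And>p. p \<in> disk \<Longrightarrow> B.tilt p 0 \<le> C1"
    by (rule B.initial_bounds) blast
  obtain k A where kA: "k > 0" "A \<ge> 0" "\<And>x. x \<in> frontier \<Omega> \<Longrightarrow> \<exists>N \<rho> a. x \<in> N \<and> boundary_data \<Omega> N \<rho> \<alpha> a k A"
    by (rule uniform_boundary_data[OF assms]) blast
  show ?thesis
  proof (intro exI allI impI ballI)
    fix F\<^sub>0 T F t and p :: "real^2"
    assume F: "F\<^sub>0 ` disk = M\<^sub>0" "mcf_neumann \<Omega> \<alpha> F\<^sub>0 T F" and t: "t \<in> time_interval T" and p: "p \<in> disk"
    have f1: "flow \<Omega> \<alpha> F\<^sub>0 T F" by (rule flow.intro[OF F(2)])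
    interpret A: flow \<Omega> \<alpha> F\<^sub>0 T F by (rule f1)
    interpret A: bounded_flow \<Omega> \<alpha> F\<^sub>0 T F k A
      by unfold_locales (use assms(1) kA in auto)
    have im: "F\<^sub>0 ` disk = F\<^sub>1 ` disk" using F(1) F'(1) by simp
    have "\<bar>A.speed r 0\<bar> \<le> C0" "A.tilt r 0 \<le> C1" if r: "r \<in> disk" for r :: "real^2"
    proof -
      obtain r' where r': "r' \<in> disk" "A.tilt r 0 = B.tilt r' 0" "A.speed r 0 = B.speed r' 0"
        by (rule initial_data_agree[OF f1 f2 im r])
      then show "\<bar>A.speed r 0\<bar> \<le> C0" "A.tilt r 0 \<le> C1" using C by auto
    qed
    from A.tilt_bound[OF this t p]
    show "gradient_function (\<lambda>p. F p t) p \<le> max C1 (2 * (1 + A ^ 2) + 4 * A / k + 4 * A * C0 / k)"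
      by (simp add: A.tilt_def)
  qed
qed

end
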